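(* Let $\mu\in\mathcal{N}$, $\mu\neq 0$. (i) If $S_\mu$ is Einstein then $\mu\in\mathcal{S}_\beta$, where $\beta$ is the only element of $\mathfrak{t}^+$ conjugate to $\frac{4}{\|\mu\|^2}\mathrm{Ric}_\mu$. In such a case, the eigenvalue type of $S_\mu$ is a positive scalar multiple of $\beta+\|\beta\|^2 I$. (ii) If $\mu\in\mathcal{S}_\beta$ ($\beta\in\mathfrak{t}$), then the following conditions are equivalent: (a) $S_\mu$ is Einstein; (b) $\frac{4}{\|\mu\|^2}\mathrm{Ric}_\mu$ is conjugate to $\beta$; (c) $F(\mu)=\|\beta\|^2$.
   Context: $\mathbb{R}^n$ has its canonical inner product $\langle\cdot,\cdot\rangle$ and canonical basis $e_1,\dots,e_n$. $V=\Lambda^2(\mathbb{R}^n)^*\otimes\mathbb{R}^n$ is the space of skew-symmetric bilinear maps $\mathbb{R}^n\times\mathbb{R}^n\to\mathbb{R}^n$, with $\mathrm{GL}_n=\mathrm{GL}_n(\mathbb{R})$ acting by $g.\mu(X,Y)=g\mu(g^{-1}X,g^{-1}Y)$ and inner product $\langle\mu,\lambda\rangle=\sum_{i,j,k}\langle\mu(e_i,e_j),e_k\rangle\langle\lambda(e_i,e_j),e_k\rangle$ (sum over all $i,j,k$). $\mathcal{N}\subset V$ is the subset of nilpotent Lie brackets. $\mathrm{Sym}(n)$ is the space of symmetric $n\times n$ matrices, and matrices carry the inner product $\langle\alpha,\beta\rangle=\mathrm{tr}(\alpha\beta^{t})$. For $\mu\in V$ the symmetric operator $\mathrm{Ric}_\mu$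 on $\mathbb{R}^n$ is defined by $\langle\mathrm{Ric}_\mu X,Y\rangle=-\frac12\sum_{i,j}\langle\mu(X,e_i),e_j\rangle\langle\mu(Y,e_i),e_j\rangle+\frac14\sum_{i,j}\langle\mu(e_i,e_j),X\rangle\langle\mu(e_i,e_j),Y\rangle$; for $\mu\in\mathcal{N}$ it is the Ricci operator of the simply connected nilpotent Lie group with Lie algebra $(\mathbb{R}^n,\mu)$ and the left invariant metric given by $\langle\cdot,\cdot\rangle$. For $\mu\ne0$, $F(\mu)=16\,\mathrm{tr}(\mathrm{Ric}_\mu^2)/\|\mu\|^4$. The solvmanifold $S_\mu$ ($0\ne\mu\in\mathcal{N}$): let $c_\mu=\mathrm{tr}(\mathrm{Ric}_\mu^2)/\mathrm{tr}(\mathrm{Ric}_\mu)$ and let $D_\mu$ be the symmetric derivation $D$ of $(\mathbb{R}^n,\mu)$ with $\mathrm{tr}\,D\ge0$ such that $c_\mu I+\mathrm{tr}(D)D$ is orthogonal to $\mathrm{Der}(\mu)\cap\mathrm{Sym}(n)$ (it is unique; $D_\mu=0$ by convention if all symmetric derivations of $\mu$ are traceless). $S_\mu$ is the simply connected solvable Lie group with Lie algebra $\mathbb{R}H\oplus\mathbb{R}^n$, $[H,X]=D_\mu X$, $[X,Y]=\mu(X,Y)$ for $X,Y\in\mathbb{R}^n$, with the left invariant metric for which $H\perp\mathbb{R}^n$, $\langle H,H\rangle=1$, and which is the canonical inner product on $\mathbb{R}^n$. Eigenvalue type: if $S_\mu$ is Einstein then, for a suitable positive multiple of $H$, the eigenvalues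 of $\mathrm{ad}$ of that multiple restricted to $\mathbb{R}^n$ are positive integers $k_1<\dots<k_r$ without common divisor, with multiplicities $d_1,\dots,d_r$; the tuple $(k_1<\dots<k_r;d_1,\dots,d_r)$ is the eigenvalue type. That it "is a positive scalar multiple of $\beta+\|\beta\|^2I$" means that, for some positive scalar $s$, the eigenvalues of $s(\beta+\|\beta\|^2I)$ are $k_1<\dots<k_r$ with multiplicities $d_1,\dots,d_r$. Strata: $\mathfrak{t}$ is the set of diagonal $n\times n$ real matrices and $\mathfrak{t}^+=\{\mathrm{diag}(a_1,\dots,a_n):a_1\le\dots\le a_n\}$. Let $E_{rs}$ be the matrix with $1$ in entry $rs$ and zeros elsewhere, and for $i<j$ let $\alpha_{ij}^k=E_{kk}-E_{ii}-E_{jj}\in\mathfrak{t}$. Write $\mu(e_i,e_j)=\sum_k\mu_{ij}^ke_k$. For $0\ne\mu\in V$, $\beta_\mu\in\mathfrak{t}$ is the unique vector of minimal norm in the convex hull of $\{\alpha_{ij}^k:i<j,\ \mu_{ij}^k\ne0\}$. For $\beta\in\mathfrak{t}$, $\mathcal{S}_\beta$ is the set of nonzero $\mu\in V$ such that $\beta$ is an element of maximal norm of the finite set $\{\beta_{g.\mu}:g\in\mathrm{GL}_n\}$. *)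

theory Defs
  imports "HOL-Analysis.Analysis"
begin

text \<open>
  The index type \<open>'n :: {finite, linorder}\<close> plays the role of \<open>{1, ..., n}\<close>; the order is needed
  for \<open>i < j\<close> and for the chamber of increasing diagonal matrices. The library inner product on
  \<open>real^'n^'n\<close> is \<open>tr (A B\<^sup>t)\<close>:
\<close>

lemma inner_matrix_eq_trace:
  fixes A B :: "real^'n^'n"
  shows "A \<bullet> B = trace (A ** transpose B)"
  by (simp add: inner_vec_def trace_def matrix_matrix_mult_def transpose_def)

type_synonym 'n bracket = "real^'n \<Rightarrow> real^'n \<Rightarrow> real^'n"
type_synonym 'n sq_mat = "real^'n^'n"

subsection \<open>Skew-symmetric bilinear maps\<close>

definition skew_bilinear :: "'n::finite bracket set" where
  "skew_bilinear = {\<mu>. bilinear \<mu> \<and> (\<forall>X Y. \<mu> X Y = - \<mu> Y X)}"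

definition gl_act :: "real^'n^'n \<Rightarrow> 'n::finite bracket \<Rightarrow> 'n bracket" where
  "gl_act g \<mu> = (\<lambda>X Y. g *v \<mu> (matrix_inv g *v X) (matrix_inv g *v Y))"

definition bracket_inner :: "'n::finite bracket \<Rightarrow> 'n bracket \<Rightarrow> real" where
  "bracket_inner \<mu> \<nu> = (\<Sum>i\<in>UNIV. \<Sum>j\<in>UNIV. \<Sum>k\<in>UNIV.
     (\<mu> (axis i 1) (axis j 1) \<bullet> axis k 1) * (\<nu> (axis i 1) (axis j 1) \<bullet> axis k 1))"

definition bracket_norm :: "'n::finite bracket \<Rightarrow> real" where
  "bracket_norm \<mu> = sqrt (bracket_inner \<mu> \<mu>)"

definition jacobi :: "'n::finite bracket \<Rightarrow> bool" where
  "jacobi \<mu> \<longleftrightarrow> (\<forall>X Y Z. \<mu> X (\<mu> Y Z) + \<mu> Y (\<mu> Z X) + \<mu> Z (\<mu> X Y) = 0)"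

primrec lower_central_series :: "'n::finite bracket \<Rightarrow> nat \<Rightarrow> (real^'n) set" where
  "lower_central_series \<mu> 0 = UNIV"
| "lower_central_series \<mu> (Suc m) = span {\<mu> X Y |X Y. Y \<in> lower_central_series \<mu> m}"

definition nilpotent_brackets :: "'n::finite bracket set" where
  "nilpotent_brackets =
     {\<mu> \<in> skew_bilinear. jacobi \<mu> \<and> (\<exists>m. lower_central_series \<mu> m = {0})}"

subsection \<open>The Ricci operator\<close>

definition ric_form :: "'n::finite bracket \<Rightarrow> real^'n \<Rightarrow> real^'n \<Rightarrow> real" where
  "ric_form \<mu> X Y =
     - (1/2) * (\<Sum>i\<in>UNIV. \<Sum>j\<in>UNIV. (\<mu> X (axis i 1) \<bullet> axis j 1) * (\<mu> Y (axis i 1) \<bullet> axis j 1))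
     + (1/4) * (\<Sum>i\<in>UNIV. \<Sum>j\<in>UNIV. (\<mu> (axis i 1) (axis j 1) \<bullet> X) * (\<mu> (axis i 1) (axis j 1) \<bullet> Y))"

definition Ric :: "'n::finite bracket \<Rightarrow> real^'n^'n" where
  "Ric \<mu> = (\<chi> i j. ric_form \<mu> (axis j 1) (axis i 1))"

lemma Ric_inner:
  assumes "\<mu> \<in> skew_bilinear"
  shows "(Ric \<mu> *v X) \<bullet> Y = ric_form \<mu> X Y"
proof -
  have bil: "bilinear \<mu>" using assms by (simp add: skew_bilinear_def)
  have l: "linear (\<lambda>X. \<mu> X Z)" for Z using bil by (simp add: bilinear_def)
  have lX: "linear (\<lambda>X. ric_form \<mu> X Y)" for Y
    by (rule linearI) (simp_all add: ric_form_def linear_add[OF l] linear_scale[OF l] inner_simps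
        algebra_simps sum.distrib sum_distrib_left)
  have sy: "ric_form \<mu> X Y = ric_form \<mu> Y X" for X Y
    by (simp add: ric_form_def mult.commute)
  have lY: "linear (\<lambda>Y. ric_form \<mu> X Y)" for X
    using lX[of X] sy by presburger
  have X: "X = (\<Sum>j\<in>UNIV. X $ j *\<^sub>R axis j 1)" for X :: "real^'n"
    using basis_expansion[of X] by (simp add: scalar_mult_eq_scaleR)
  have "ric_form \<mu> X Y = ric_form \<mu> (\<Sum>j\<in>UNIV. X $ j *\<^sub>R axis j 1) (\<Sum>i\<in>UNIV. Y $ i *\<^sub>R axis i 1)"
    using X by metis
  also have "\<dots> = (\<Sum>i\<in>UNIV. Y $ i * (\<Sum>j\<in>UNIV. X $ j * ric_form \<mu> (axis j 1) (axis i 1)))"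
    by (simp add: linear_sum[OF lX] linear_sum[OF lY] linear_scale[OF lX] linear_scale[OF lY])
  also have "\<dots> = (Ric \<mu> *v X) \<bullet> Y"
    by (simp add: inner_vec_def Ric_def matrix_vector_mult_def mult.commute)
  finally show ?thesis by simp
qed

definition F_functional :: "'n::finite bracket \<Rightarrow> real" where
  "F_functional \<mu> = 16 * trace (Ric \<mu> ** Ric \<mu>) / bracket_norm \<mu> ^ 4"

subsection \<open>Einstein left invariant metrics\<close>

text \<open>
  A simply connected Lie group with a left invariant metric is given by a Lie bracket on a Euclidean
  space. For left invariant fields \<open>X, Y, Z\<close> the function \<open>\<langle>Y, Z\<rangle>\<close> is constant, so metric
  compatibility \<open>X\<langle>Y, Z\<rangle> = \<langle>\<nabla>\<^sub>X Y, Z\<rangle> + \<langle>Y, \<nabla>\<^sub>X Z\<rangle>\<close> has left-hand side zero. The Levi-Civita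
  connection, the curvature and the Ricci tensor are left invariant, hence determined by their
  values on left invariant fields.
\<close>

definition levi_civita ::
  "('a::euclidean_space \<Rightarrow> 'a \<Rightarrow> 'a) \<Rightarrow> ('a \<Rightarrow> 'a \<Rightarrow> 'a) \<Rightarrow> bool" where
  "levi_civita br nab \<longleftrightarrow> bilinear nab
     \<and> (\<forall>X Y. nab X Y - nab Y X = br X Y)
     \<and> (\<forall>X Y Z. nab X Y \<bullet> Z + Y \<bullet> nab X Z = 0)"

lemma levi_civita_ex1:
  fixes br :: "'a::euclidean_space \<Rightarrow> 'a \<Rightarrow> 'a"
  assumes "bilinear br" and skew: "\<And>X Y. br X Y = - br Y X"
  shows "\<exists>!nab. levi_civita br nab"
proof -
  have l1: "linear (\<lambda>X. br X Y)" and l2: "linear (br Y)" for Y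
    using assms(1) by (simp_all add: bilinear_def)
  define K where "K X Y Z = (br X Y \<bullet> Z - br Y Z \<bullet> X + br Z X \<bullet> Y) / 2" for X Y Z
  define N where "N X Y = (\<Sum>b\<in>Basis. K X Y b *\<^sub>R b)" for X Y
  note lin = linear_add[OF l1] linear_add[OF l2] linear_scale[OF l1] linear_scale[OF l2]
  have K3: "linear (K X Y)" for X Y
    by (rule linearI) (simp_all add: K_def lin inner_add_left inner_add_right field_simps)
  have NK: "N X Y \<bullet> Z = K X Y Z" for X Y Z
  proof -
    have "K X Y Z = K X Y (\<Sum>b\<in>Basis. (Z \<bullet> b) *\<^sub>R b)" by (simp add: euclidean_representation)
    also have "\<dots> = (\<Sum>b\<in>Basis. (Z \<bullet> b) * K X Y b)"
      by (simp add: linear_sum[OF K3] linear_scale[OF K3])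
    also have "\<dots> = N X Y \<bullet> Z"
      by (simp add: N_def inner_sum_left inner_commute[of Z] mult.commute)
    finally show ?thesis by simp
  qed
  have bilN: "bilinear N"
    unfolding bilinear_def
    by (intro conjI allI linearI; rule euclidean_eqI)
      (simp_all add: NK inner_add_left K_def lin inner_simps algebra_simps add_divide_distrib
        diff_divide_distrib)
  have "levi_civita br N"
    unfolding levi_civita_def
  proof (intro conjI allI bilN)
    fix X Y Z
    show "N X Y - N Y X = br X Y"
    proof (rule euclidean_eqI)
      fix b :: 'a
      have s: "br Y X = - br X Y" "br X b = - br b X" "br Y b = - br b Y" by (rule skew)+
      show "(N X Y - N Y X) \<bullet> b = br X Y \<bullet> b"
        by (simp add: inner_diff_left NK K_def s field_simps)
    qed
    have s: "br Z X = - br X Z" "br Z Y = - br Y Z" "br Y X = - br X Y" by (rule skew)+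
    show "N X Y \<bullet> Z + Y \<bullet> N X Z = 0"
      by (simp add: inner_commute[of Y] NK) (simp add: K_def s field_simps)
  qed
  moreover have "nab = N" if lc: "levi_civita br nab" for nab
  proof (intro ext)
    fix X Y
    have t: "nab X Y - nab Y X = br X Y" and m: "nab X Y \<bullet> Z + nab X Z \<bullet> Y = 0" for X Y Z
      using lc by (auto simp: levi_civita_def inner_commute)
    have "nab X Y \<bullet> Z = K X Y Z" for Z
      using m[of X Y Z] m[of Y X Z] m[of Z X Y]
      by (simp add: K_def t[symmetric] inner_diff_left field_simps)
    then have "nab X Y \<bullet> Z = N X Y \<bullet> Z" for Z by (simp add: NK)
    then show "nab X Y = N X Y" by (metis vector_eq_rdot)
  qed
  ultimately show ?thesis by blast
qed

definition curvature ::
  "('a::euclidean_space \<Rightarrow> 'a \<Rightarrow> 'a) \<Rightarrow> ('a \<Rightarrow> 'a \<Rightarrow> 'a) \<Rightarrow> 'a \<Rightarrow> 'a \<Rightarrow> 'a \<Rightarrow> 'a" where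
  "curvature br nab X Y Z = nab X (nab Y Z) - nab Y (nab X Z) - nab (br X Y) Z"

definition ricci_tensor ::
  "('a::euclidean_space \<Rightarrow> 'a \<Rightarrow> 'a) \<Rightarrow> ('a \<Rightarrow> 'a \<Rightarrow> 'a) \<Rightarrow> 'a \<Rightarrow> 'a \<Rightarrow> real" where
  "ricci_tensor br nab Y Z = (\<Sum>b\<in>Basis. curvature br nab b Y Z \<bullet> b)"

definition einstein :: "('a::euclidean_space \<Rightarrow> 'a \<Rightarrow> 'a) \<Rightarrow> bool" where
  "einstein br \<longleftrightarrow>
     (\<exists>nab c. levi_civita br nab \<and> (\<forall>Y Z. ricci_tensor br nab Y Z = c * (Y \<bullet> Z)))"

subsection \<open>The solvmanifold attached to a nilpotent bracket\<close>

definition derivations :: "'n::finite bracket \<Rightarrow> (real^'n^'n) set" where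
  "derivations \<mu> = {D. \<forall>X Y. D *v \<mu> X Y = \<mu> (D *v X) Y + \<mu> X (D *v Y)}"

definition Sym :: "(real^'n^'n) set" where
  "Sym = {A. transpose A = A}"

definition c_const :: "'n::finite bracket \<Rightarrow> real" where
  "c_const \<mu> = trace (Ric \<mu> ** Ric \<mu>) / trace (Ric \<mu>)"

definition D_der :: "'n::finite bracket \<Rightarrow> real^'n^'n" where
  "D_der \<mu> =
     (if \<forall>A \<in> derivations \<mu> \<inter> Sym. trace A = 0 then 0
      else (THE D. D \<in> derivations \<mu> \<inter> Sym \<and> trace D \<ge> 0 \<and>
              (\<forall>A \<in> derivations \<mu> \<inter> Sym.
                 orthogonal (c_const \<mu> *\<^sub>R mat 1 + trace D *\<^sub>R D) A)))"

text \<open>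
  The metric Lie algebra of \<open>S\<^sub>\<mu>\<close> lives on \<open>real \<times> real^'n\<close> with the product inner product; here
  \<open>H = (1, 0)\<close>.
\<close>

definition solv_bracket ::
  "'n::finite bracket \<Rightarrow> real \<times> (real^'n) \<Rightarrow> real \<times> (real^'n) \<Rightarrow> real \<times> (real^'n)" where
  "solv_bracket \<mu> = (\<lambda>(a, X) (b, Y).
     (0, a *\<^sub>R (D_der \<mu> *v Y) - b *\<^sub>R (D_der \<mu> *v X) + \<mu> X Y))"

text \<open>
  Multiplicities are dimensions of eigenspaces; the predicate is only applied to symmetric operators,
  for which these agree with algebraic multiplicities and all eigenvalues are real.
\<close>

definition has_spectrum :: "(real^'n::finite \<Rightarrow> real^'n) \<Rightarrow> nat list \<Rightarrow> nat list \<Rightarrow> bool" where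
  "has_spectrum f ks ds \<longleftrightarrow> sorted_wrt (<) ks \<and> length ds = length ks
     \<and> {l. \<exists>v. v \<noteq> 0 \<and> f v = l *\<^sub>R v} = real ` set ks
     \<and> (\<forall>i < length ks. dim {v. f v = real (ks ! i) *\<^sub>R v} = ds ! i)"

definition eigenvalue_type :: "'n::finite bracket \<Rightarrow> nat list \<Rightarrow> nat list \<Rightarrow> bool" where
  "eigenvalue_type \<mu> ks ds \<longleftrightarrow> (\<forall>k \<in> set ks. 0 < k) \<and> Gcd (set ks) = 1
     \<and> (\<exists>h > 0. has_spectrum (\<lambda>X. snd (solv_bracket \<mu> (h *\<^sub>R (1, 0)) (0, X))) ks ds)"

subsection \<open>Strata\<close>

definition diag_mats :: "(real^'n^'n) set" where
  "diag_mats = {A. \<forall>i j. i \<noteq> j \<longrightarrow> A $ i $ j = 0}"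

definition diag_mats_incr :: "'n::{finite,linorder} sq_mat set" where
  "diag_mats_incr = {A \<in> diag_mats. \<forall>i j. i \<le> j \<longrightarrow> A $ i $ i \<le> A $ j $ j}"

definition E_mat :: "'n \<Rightarrow> 'n \<Rightarrow> real^'n^'n::finite" where
  "E_mat r s = (\<chi> i j. if i = r \<and> j = s then 1 else 0)"

definition alpha :: "'n \<Rightarrow> 'n \<Rightarrow> 'n \<Rightarrow> real^'n^'n::finite" where
  "alpha i j k = E_mat k k - E_mat i i - E_mat j j"

definition weights :: "'n::{finite,linorder} bracket \<Rightarrow> 'n sq_mat set" where
  "weights \<mu> = {alpha i j k |i j k. i < j \<and> \<mu> (axis i 1) (axis j 1) $ k \<noteq> 0}"

definition beta :: "'n::{finite,linorder} bracket \<Rightarrow> 'n sq_mat" where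
  "beta \<mu> = (THE b. b \<in> convex hull weights \<mu> \<and> (\<forall>x \<in> convex hull weights \<mu>. norm b \<le> norm x))"

definition stratum :: "'n::{finite,linorder} sq_mat \<Rightarrow> 'n bracket set" where
  "stratum b = {\<mu> \<in> skew_bilinear. \<mu> \<noteq> (\<lambda>X Y. 0)
     \<and> b \<in> {beta (gl_act g \<mu>) |g. invertible g}
     \<and> (\<forall>x \<in> {beta (gl_act g \<mu>) |g. invertible g}. norm x \<le> norm b)}"

definition conjugate :: "real^'n^'n \<Rightarrow> real^'n^'n::finite \<Rightarrow> bool" where
  "conjugate A B \<longleftrightarrow> (\<exists>P. invertible P \<and> A = P ** B ** matrix_inv P)"

end

theory Submission
  imports Defs
begin

text \<open>
  Put \<open>m(\<mu>) = 4 Ric\<^sub>\<mu> / \<parallel>\<mu>\<parallel>\<^sup>2\<close>, so that \<open>F(\<mu>) = \<parallel>m(\<mu>)\<parallel>\<^sup>2\<close>. The identity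
  \<open>4 \<langle>Ric\<^sub>\<mu>, A\<rangle> = \<langle>\<pi>(A) \<mu>, \<mu>\<rangle>\<close> (\<open>Ric_moment\<close>, with \<open>\<pi>\<close> the infinitesimal action on brackets) says that \<open>m\<close>
  is the moment map of the action of \<open>GL\<^sub>n\<close>. Three facts prove the theorem.

  \<^item> \<open>\<parallel>\<beta>\<^sub>g\<^sub>.\<^sub>\<mu>\<parallel> \<le> \<parallel>m(\<mu>)\<parallel>\<close> for every \<open>g\<close>, and in the case of equality there is an orthogonal \<open>K\<close> with
    \<open>m(K.\<mu>) = \<beta> = \<beta>\<^sub>g\<^sub>.\<^sub>\<mu>\<close> for which \<open>\<beta> + \<parallel>\<beta>\<parallel>\<^sup>2 I\<close> is a derivation of \<open>K.\<mu>\<close> (\<open>norm_beta_le_norm_moment\<close>). Namely, \<open>g\<close> can be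
    replaced by an orthogonal matrix \<open>K\<close> without losing the inequalities \<open>\<parallel>\<beta>\<parallel>\<^sup>2 \<le> \<langle>\<beta>, \<alpha>\<rangle>\<close> for the weights \<open>\<alpha>\<close>
    (\<open>orthogonal_frame_in_half_space\<close>, by Gram-Schmidt). Since the diagonal part of \<open>m(K.\<mu>)\<close> is an average of
    weights, \<open>\<parallel>\<beta>\<parallel>\<^sup>2 \<le> \<langle>\<beta>, m(K.\<mu>)\<rangle>\<close>, and \<open>m(K.\<mu>)\<close> is conjugate to \<open>m(\<mu>)\<close>.

  \<^item> If \<open>Ric\<^sub>\<mu> = c I + D\<close> with a derivation \<open>D\<close> (\<open>soliton\<close>), then the bound is attained. In an orthonormal
    eigenbasis of \<open>Ric\<^sub>\<mu>\<close> the derivation \<open>D\<close> is diagonal, hence orthogonal to all weights, so that \<open>m(K.\<mu>)\<close> has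
    the same inner product with each of them; lying in their convex hull, it is the minimal vector of the
    hull (\<open>soliton_stratum\<close>). With the first fact, being a soliton, conjugacy of \<open>m(\<mu>)\<close> to the
    stratum label, and equality of norms are equivalent (\<open>stratum_equality_iff\<close>).

  \<^item> \<open>S\<^sub>\<mu>\<close> is Einstein if and only if \<open>\<mu>\<close> is a soliton (\<open>einstein_iff_soliton\<close>). The Ricci tensor of \<open>S\<^sub>\<mu>\<close> is
    \<open>Ric\<^sub>\<mu> - tr(D\<^sub>\<mu>) D\<^sub>\<mu>\<close> on \<open>\<real>\<^sup>n\<close> and \<open>- tr(D\<^sub>\<mu>\<^sup>2)\<close> on \<open>H\<close> (\<open>ricci_tensor_solv_bracket\<close>); the mixed terms
    vanish because \<open>tr(D ad X) = 0\<close> for derivations of nilpotent brackets. Conversely, for a soliton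
    the orthogonality of \<open>Ric\<^sub>\<mu>\<close> to all derivations determines \<open>c\<close> and identifies \<open>D\<^sub>\<mu>\<close> as a positive multiple of
    \<open>D\<close>, once it is known that \<open>D\<close> is positive (\<open>soliton_eigenvalue_pos\<close>).

  For the eigenvalue type, \<open>D\<^sub>\<mu>\<close> is a positive multiple of a conjugate of \<open>\<beta> + \<parallel>\<beta>\<parallel>\<^sup>2 I\<close>. Its eigenvalues
  are positive, and up to a common factor they are rational, because \<open>- \<beta> / \<parallel>\<beta>\<parallel>\<^sup>2\<close> is the orthogonal projection
  of \<open>I\<close> onto the span of integral matrices (\<open>rational_minimal_vector\<close>).
\<close>

section \<open>Sums over the standard basis\<close>

abbreviation ax :: "'n \<Rightarrow> real^'n::finite" where
  "ax i \<equiv> axis i 1"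

declare transpose_matrix_vector [simp del]

lemma standard_expansion: "x = (\<Sum>i\<in>UNIV. (x $ i) *\<^sub>R ax i)" for x :: "real^'n"
  using basis_expansion[of x] by (simp add: scalar_mult_eq_scaleR)

lemma inner_standard: "x \<bullet> ax i = x $ i" for x :: "real^'n"
  by (simp add: inner_axis)

lemma parseval: "(\<Sum>i\<in>UNIV. (x \<bullet> ax i) * (y \<bullet> ax i)) = x \<bullet> y" for x y :: "real^'n"
  by (simp only: inner_standard) (simp add: inner_vec_def)

lemma matrix_entry: "A $ i $ j = ax i \<bullet> (A *v ax j)" for A :: "real^'n^'n"
  by (simp add: inner_commute[of "ax i"] inner_standard matrix_vector_mult_basis column_def)

lemma matrix_eq_entries: "(\<And>i j. A $ i $ j = B $ i $ j) \<Longrightarrow> A = B" for A B :: "real^'n^'n"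
  by (simp add: vec_eq_iff)

lemma matrix_column_expansion: "A *v ax i = (\<Sum>a\<in>UNIV. (A $ a $ i) *\<^sub>R ax a)" for A :: "real^'n^'n"
  using standard_expansion[of "A *v ax i"] by (simp add: matrix_vector_mult_basis column_def)

lemma inner_mult_transpose: "(A *v x) \<bullet> y = x \<bullet> (transpose A *v y)" for A :: "real^'n^'n"
  unfolding transpose_matrix_vector inner_commute[of x] dot_lmul_matrix by (rule inner_commute)

lemma trace_eq_inner: "trace A = (\<Sum>i\<in>UNIV. (A *v ax i) \<bullet> ax i)" for A :: "real^'n^'n"
  by (simp add: trace_def inner_standard matrix_vector_mult_basis column_def)

lemma inner_matrix_columns: "A \<bullet> B = (\<Sum>i\<in>UNIV. (A *v ax i) \<bullet> (B *v ax i))" for A B :: "real^'n^'n"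
  unfolding inner_vec_def
  by (subst sum.swap) (simp add: matrix_vector_mult_basis column_def)

lemma trace_scaleR: "trace (c *\<^sub>R A) = c * trace A" for A :: "real^'n^'n"
  by (simp add: trace_def sum_distrib_left)

lemma inner_mat_1: "A \<bullet> mat 1 = trace A" for A :: "real^'n^'n"
  by (simp add: inner_matrix_eq_trace)

lemma mult_scaleR_left: "(c *\<^sub>R A) ** B = c *\<^sub>R (A ** B)" for A B :: "real^'n^'n"
  by (simp add: matrix_eq matrix_vector_mul_assoc[symmetric] scaleR_matrix_vector_assoc[symmetric])

lemma mult_scaleR_right: "A ** (c *\<^sub>R B) = c *\<^sub>R (A ** B)" for A B :: "real^'n^'n"
  by (simp add: matrix_eq matrix_vector_mul_assoc[symmetric] scaleR_matrix_vector_assoc[symmetric]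
      matrix_vector_mult_scaleR)

text \<open>The form in which both the adjoint of the infinitesimal action on brackets and the
  independence of all sums below of the orthonormal basis are used.\<close>

lemma sum_basis_adjoint:
  fixes B :: "real^'n \<Rightarrow> real^'n \<Rightarrow> real"
  assumes "bilinear B"
  shows "(\<Sum>i\<in>UNIV. B (A *v ax i) (ax i)) = (\<Sum>i\<in>UNIV. B (ax i) (transpose A *v ax i))"
proof -
  have l: "linear (\<lambda>x. B x y)" "linear (B x)" for x y
    using assms by (auto simp: bilinear_def)
  have "(\<Sum>i\<in>UNIV. B (A *v ax i) (ax i)) = (\<Sum>i\<in>UNIV. \<Sum>a\<in>UNIV. A $ a $ i * B (ax a) (ax i))"
    by (simp add: matrix_column_expansion linear_sum[OF l(1)] linear_scale[OF l(1)])
  also have "\<dots> = (\<Sum>i\<in>UNIV. \<Sum>a\<in>UNIV. A $ i $ a * B (ax i) (ax a))"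
    by (rule sum.swap)
  also have "\<dots> = (\<Sum>i\<in>UNIV. B (ax i) (transpose A *v ax i))"
    by (simp add: matrix_column_expansion[of "transpose A"] linear_sum[OF l(2)] linear_scale[OF l(2)])
      (simp add: transpose_def)
  finally show ?thesis .
qed

lemma orthogonal_matrix_transpose_mult:
  fixes K :: "real^'n^'n"
  assumes "orthogonal_matrix K"
  shows "transpose K ** K = mat 1" "K ** transpose K = mat 1"
    "transpose K *v (K *v x) = x" "K *v (transpose K *v x) = x"
  using assms by (auto simp: orthogonal_matrix_def matrix_vector_mul_assoc)

lemma sum_basis_orthogonal:
  fixes B :: "real^'n \<Rightarrow> real^'n \<Rightarrow> real"
  assumes B: "bilinear B" and K: "orthogonal_matrix K"
  shows "(\<Sum>i\<in>UNIV. B (K *v ax i) (K *v ax i)) = (\<Sum>i\<in>UNIV. B (ax i) (ax i))"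
proof -
  have "bilinear (\<lambda>x y. B x (K *v y))"
    using B by (auto simp: bilinear_def linear_iff matrix_vector_right_distrib matrix_vector_mult_scaleR)
  from sum_basis_adjoint[OF this, of K] show ?thesis
    by (simp add: orthogonal_matrix_transpose_mult[OF K])
qed

section \<open>The action of matrices on brackets and the moment map\<close>

lemma skew_bilinear_swap: "\<mu> \<in> skew_bilinear \<Longrightarrow> \<mu> X Y = - \<mu> Y X"
  unfolding skew_bilinear_def by blast

lemma skew_bilinearD:
  assumes "\<mu> \<in> skew_bilinear"
  shows "bilinear \<mu>" "\<mu> X X = 0"
    "linear (\<lambda>x. \<mu> x Y)" "linear (\<lambda>x. \<mu> X x)"
    "\<mu> (x + y) z = \<mu> x z + \<mu> y z" "\<mu> z (x + y) = \<mu> z x + \<mu> z y"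
    "\<mu> (c *\<^sub>R x) z = c *\<^sub>R \<mu> x z" "\<mu> z (c *\<^sub>R x) = c *\<^sub>R \<mu> z x"
    "\<mu> 0 z = 0" "\<mu> z 0 = 0"
proof -
  show b: "bilinear \<mu>"
    using assms unfolding skew_bilinear_def by blast
  have "\<mu> X X + \<mu> X X = 0"
    using skew_bilinear_swap[OF assms, of X X] by (simp only: eq_neg_iff_add_eq_0)
  then have "2 *\<^sub>R \<mu> X X = 0" by (simp only: scaleR_2)
  then show "\<mu> X X = 0" by simp
  show "linear (\<lambda>x. \<mu> x Y)" "linear (\<lambda>x. \<mu> X x)"
    "\<mu> (x + y) z = \<mu> x z + \<mu> y z" "\<mu> z (x + y) = \<mu> z x + \<mu> z y"
    "\<mu> (c *\<^sub>R x) z = c *\<^sub>R \<mu> x z" "\<mu> z (c *\<^sub>R x) = c *\<^sub>R \<mu> z x"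
    using b by (auto simp: bilinear_def linear_iff)
  show "\<mu> 0 z = 0" "\<mu> z 0 = 0"
    using b bilinear_lzero bilinear_rzero by blast+
qed

lemma bilinear_zero_on_basis:
  fixes \<mu> :: "'n::finite bracket"
  assumes "bilinear \<mu>" "\<And>i j. \<mu> (ax i) (ax j) = 0"
  shows "\<mu> = (\<lambda>X Y. 0)"
proof (intro ext)
  fix X Y
  have z: "bilinear (\<lambda>(X::real^'n) (Y::real^'n). 0::real^'n)"
    by (auto simp: bilinear_def linear_iff)
  show "\<mu> X Y = 0"
    by (rule bilinear_eq_stdbasis[OF assms(1) z, THEN fun_cong, THEN fun_cong])
      (auto simp: assms(2) Basis_vec_def)
qed

lemma bracket_inner_eq:
  "bracket_inner \<mu> \<nu> = (\<Sum>i\<in>UNIV. \<Sum>j\<in>UNIV. \<mu> (ax i) (ax j) \<bullet> \<nu> (ax i) (ax j))"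
  by (simp only: bracket_inner_def parseval)

lemma ric_form_eq:
  "ric_form \<mu> X Y = - (1/2) * (\<Sum>i\<in>UNIV. \<mu> X (ax i) \<bullet> \<mu> Y (ax i))
     + (1/4) * (\<Sum>i\<in>UNIV. \<Sum>j\<in>UNIV. (\<mu> (ax i) (ax j) \<bullet> X) * (\<mu> (ax i) (ax j) \<bullet> Y))"
  by (simp only: ric_form_def parseval)

lemma bracket_norm_sq: "(bracket_norm \<mu>)\<^sup>2 = bracket_inner \<mu> \<mu>"
  unfolding bracket_norm_def
  by (rule real_sqrt_pow2) (auto simp: bracket_inner_eq intro!: sum_nonneg)

lemma bracket_inner_eq_0:
  assumes "bilinear \<mu>" "bracket_inner \<mu> \<mu> = 0"
  shows "\<mu> = (\<lambda>X Y. 0)"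
proof (rule bilinear_zero_on_basis[OF assms(1)])
  fix i j
  have "\<forall>i\<in>UNIV. (\<Sum>j\<in>UNIV. \<mu> (ax i) (ax j) \<bullet> \<mu> (ax i) (ax j)) = 0"
    using assms(2) unfolding bracket_inner_eq
    by (subst (asm) sum_nonneg_eq_0_iff) (auto intro!: sum_nonneg)
  then have "\<forall>j\<in>UNIV. \<mu> (ax i) (ax j) \<bullet> \<mu> (ax i) (ax j) = 0"
    by (subst (asm) sum_nonneg_eq_0_iff) auto
  then show "\<mu> (ax i) (ax j) = 0" by simp
qed

lemma bracket_norm_pos:
  assumes "\<mu> \<in> skew_bilinear" "\<mu> \<noteq> (\<lambda>X Y. 0)"
  shows "0 < (bracket_norm \<mu>)\<^sup>2"
proof -
  have "bracket_inner \<mu> \<mu> \<noteq> 0"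
    using bracket_inner_eq_0[of \<mu>] assms skew_bilinearD(1) by blast
  moreover have "0 \<le> bracket_inner \<mu> \<mu>"
    by (auto simp: bracket_inner_eq intro!: sum_nonneg)
  ultimately show ?thesis by (simp add: bracket_norm_sq)
qed

text \<open>The derivative of \<^const>\<open>gl_act\<close> at the identity; derivations are the matrices that
  annihilate the bracket.\<close>

definition gl_rep :: "real^'n^'n \<Rightarrow> 'n::finite bracket \<Rightarrow> 'n bracket" where
  "gl_rep A \<mu> = (\<lambda>X Y. A *v \<mu> X Y - \<mu> (A *v X) Y - \<mu> X (A *v Y))"

lemma derivations_gl_rep: "D \<in> derivations \<mu> \<longleftrightarrow> gl_rep D \<mu> = (\<lambda>X Y. 0)"
  by (auto simp: derivations_def gl_rep_def fun_eq_iff algebra_simps)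

lemma bilinear_gl_rep: "bilinear \<mu> \<Longrightarrow> bilinear (gl_rep A \<mu>)"
  by (auto simp: gl_rep_def bilinear_def linear_iff matrix_vector_right_distrib
      matrix_vector_mult_scaleR algebra_simps)

lemma gl_rep_adjoint:
  assumes "bilinear \<mu>" "bilinear \<nu>"
  shows "bracket_inner (gl_rep A \<mu>) \<nu> = bracket_inner \<mu> (gl_rep (transpose A) \<nu>)"
proof -
  have b: "bilinear (\<lambda>x y. \<mu> x z \<bullet> \<nu> y z)" "bilinear (\<lambda>x y. \<mu> z x \<bullet> \<nu> z y)" for z
    using assms by (auto simp: bilinear_def linear_iff inner_simps)
  have 1: "(\<Sum>i\<in>UNIV. \<Sum>j\<in>UNIV. \<mu> (A *v ax i) (ax j) \<bullet> \<nu> (ax i) (ax j))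
     = (\<Sum>i\<in>UNIV. \<Sum>j\<in>UNIV. \<mu> (ax i) (ax j) \<bullet> \<nu> (transpose A *v ax i) (ax j))"
    by (subst (1 2) sum.swap) (simp add: sum_basis_adjoint[OF b(1)])
  have 2: "(\<Sum>i\<in>UNIV. \<Sum>j\<in>UNIV. \<mu> (ax i) (A *v ax j) \<bullet> \<nu> (ax i) (ax j))
     = (\<Sum>i\<in>UNIV. \<Sum>j\<in>UNIV. \<mu> (ax i) (ax j) \<bullet> \<nu> (ax i) (transpose A *v ax j))"
    by (simp add: sum_basis_adjoint[OF b(2)])
  show ?thesis
    unfolding bracket_inner_eq gl_rep_def
    by (simp add: inner_diff_left inner_diff_right sum_subtractf 1 2 inner_mult_transpose)
qed

lemma Ric_symmetric: "transpose (Ric \<mu>) = Ric \<mu>"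
  by (simp add: transpose_def Ric_def vec_eq_iff ric_form_eq inner_commute mult.commute)

text \<open>This identity makes \<open>4 Ric / \<parallel>\<mu>\<parallel>\<^sup>2\<close> the moment map of the action: pairing it with \<open>A\<close> gives the
  derivative of the squared norm of the bracket in the direction \<open>A\<close>.\<close>

lemma Ric_moment:
  assumes \<mu>: "\<mu> \<in> skew_bilinear"
  shows "Ric \<mu> \<bullet> A = 1/4 * bracket_inner (gl_rep A \<mu>) \<mu>"
proof -
  note s = skew_bilinear_swap[OF \<mu>]
  have 1: "(\<Sum>a\<in>UNIV. \<Sum>i\<in>UNIV. \<mu> (ax a) (ax i) \<bullet> \<mu> (A *v ax a) (ax i))
     = bracket_inner (\<lambda>X Y. \<mu> (A *v X) Y) \<mu>"
    by (simp add: bracket_inner_eq inner_commute)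
  have 2: "bracket_inner (\<lambda>X Y. \<mu> X (A *v Y)) \<mu> = bracket_inner (\<lambda>X Y. \<mu> (A *v X) Y) \<mu>"
  proof -
    have "\<mu> X (A *v Y) \<bullet> \<mu> X Y = \<mu> (A *v Y) X \<bullet> \<mu> Y X" for X Y
      using s[of X "A *v Y"] s[of X Y] by simp
    then show ?thesis
      unfolding bracket_inner_eq by (simp only: sum.swap[of "\<lambda>i j. \<mu> (A *v ax j) (ax i) \<bullet> \<mu> (ax j) (ax i)"])
  qed
  have quad: "(\<Sum>a\<in>UNIV. (x \<bullet> ax a) * (x \<bullet> (A *v ax a))) = (A *v x) \<bullet> x" for x
  proof -
    have "x \<bullet> (A *v x) = x \<bullet> (A *v (\<Sum>a\<in>UNIV. (x $ a) *\<^sub>R ax a))"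
      using standard_expansion[of x] by simp
    also have "\<dots> = (\<Sum>a\<in>UNIV. (x \<bullet> ax a) * (x \<bullet> (A *v ax a)))"
      by (simp add: linear_sum[OF matrix_vector_mul_linear] matrix_vector_mult_scaleR inner_sum_right
          inner_standard)
    finally show ?thesis by (simp add: inner_commute)
  qed
  have 3: "(\<Sum>a\<in>UNIV. \<Sum>i\<in>UNIV. \<Sum>j\<in>UNIV. (\<mu> (ax i) (ax j) \<bullet> ax a) * (\<mu> (ax i) (ax j) \<bullet> (A *v ax a)))
     = bracket_inner (\<lambda>X Y. A *v \<mu> X Y) \<mu>"
  proof -
    have "(\<Sum>a\<in>UNIV. \<Sum>i\<in>UNIV. \<Sum>j\<in>UNIV. G a i j) = (\<Sum>i\<in>UNIV. \<Sum>j\<in>UNIV. \<Sum>a\<in>UNIV. G a i j)"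
      for G :: "'n \<Rightarrow> 'n \<Rightarrow> 'n \<Rightarrow> real"
      by (subst sum.swap, rule sum.cong[OF refl], rule sum.swap)
    then show ?thesis
      unfolding bracket_inner_eq by (rule trans) (simp only: quad)
  qed
  have "Ric \<mu> \<bullet> A = (\<Sum>a\<in>UNIV. ric_form \<mu> (ax a) (A *v ax a))"
    by (simp add: inner_matrix_columns Ric_inner[OF \<mu>])
  also have "\<dots> = - (1/2) * bracket_inner (\<lambda>X Y. \<mu> (A *v X) Y) \<mu>
      + 1/4 * bracket_inner (\<lambda>X Y. A *v \<mu> X Y) \<mu>"
    unfolding ric_form_eq sum.distrib sum_distrib_left[symmetric] 1 3 ..
  also have "\<dots> = 1/4 * bracket_inner (gl_rep A \<mu>) \<mu>"
  proof -
    have "bracket_inner (gl_rep A \<mu>) \<mu> = bracket_inner (\<lambda>X Y. A *v \<mu> X Y) \<mu>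
      - bracket_inner (\<lambda>X Y. \<mu> (A *v X) Y) \<mu> - bracket_inner (\<lambda>X Y. \<mu> X (A *v Y)) \<mu>"
      by (simp add: bracket_inner_eq gl_rep_def inner_diff_left sum_subtractf)
    then show ?thesis using 2 by simp
  qed
  finally show ?thesis .
qed

lemma Ric_orthogonal_derivation:
  assumes "\<mu> \<in> skew_bilinear" "D \<in> derivations \<mu>"
  shows "Ric \<mu> \<bullet> D = 0"
  using assms by (simp add: Ric_moment derivations_gl_rep bracket_inner_eq)

lemma trace_Ric:
  assumes "\<mu> \<in> skew_bilinear"
  shows "trace (Ric \<mu>) = - (1/4) * (bracket_norm \<mu>)\<^sup>2"
  using Ric_moment[OF assms, of "mat 1"]
  by (simp add: inner_mat_1 bracket_norm_sq gl_rep_def bracket_inner_eq sum_negf)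

lemma trace_Ric_squared: "trace (Ric \<mu> ** Ric \<mu>) = Ric \<mu> \<bullet> Ric \<mu>"
  by (simp add: inner_matrix_eq_trace Ric_symmetric)

subsection \<open>Change of basis\<close>

lemma matrix_inv_mult:
  fixes g :: "real^'n^'n"
  assumes "invertible g"
  shows "g ** matrix_inv g = mat 1" "matrix_inv g ** g = mat 1"
    "g *v (matrix_inv g *v x) = x" "matrix_inv g *v (g *v x) = x"
proof -
  show a: "g ** matrix_inv g = mat 1" "matrix_inv g ** g = mat 1"
    using someI_ex[OF assms[unfolded invertible_def]] by (simp_all add: matrix_inv_def)
  then show "g *v (matrix_inv g *v x) = x" "matrix_inv g *v (g *v x) = x"
    by (simp_all add: matrix_vector_mul_assoc)
qed

lemma matrix_inv_eqI:
  fixes g h :: "real^'n^'n"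
  assumes "g ** h = mat 1"
  shows "matrix_inv g = h" "invertible g"
proof -
  have h: "h ** g = mat 1" using assms matrix_left_right_inverse by blast
  then show "invertible g" using assms invertible_def by blast
  then show "matrix_inv g = h"
    by (metis h matrix_inv_mult(1) matrix_mul_assoc matrix_mul_lid matrix_mul_rid)
qed

lemma invertible_orthogonal: "orthogonal_matrix K \<Longrightarrow> invertible K" for K :: "real^'n^'n"
  using matrix_inv_eqI(2) orthogonal_matrix_def by blast

lemma matrix_inv_orthogonal: "orthogonal_matrix K \<Longrightarrow> matrix_inv K = transpose K" for K :: "real^'n^'n"
  using matrix_inv_eqI(1) orthogonal_matrix_def by blast

lemma gl_act_skew_bilinear:
  assumes "\<mu> \<in> skew_bilinear"
  shows "gl_act g \<mu> \<in> skew_bilinear"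
  unfolding skew_bilinear_def
proof (intro CollectI conjI allI)
  show "bilinear (gl_act g \<mu>)"
    by (auto simp: gl_act_def bilinear_def linear_iff matrix_vector_right_distrib
      matrix_vector_mult_scaleR skew_bilinearD[OF assms])
  show "gl_act g \<mu> X Y = - gl_act g \<mu> Y X" for X Y
    unfolding gl_act_def skew_bilinear_swap[OF assms, of _ "matrix_inv g *v Y"]
    by (rule linear_neg[OF matrix_vector_mul_linear])
qed

lemma gl_act_inverse: "invertible g \<Longrightarrow> \<mu> X Y = matrix_inv g *v gl_act g \<mu> (g *v X) (g *v Y)"
  by (simp add: gl_act_def matrix_inv_mult)

lemma gl_act_nonzero:
  assumes "invertible g" "\<mu> \<noteq> (\<lambda>X Y. 0)"
  shows "gl_act g \<mu> \<noteq> (\<lambda>X Y. 0)"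
proof
  assume "gl_act g \<mu> = (\<lambda>X Y. 0)"
  then have "\<mu> X Y = 0" for X Y using gl_act_inverse[OF assms(1), of \<mu> X Y] by simp
  then show False using assms(2) by blast
qed

lemma derivations_gl_act:
  assumes "invertible g" "D \<in> derivations \<mu>"
  shows "g ** D ** matrix_inv g \<in> derivations (gl_act g \<mu>)"
  using assms
  by (simp add: derivations_def gl_act_def matrix_vector_mul_assoc[symmetric] matrix_inv_mult
      matrix_vector_right_distrib)

lemma derivations_gl_act_iff:
  assumes g: "invertible g"
  shows "g ** D ** matrix_inv g \<in> derivations (gl_act g \<mu>) \<longleftrightarrow> D \<in> derivations \<mu>"
proof
  assume "g ** D ** matrix_inv g \<in> derivations (gl_act g \<mu>)"
  then have "(g ** D ** matrix_inv g) *v gl_act g \<mu> (g *v X) (g *v Y) =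
      gl_act g \<mu> ((g ** D ** matrix_inv g) *v (g *v X)) (g *v Y)
      + gl_act g \<mu> (g *v X) ((g ** D ** matrix_inv g) *v (g *v Y))" for X Y
    by (simp add: derivations_def)
  then have "g *v (D *v \<mu> X Y) = g *v (\<mu> (D *v X) Y + \<mu> X (D *v Y))" for X Y
    by (simp add: gl_act_def matrix_vector_mul_assoc[symmetric] matrix_inv_mult g
        matrix_vector_right_distrib)
  then have "D *v \<mu> X Y = \<mu> (D *v X) Y + \<mu> X (D *v Y)" for X Y
    using matrix_inv_mult(4)[OF g] by metis
  then show "D \<in> derivations \<mu>"
    by (simp add: derivations_def)
qed (rule derivations_gl_act[OF g])

lemma ric_form_gl_act_orthogonal:
  assumes \<mu>: "\<mu> \<in> skew_bilinear" and K: "orthogonal_matrix K"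
  shows "ric_form (gl_act K \<mu>) X Y = ric_form \<mu> (transpose K *v X) (transpose K *v Y)"
proof -
  have K': "orthogonal_matrix (transpose K)" using K by simp
  note sw = skew_bilinearD[OF \<mu>]
  have bil: "bilinear (\<lambda>u v. \<mu> (transpose K *v X) u \<bullet> \<mu> (transpose K *v Y) v)"
    "bilinear (\<lambda>u v. (\<mu> u w \<bullet> X') * (\<mu> v w \<bullet> Y'))"
    "bilinear (\<lambda>u v. (\<mu> w u \<bullet> X') * (\<mu> w v \<bullet> Y'))" for w X' Y'
    by (auto simp: bilinear_def linear_iff sw inner_simps algebra_simps)
  have q: "gl_act K \<mu> U V \<bullet> Z = \<mu> (transpose K *v U) (transpose K *v V) \<bullet> (transpose K *v Z)" for U V Z
    by (simp add: gl_act_def matrix_inv_orthogonal[OF K] inner_mult_transpose)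
  have q': "gl_act K \<mu> U V \<bullet> gl_act K \<mu> U' V'
      = \<mu> (transpose K *v U) (transpose K *v V) \<bullet> \<mu> (transpose K *v U') (transpose K *v V')" for U V U' V'
    by (simp add: q) (simp add: gl_act_def matrix_inv_orthogonal[OF K] orthogonal_matrix_transpose_mult[OF K])
  have "(\<Sum>i\<in>UNIV. \<Sum>j\<in>UNIV. (\<mu> (transpose K *v ax i) (transpose K *v ax j) \<bullet> X') * (\<mu> (transpose K *v ax i) (transpose K *v ax j) \<bullet> Y'))
      = (\<Sum>i\<in>UNIV. \<Sum>j\<in>UNIV. (\<mu> (ax i) (ax j) \<bullet> X') * (\<mu> (ax i) (ax j) \<bullet> Y'))" for X' Y'
    by (simp only: sum_basis_orthogonal[OF bil(3) K'])
      (subst sum.swap, simp only: sum_basis_orthogonal[OF bil(2) K'], rule sum.swap)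
  then show ?thesis
    unfolding ric_form_eq q' unfolding q by (simp only: sum_basis_orthogonal[OF bil(1) K'])
qed

lemma Ric_gl_act_orthogonal:
  assumes \<mu>: "\<mu> \<in> skew_bilinear" and K: "orthogonal_matrix K"
  shows "Ric (gl_act K \<mu>) = K ** Ric \<mu> ** transpose K"
proof (rule matrix_eq_entries)
  fix i j
  show "Ric (gl_act K \<mu>) $ i $ j = (K ** Ric \<mu> ** transpose K) $ i $ j"
    unfolding matrix_entry[of _ i j] inner_commute[of "ax i"] matrix_vector_mul_assoc[symmetric]
      inner_mult_transpose[of K] Ric_inner[OF gl_act_skew_bilinear[OF \<mu>]] Ric_inner[OF \<mu>]
    by (rule ric_form_gl_act_orthogonal[OF \<mu> K])
qed

lemma trace_conj_orthogonal:
  fixes A :: "real^'n^'n"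
  assumes "orthogonal_matrix K"
  shows "trace (K ** A ** transpose K) = trace A"
  by (metis assms matrix_mul_assoc matrix_mul_lid orthogonal_matrix_transpose_mult(1) trace_mul_sym)

lemma bracket_norm_gl_act_orthogonal:
  assumes \<mu>: "\<mu> \<in> skew_bilinear" and K: "orthogonal_matrix K"
  shows "(bracket_norm (gl_act K \<mu>))\<^sup>2 = (bracket_norm \<mu>)\<^sup>2"
proof -
  have "trace (Ric (gl_act K \<mu>)) = trace (Ric \<mu>)"
    unfolding Ric_gl_act_orthogonal[OF \<mu> K] by (rule trace_conj_orthogonal[OF K])
  then show ?thesis
    unfolding trace_Ric[OF \<mu>] trace_Ric[OF gl_act_skew_bilinear[OF \<mu>, of K]] by simp
qed

section \<open>Orthonormal bases adapted to a matrix or to a flag\<close>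

lemma orthogonal_matrix_rows:
  "orthogonal_matrix K \<longleftrightarrow> (\<forall>i j. K $ i \<bullet> K $ j = (if i = j then 1 else 0))"
  for K :: "real^'n^'n"
proof -
  have "orthogonal_matrix K \<longleftrightarrow> K ** transpose K = mat 1"
    by (metis matrix_left_right_inverse orthogonal_matrix)
  also have "\<dots> \<longleftrightarrow> (\<forall>i j. K $ i \<bullet> K $ j = (if i = j then 1 else 0))"
    by (simp add: vec_eq_iff matrix_matrix_mult_def transpose_def mat_def inner_vec_def)
  finally show ?thesis .
qed

lemma transpose_mult_axis: "transpose K *v ax i = K $ i" for K :: "real^'n^'n"
  by (simp add: matrix_vector_mult_basis column_def transpose_def vec_eq_iff)

lemma conj_transpose_entry: "(K ** A ** transpose K) $ i $ j = K $ i \<bullet> (A *v K $ j)"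
  for A K :: "real^'n^'n"
proof -
  have "(K ** A ** transpose K) $ i $ j = (transpose K *v ax i) \<bullet> (A *v (transpose K *v ax j))"
    by (simp add: matrix_entry[of _ i j] matrix_vector_mul_assoc[symmetric] inner_mult_transpose)
  then show ?thesis by (simp add: transpose_mult_axis)
qed

lemma compact_orthogonal_matrices: "compact {K :: real^'n^'n. orthogonal_matrix K}"
proof -
  have "closed {K :: real^'n^'n. \<forall>i j. K $ i \<bullet> K $ j = (if i = j then 1 else 0)}"
    by (intro closed_Collect_all closed_Collect_eq continuous_intros)
  then have "closed {K :: real^'n^'n. orthogonal_matrix K}"
    by (simp add: orthogonal_matrix_rows)
  moreover have "norm K \<le> sqrt (real CARD('n))" if "orthogonal_matrix K" for K :: "real^'n^'n"
    using that by (simp add: norm_eq_sqrt_inner[of K] inner_vec_def[of K] orthogonal_matrix_rows)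
  then have "bounded {K :: real^'n^'n. orthogonal_matrix K}"
    by (auto simp: bounded_iff)
  ultimately show ?thesis by (simp add: compact_eq_bounded_closed)
qed

text \<open>Maximise \<open>\<Sum>\<^sub>i w\<^sub>i \<langle>A k\<^sub>i, k\<^sub>i\<rangle>\<close> over orthonormal bases \<open>k\<close>, with strictly increasing weights
  \<open>w\<close>. Rotating a maximiser in the plane of \<open>k\<^sub>p, k\<^sub>q\<close> cannot increase the sum: a small
  rotation shows that the entry \<open>\<langle>A k\<^sub>p, k\<^sub>q\<rangle>\<close> vanishes, a quarter turn that the diagonal entries are
  in increasing order.\<close>

lemma symmetric_diagonalization:
  fixes A :: "'n::{finite,linorder} sq_mat"
  assumes A: "transpose A = A"
  obtains K where "orthogonal_matrix K" "K ** A ** transpose K \<in> diag_mats_incr"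
proof -
  define w :: "'n \<Rightarrow> real" where "w i = real (card {j. j < i})" for i
  have w: "w q < w p" if "q < p" for p q
    unfolding w_def using that by (auto intro!: psubset_card_mono)
  define f where "f K = (\<Sum>i\<in>UNIV. w i * (K $ i \<bullet> (A *v K $ i)))" for K :: "'n sq_mat"
  have "continuous_on {K :: 'n sq_mat. orthogonal_matrix K} f"
    unfolding f_def
    by (intro continuous_intros linear_continuous_on_compose[OF _ matrix_vector_mul_linear])
  then obtain K where K: "orthogonal_matrix K" and max: "\<And>L. orthogonal_matrix L \<Longrightarrow> f L \<le> f K"
    using continuous_attains_sup[OF compact_orthogonal_matrices] orthogonal_matrix_id by blast
  have KK: "K $ i \<bullet> K $ j = (if i = j then 1 else 0)" for i j
    using K by (simp add: orthogonal_matrix_rows)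
  have sy: "x \<bullet> (A *v y) = y \<bullet> (A *v x)" for x y
    by (metis A inner_commute inner_mult_transpose)
  have rotation: "s\<^sup>2 * (K $ q \<bullet> (A *v K $ q) - K $ p \<bullet> (A *v K $ p))
      + 2 * c * s * (K $ p \<bullet> (A *v K $ q)) \<le> 0"
    if "q < p" and cs: "c\<^sup>2 + s\<^sup>2 = 1" for p q c s
  proof -
    have pq: "p \<noteq> q" "q \<noteq> p" using that by auto
    define L where "L = (\<chi> i. if i = p then c *\<^sub>R K $ p + s *\<^sub>R K $ q
        else if i = q then c *\<^sub>R K $ q - s *\<^sub>R K $ p else K $ i)"
    have L: "L $ p = c *\<^sub>R K $ p + s *\<^sub>R K $ q" "L $ q = c *\<^sub>R K $ q - s *\<^sub>R K $ p"
      "\<And>i. i \<noteq> p \<Longrightarrow> i \<noteq> q \<Longrightarrow> L $ i = K $ i"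
      using pq by (auto simp: L_def)
    have cs': "c * c + s * s = 1" using cs by (simp add: power2_eq_square)
    have "L $ i \<bullet> L $ j = (if i = j then 1 else 0)" for i j
      using pq cs' by (cases "i = p"; cases "i = q"; cases "j = p"; cases "j = q")
        (auto simp: L KK inner_simps algebra_simps)
    then have "f L \<le> f K" by (intro max) (simp add: orthogonal_matrix_rows)
    moreover have split: "f M = w p * (M $ p \<bullet> (A *v M $ p)) + w q * (M $ q \<bullet> (A *v M $ q))
        + (\<Sum>i\<in>UNIV - {p} - {q}. w i * (M $ i \<bullet> (A *v M $ i)))" for M
      using pq unfolding f_def by (subst sum.remove[of _ p]) (auto simp: sum.remove[of _ q])
    moreover have "(\<Sum>i\<in>UNIV - {p} - {q}. w i * (L $ i \<bullet> (A *v L $ i)))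
        = (\<Sum>i\<in>UNIV - {p} - {q}. w i * (K $ i \<bullet> (A *v K $ i)))"
      by (rule sum.cong) (auto simp: L)
    ultimately have "w p * (L $ p \<bullet> (A *v L $ p)) + w q * (L $ q \<bullet> (A *v L $ q))
        \<le> w p * (K $ p \<bullet> (A *v K $ p)) + w q * (K $ q \<bullet> (A *v K $ q))"
      by simp
    moreover define a b d where "a = K $ p \<bullet> (A *v K $ p)" and "b = K $ p \<bullet> (A *v K $ q)"
      and "d = K $ q \<bullet> (A *v K $ q)"
    moreover have "K $ q \<bullet> (A *v K $ p) = b" using sy b_def by simp
    ultimately have "w p * (c\<^sup>2 * a + 2 * c * s * b + s\<^sup>2 * d)
        + w q * (s\<^sup>2 * a - 2 * c * s * b + c\<^sup>2 * d) \<le> w p * a + w q * d"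
      by (simp add: L inner_simps matrix_vector_right_distrib matrix_vector_mult_diff_distrib
          matrix_vector_mult_scaleR power2_eq_square algebra_simps)
    moreover have "c\<^sup>2 = 1 - s\<^sup>2" using cs by simp
    ultimately have "(w p - w q) * (s\<^sup>2 * (d - a) + 2 * c * s * b) \<le> 0"
      by (simp add: algebra_simps)
    then have "s\<^sup>2 * (d - a) + 2 * c * s * b \<le> 0"
      using w[OF \<open>q < p\<close>] by (simp add: mult_le_0_iff)
    then show ?thesis by (simp add: a_def b_def d_def)
  qed
  have incr: "K $ q \<bullet> (A *v K $ q) \<le> K $ p \<bullet> (A *v K $ p)" if "q < p" for p q
    using rotation[OF that, of 0 1] by simp
  have offdiag: "K $ p \<bullet> (A *v K $ q) = 0" if "q < p" for p q
  proof (rule ccontr)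
    define b e where "b = K $ p \<bullet> (A *v K $ q)"
      and "e = K $ p \<bullet> (A *v K $ p) - K $ q \<bullet> (A *v K $ q)"
    assume "K $ p \<bullet> (A *v K $ q) \<noteq> 0"
    then have b: "b \<noteq> 0" by (simp add: b_def)
    have e: "0 \<le> e" using incr[OF that] by (simp add: e_def)
    \<comment> \<open>rotate by the angle with tangent \<open>t\<close>; this \<open>t\<close> makes the linear term dominate the quadratic one\<close>
    define t where "t = b / (e + 1)"
    define c where "c = 1 / sqrt (1 + t\<^sup>2)"
    have pos: "0 < 1 + t\<^sup>2" by (simp add: add_pos_nonneg)
    have c2: "c\<^sup>2 = 1 / (1 + t\<^sup>2)" using pos by (simp add: c_def power_divide)
    then have "c\<^sup>2 * (1 + t\<^sup>2) = 1" using pos by simp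
    then have "c\<^sup>2 + (t * c)\<^sup>2 = 1" by (simp add: algebra_simps power2_eq_square)
    from rotation[OF that this] have "c\<^sup>2 * (2 * t * b - t\<^sup>2 * e) \<le> 0"
      by (simp add: b_def e_def algebra_simps power2_eq_square)
    moreover have "0 < c\<^sup>2" using c2 pos by simp
    ultimately have "2 * t * b - t\<^sup>2 * e \<le> 0" by (metis mult_pos_pos not_le)
    moreover have "b = t * (e + 1)" using e by (simp add: t_def)
    ultimately have "t\<^sup>2 * (e + 2) \<le> 0" by (simp add: power2_eq_square algebra_simps)
    moreover have "t \<noteq> 0" using b e by (simp add: t_def)
    ultimately show False using e by (simp add: mult_le_0_iff)
  qed
  have "K ** A ** transpose K \<in> diag_mats_incr"
    unfolding diag_mats_incr_def diag_mats_def mem_Collect_eq conj_transpose_entry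
  proof (intro conjI allI impI)
    fix i j :: 'n
    show "K $ i \<bullet> (A *v K $ j) = 0" if "i \<noteq> j"
      using that offdiag[of i j] offdiag[of j i] sy[of "K $ i" "K $ j"]
      by (cases i j rule: linorder_cases) auto
    show "K $ i \<bullet> (A *v K $ i) \<le> K $ j \<bullet> (A *v K $ j)" if "i \<le> j"
      using that incr[of i j] by (cases "i = j") auto
  qed
  with K show ?thesis using that by blast
qed

text \<open>Gram-Schmidt, run through the basis \<open>h\<close> in order of decreasing \<open>f\<close>. Each vector is
  obtained from \<open>h\<^sub>i\<close> by subtracting the orthogonal projection onto the span of all earlier vectors of \<open>h\<close>,
  so that the vectors can be chosen independently of each other; ties of \<open>f\<close> are broken by the order of
  the indices.\<close>

lemma gram_schmidt_decreasing:
  fixes h :: "'n::{finite,linorder} \<Rightarrow> (real, 'n) vec" and f :: "'n \<Rightarrow> real"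
  assumes ind: "independent (range h)" and inj: "inj h"
  obtains K where "orthogonal_matrix K"
    "\<And>i. transpose K *v ax i \<in> span {h a |a. f i \<le> f a}"
    "\<And>i a. f i < f a \<Longrightarrow> (transpose K *v ax i) \<bullet> h a = 0"
proof -
  define before where "before a i \<longleftrightarrow> f i < f a \<or> (f i = f a \<and> a < i)" for a i
  have "\<exists>u. u \<in> span {h a |a. before a i \<or> a = i} \<and> (\<forall>w\<in>span {h a |a. before a i}. u \<bullet> w = 0)
      \<and> u \<noteq> 0" for i
  proof -
    obtain y z where y: "y \<in> span {h a |a. before a i}"
      and z: "\<And>w. w \<in> span {h a |a. before a i} \<Longrightarrow> orthogonal z w" and hi: "h i = y + z"
      by (rule orthogonal_subspace_decomp_exists[of "{h a |a. before a i}" "h i"]) (rule that)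
    have "{h a |a. before a i} \<subseteq> range h - {h i}"
      using inj by (auto simp: before_def dest: injD)
    from span_mono[OF this] have "h i \<notin> span {h a |a. before a i}"
      using ind by (auto simp: dependent_def)
    then have "z \<noteq> 0" using y hi by auto
    moreover have "z \<in> span {h a |a. before a i \<or> a = i}"
    proof -
      have "h i \<in> span {h a |a. before a i \<or> a = i}" by (rule span_base) blast
      moreover have "y \<in> span {h a |a. before a i \<or> a = i}"
        using y span_mono[of "{h a |a. before a i}" "{h a |a. before a i \<or> a = i}"] by blast
      moreover have "z = h i - y" using hi by simp
      ultimately show ?thesis by (simp add: span_diff)
    qed
    ultimately show ?thesis using z by (auto simp: orthogonal_def)
  qed
  then have "\<forall>i. \<exists>u. u \<in> span {h a |a. before a i \<or> a = i}
      \<and> (\<forall>w\<in>span {h a |a. before a i}. u \<bullet> w = 0) \<and> u \<noteq> 0" by blast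
  from choice[OF this] obtain u where u: "\<And>i. u i \<in> span {h a |a. before a i \<or> a = i}"
      and uo: "\<And>i w. w \<in> span {h a |a. before a i} \<Longrightarrow> u i \<bullet> w = 0" and u0: "\<And>i. u i \<noteq> 0"
    by blast
  have uu: "u i \<bullet> u j = 0" if "before j i" for i j
  proof -
    have "{h a |a. before a j \<or> a = j} \<subseteq> {h a |a. before a i}"
      using that by (auto simp: before_def)
    from span_mono[OF this] show ?thesis using uo u[of j] by blast
  qed
  have total: "before i j \<or> before j i" if "i \<noteq> j" for i j
    using that by (auto simp: before_def)
  define K where "K = (\<chi> i. (1 / norm (u i)) *\<^sub>R u i)"
  have K: "transpose K *v ax i = (1 / norm (u i)) *\<^sub>R u i" for i
    by (simp add: transpose_mult_axis K_def)
  have "K $ i \<bullet> K $ j = (if i = j then 1 else 0)" for i j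
  proof (cases "i = j")
    case True
    then show ?thesis using u0[of j] by (simp add: K_def norm_eq_sqrt_inner)
  next
    case False
    then show ?thesis using total[OF False] uu[of i j] uu[of j i] by (auto simp: K_def inner_commute)
  qed
  then have "orthogonal_matrix K" by (simp add: orthogonal_matrix_rows)
  moreover have "transpose K *v ax i \<in> span {h a |a. f i \<le> f a}" for i
  proof -
    have "{h a |a. before a i \<or> a = i} \<subseteq> {h a |a. f i \<le> f a}" by (auto simp: before_def)
    from span_mono[OF this] have "u i \<in> span {h a |a. f i \<le> f a}" using u[of i] by blast
    then show ?thesis unfolding K by (rule span_scale)
  qed
  moreover have "(transpose K *v ax i) \<bullet> h a = 0" if "f i < f a" for i a
  proof -
    have "h a \<in> span {h a |a. before a i}" using that by (intro span_base) (auto simp: before_def)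
    then show ?thesis unfolding K using uo by simp
  qed
  ultimately show ?thesis using that by blast
qed

section \<open>Weights of a bracket and the minimal vector of their convex hull\<close>

lemma inner_E_mat: "B \<bullet> E_mat r s = B $ r $ s"
proof -
  have "B \<bullet> E_mat r s = (\<Sum>i\<in>UNIV. \<Sum>j\<in>UNIV. if i = r then (if j = s then B $ i $ j else 0) else 0)"
    unfolding inner_vec_def E_mat_def by (intro sum.cong) auto
  also have "\<dots> = (\<Sum>i\<in>UNIV. if i = r then B $ i $ s else 0)"
    by (rule sum.cong) auto
  finally show ?thesis by simp
qed

lemma inner_alpha: "B \<bullet> alpha i j k = B $ k $ k - B $ i $ i - B $ j $ j"
  by (simp add: alpha_def inner_diff_right inner_E_mat)

lemma alpha_commute: "alpha i j k = alpha j i k"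
  by (simp add: alpha_def)

lemma trace_alpha: "mat 1 \<bullet> alpha i j k = -1"
  by (simp add: inner_alpha mat_def)

lemma subspace_diag_mats: "subspace diag_mats"
  by (auto simp: subspace_def diag_mats_def)

lemma alpha_diag: "alpha i j k \<in> diag_mats"
  by (auto simp: alpha_def diag_mats_def E_mat_def)

lemma diag_mats_eqI:
  assumes "A \<in> diag_mats" "B \<in> diag_mats" "\<And>C. C \<in> diag_mats \<Longrightarrow> A \<bullet> C = B \<bullet> C"
  shows "A = B"
proof -
  have "A - B \<in> diag_mats" using subspace_diff[OF subspace_diag_mats] assms by blast
  then have "(A - B) \<bullet> (A - B) = 0" using assms(3) by (simp add: inner_diff_left)
  then show ?thesis by simp
qed

lemma diag_mult_axis: "B \<in> diag_mats \<Longrightarrow> B *v ax i = (B $ i $ i) *\<^sub>R ax i"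
  unfolding matrix_vector_mult_basis by (auto simp: column_def vec_eq_iff diag_mats_def axis_def)

lemma weights_iff: "\<mu> \<in> skew_bilinear \<Longrightarrow> \<mu> (ax i) (ax j) $ k \<noteq> 0 \<Longrightarrow> alpha i j k \<in> weights \<mu>"
proof -
  assume \<mu>: "\<mu> \<in> skew_bilinear" and nz: "\<mu> (ax i) (ax j) $ k \<noteq> 0"
  have "\<mu> (ax j) (ax i) $ k \<noteq> 0" using nz skew_bilinear_swap[OF \<mu>, of "ax i" "ax j"] by auto
  moreover have "i \<noteq> j" using nz skew_bilinearD(2)[OF \<mu>] by auto
  ultimately show "alpha i j k \<in> weights \<mu>"
    using nz unfolding weights_def mem_Collect_eq by (metis alpha_commute linorder_neqE)
qed

lemma finite_weights: "finite (weights \<mu>)"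
proof (rule finite_subset)
  show "weights \<mu> \<subseteq> range (\<lambda>p. alpha (fst p) (fst (snd p)) (snd (snd p)))"
  proof
    fix x assume "x \<in> weights \<mu>"
    then obtain i j k where "x = alpha i j k" by (auto simp: weights_def)
    then show "x \<in> range (\<lambda>p. alpha (fst p) (fst (snd p)) (snd (snd p)))"
      by (intro range_eqI[of _ _ "(i, j, k)"]) simp
  qed
qed simp

lemma weights_nonempty:
  assumes "\<mu> \<in> skew_bilinear" "\<mu> \<noteq> (\<lambda>X Y. 0)"
  shows "weights \<mu> \<noteq> {}"
proof
  assume "weights \<mu> = {}"
  then have "\<mu> (ax i) (ax j) = 0" for i j
    using weights_iff[OF assms(1), of i j] by (auto simp: vec_eq_iff)
  then show False using assms bilinear_zero_on_basis skew_bilinearD(1) by blast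
qed

lemma hull_weights_diag: "convex hull weights \<mu> \<subseteq> diag_mats"
proof (rule hull_minimal)
  show "weights \<mu> \<subseteq> diag_mats" using alpha_diag by (auto simp: weights_def)
  show "convex (diag_mats :: 'a sq_mat set)" by (rule subspace_imp_convex[OF subspace_diag_mats])
qed

lemma hull_weights_inner_const:
  assumes "\<And>x. x \<in> weights \<mu> \<Longrightarrow> b \<bullet> x = c" "x \<in> convex hull weights \<mu>"
  shows "b \<bullet> x = c"
proof -
  have "convex hull weights \<mu> \<subseteq> {x. b \<bullet> x = c}"
    using assms(1) by (intro hull_minimal) (auto simp: convex_hyperplane)
  then show ?thesis using assms(2) by auto
qed

lemma beta_eqI:
  assumes b: "b \<in> convex hull weights \<mu>" "\<And>x. x \<in> convex hull weights \<mu> \<Longrightarrow> norm b \<le> norm x"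
  shows "beta \<mu> = b"
  unfolding beta_def
proof (rule the_equality)
  have "closed (convex hull weights \<mu>)"
    by (simp add: finite_weights compact_imp_closed finite_imp_compact_convex_hull)
  then show "c = b" if "c \<in> convex hull weights \<mu> \<and> (\<forall>x\<in>convex hull weights \<mu>. norm c \<le> norm x)" for c
    using that b by (intro any_closest_point_unique[where a = 0 and S = "convex hull weights \<mu>"]) auto
qed (use b in blast)

lemma beta_minimal:
  assumes "weights \<mu> \<noteq> {}"
  shows "beta \<mu> \<in> convex hull weights \<mu>"
    "x \<in> convex hull weights \<mu> \<Longrightarrow> (norm (beta \<mu>))\<^sup>2 \<le> beta \<mu> \<bullet> x"
proof -
  have cl: "closed (convex hull weights \<mu>)"
    by (simp add: finite_weights compact_imp_closed finite_imp_compact_convex_hull)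
  obtain b where b: "b \<in> convex hull weights \<mu>" "\<forall>x\<in>convex hull weights \<mu>. dist 0 b \<le> dist 0 x"
    using distance_attains_inf[OF cl] assms by (metis convex_hull_eq_empty)
  have eq: "beta \<mu> = b" using b by (intro beta_eqI) auto
  then show "beta \<mu> \<in> convex hull weights \<mu>" using b by simp
  show "(norm (beta \<mu>))\<^sup>2 \<le> beta \<mu> \<bullet> x" if "x \<in> convex hull weights \<mu>"
    using any_closest_point_dot[OF convex_convex_hull cl b(1) that b(2)]
    by (simp add: eq inner_diff_right power2_norm_eq_inner)
qed

subsection \<open>The moment map against diagonal matrices\<close>

definition moment :: "'n::finite bracket \<Rightarrow> real^'n^'n" where
  "moment \<mu> = (4 / bracket_norm \<mu> ^ 2) *\<^sub>R Ric \<mu>"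

lemma sum_squares_bracket: "(\<Sum>i\<in>UNIV. \<Sum>j\<in>UNIV. \<Sum>k\<in>UNIV. (\<mu> (ax i) (ax j) $ k)\<^sup>2) = (bracket_norm \<mu>)\<^sup>2"
  unfolding bracket_norm_sq bracket_inner_eq inner_vec_def by (simp add: power2_eq_square)

lemma gl_rep_diag:
  assumes "\<mu> \<in> skew_bilinear" "B \<in> diag_mats"
  shows "gl_rep B \<mu> (ax i) (ax j) $ k = (B \<bullet> alpha i j k) * \<mu> (ax i) (ax j) $ k"
proof -
  have "(B *v x) $ k = B $ k $ k * x $ k" for x
  proof -
    have "(B *v x) $ k = (\<Sum>j\<in>UNIV. if j = k then B $ k $ k * x $ k else 0)"
      unfolding matrix_vector_mult_def vec_lambda_beta
      using assms(2) by (intro sum.cong) (auto simp: diag_mats_def)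
    then show ?thesis by simp
  qed
  then show ?thesis
    by (simp add: gl_rep_def diag_mult_axis[OF assms(2)] skew_bilinearD[OF assms(1)] inner_alpha
        algebra_simps)
qed

lemma diag_derivation_iff:
  assumes \<mu>: "\<mu> \<in> skew_bilinear" and B: "B \<in> diag_mats"
  shows "B \<in> derivations \<mu> \<longleftrightarrow> (\<forall>i j k. \<mu> (ax i) (ax j) $ k \<noteq> 0 \<longrightarrow> B \<bullet> alpha i j k = 0)"
proof -
  have "gl_rep B \<mu> = (\<lambda>X Y. 0) \<longleftrightarrow> (\<forall>i j. gl_rep B \<mu> (ax i) (ax j) = 0)"
    using bilinear_zero_on_basis[OF bilinear_gl_rep[OF skew_bilinearD(1)[OF \<mu>], of B]] by auto
  also have "\<dots> \<longleftrightarrow> (\<forall>i j k. gl_rep B \<mu> (ax i) (ax j) $ k = 0)"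
    by (simp add: vec_eq_iff)
  finally show ?thesis
    by (auto simp: derivations_gl_rep gl_rep_diag[OF \<mu> B])
qed

lemma moment_inner_diag:
  assumes \<mu>: "\<mu> \<in> skew_bilinear" "\<mu> \<noteq> (\<lambda>X Y. 0)" and B: "B \<in> diag_mats"
  shows "(bracket_norm \<mu>)\<^sup>2 * (moment \<mu> \<bullet> B)
    = (\<Sum>i\<in>UNIV. \<Sum>j\<in>UNIV. \<Sum>k\<in>UNIV. (\<mu> (ax i) (ax j) $ k)\<^sup>2 * (B \<bullet> alpha i j k))"
proof -
  have "(bracket_norm \<mu>)\<^sup>2 * (moment \<mu> \<bullet> B) = 4 * (Ric \<mu> \<bullet> B)"
    using bracket_norm_pos[OF \<mu>] by (simp add: moment_def)
  also have "\<dots> = bracket_inner (gl_rep B \<mu>) \<mu>" by (simp add: Ric_moment[OF \<mu>(1)])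
  also have "\<dots> = (\<Sum>i\<in>UNIV. \<Sum>j\<in>UNIV. \<Sum>k\<in>UNIV. (\<mu> (ax i) (ax j) $ k)\<^sup>2 * (B \<bullet> alpha i j k))"
    unfolding bracket_inner_eq inner_vec_def[of "gl_rep B \<mu> _ _"]
    by (simp add: gl_rep_diag[OF \<mu>(1) B] power2_eq_square mult_ac)
  finally show ?thesis .
qed

text \<open>The diagonal part of the moment map is an average of the weights, each weight occurring
  with the square of the structure constant to which it belongs.\<close>

lemma moment_in_hull_weights:
  assumes \<mu>: "\<mu> \<in> skew_bilinear" "\<mu> \<noteq> (\<lambda>X Y. 0)" and diag: "moment \<mu> \<in> diag_mats"
  shows "moment \<mu> \<in> convex hull weights \<mu>"
proof -
  define N where "N = (bracket_norm \<mu>)\<^sup>2"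
  have N: "0 < N" unfolding N_def by (rule bracket_norm_pos[OF \<mu>])
  define c where "c = (\<lambda>(i, j, k). (\<mu> (ax i) (ax j) $ k)\<^sup>2 / N)"
  define al where "al = (\<lambda>(i, j, k). alpha i j k :: 'a sq_mat)"
  define S where "S = {p. c p \<noteq> 0}"
  have triple: "(\<Sum>i\<in>UNIV. \<Sum>j\<in>UNIV. \<Sum>k\<in>UNIV. G (i, j, k)) = (\<Sum>p\<in>UNIV. G p)"
    for G :: "'a \<times> 'a \<times> 'a \<Rightarrow> 'b::comm_monoid_add"
    unfolding UNIV_Times_UNIV[symmetric] sum.cartesian_product' by (rule refl)
  have to_S: "(\<Sum>p\<in>UNIV. G p) = (\<Sum>p\<in>S. G p)" if "\<And>p. c p = 0 \<Longrightarrow> G p = 0"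
    for G :: "'a \<times> 'a \<times> 'a \<Rightarrow> 'b::comm_monoid_add"
    by (rule sum.mono_neutral_right) (auto simp: S_def that)
  have "sum c UNIV = 1"
    using sum_squares_bracket[of \<mu>] N triple[of c]
    by (simp add: c_def sum_divide_distrib[symmetric] N_def)
  then have c1: "sum c S = 1" using to_S[of c] by simp
  have "al p \<in> convex hull weights \<mu>" if "p \<in> S" for p
    using that weights_iff[OF \<mu>(1)] by (cases p) (simp add: S_def c_def al_def hull_inc)
  then have "(\<Sum>p\<in>S. c p *\<^sub>R al p) \<in> convex hull weights \<mu>"
    using N by (intro convex_sum c1) (auto simp: c_def)
  moreover have "moment \<mu> = (\<Sum>p\<in>UNIV. c p *\<^sub>R al p)"
  proof (rule diag_mats_eqI[OF diag])
    show "(\<Sum>p\<in>UNIV. c p *\<^sub>R al p) \<in> diag_mats"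
      by (intro subspace_sum subspace_scale subspace_diag_mats) (auto simp: al_def alpha_diag)
    fix B :: "'a sq_mat" assume "B \<in> diag_mats"
    from moment_inner_diag[OF \<mu> this] N
    have "moment \<mu> \<bullet> B = (\<Sum>i\<in>UNIV. \<Sum>j\<in>UNIV. \<Sum>k\<in>UNIV. (\<mu> (ax i) (ax j) $ k)\<^sup>2 * (B \<bullet> alpha i j k)) / N"
      by (simp add: N_def field_simps)
    also have "\<dots> = (\<Sum>i\<in>UNIV. \<Sum>j\<in>UNIV. \<Sum>k\<in>UNIV. (c (i, j, k) *\<^sub>R al (i, j, k)) \<bullet> B)"
      by (simp add: sum_divide_distrib c_def al_def inner_commute[of B])
    also have "\<dots> = (\<Sum>p\<in>UNIV. c p *\<^sub>R al p) \<bullet> B"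
      using triple[of "\<lambda>p. (c p *\<^sub>R al p) \<bullet> B"] by (simp add: inner_sum_left)
    finally show "moment \<mu> \<bullet> B = (\<Sum>p\<in>UNIV. c p *\<^sub>R al p) \<bullet> B" .
  qed
  ultimately show ?thesis using to_S[of "\<lambda>p. c p *\<^sub>R al p"] by simp
qed

section \<open>The moment map bounds the stratum label\<close>

lemma matrix_cancel:
  fixes A P K :: "real^'n^'n"
  shows "invertible P \<Longrightarrow> A ** P ** matrix_inv P = A" "invertible P \<Longrightarrow> A ** matrix_inv P ** P = A"
    "orthogonal_matrix K \<Longrightarrow> A ** K ** transpose K = A"
    "orthogonal_matrix K \<Longrightarrow> A ** transpose K ** K = A"
  by (simp_all add: matrix_mul_assoc[symmetric] matrix_inv_mult orthogonal_matrix_transpose_mult)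

lemma matrix_add_rdistrib: "(A + B) ** C = A ** C + B ** C" for A B C :: "real^'n^'n"
  by (simp add: matrix_eq matrix_vector_mul_assoc[symmetric] matrix_vector_mult_add_rdistrib)

lemma norm_conj_orthogonal:
  fixes A K :: "real^'n^'n"
  assumes K: "orthogonal_matrix K"
  shows "norm (K ** A ** transpose K) = norm A"
proof -
  have "(K ** A ** transpose K) ** transpose (K ** A ** transpose K) = K ** (A ** transpose A) ** transpose K"
    by (simp add: matrix_transpose_mul matrix_mul_assoc matrix_cancel(4)[OF K])
  then have "(K ** A ** transpose K) \<bullet> (K ** A ** transpose K) = A \<bullet> A"
    by (simp add: inner_matrix_eq_trace trace_conj_orthogonal[OF K])
  then show ?thesis by (simp add: norm_eq_sqrt_inner)
qed

lemma moment_symmetric: "transpose (moment \<mu>) = moment \<mu>"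
  by (simp add: moment_def transpose_scalar Ric_symmetric)

lemma moment_gl_act_orthogonal:
  assumes "\<mu> \<in> skew_bilinear" "orthogonal_matrix K"
  shows "moment (gl_act K \<mu>) = K ** moment \<mu> ** transpose K"
  by (simp add: moment_def bracket_norm_gl_act_orthogonal[OF assms] Ric_gl_act_orthogonal[OF assms]
      mult_scaleR_left mult_scaleR_right)

lemma F_functional_eq_norm_moment: "F_functional \<mu> = (norm (moment \<mu>))\<^sup>2"
  by (simp add: F_functional_def moment_def trace_Ric_squared power2_norm_eq_inner[symmetric]
      power_mult_distrib power_divide flip: power_mult)

text \<open>A lower bound \<open>r \<le> \<langle>b, \<alpha>\<rangle>\<close> for all weights says that the bracket is compatible with the
  filtration of \<open>\<real>\<^sup>n\<close> by sums of eigenspaces of \<open>b\<close>. A change of basis moves the filtration, and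
  an orthonormal basis adapted to the moved filtration restores the bound; so the matrix that realises
  the label can be replaced by an orthogonal one.\<close>

lemma orthogonal_frame_in_half_space:
  fixes \<mu> :: "'n::{finite,linorder} bracket"
  assumes \<mu>: "\<mu> \<in> skew_bilinear" and g: "invertible g"
    and r: "\<And>i j k. gl_act g \<mu> (ax i) (ax j) $ k \<noteq> 0 \<Longrightarrow> r \<le> b \<bullet> alpha i j k"
  shows "\<exists>K. orthogonal_matrix K
    \<and> (\<forall>i j k. gl_act K \<mu> (ax i) (ax j) $ k \<noteq> 0 \<longrightarrow> r \<le> b \<bullet> alpha i j k)"
proof -
  define h where "h a = matrix_inv g *v ax a" for a
  define f where "f a = b $ a $ a" for a
  note sw = skew_bilinearD[OF \<mu>]
  have inj_g: "inj ((*v) (matrix_inv g))"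
    by (rule injI) (metis g matrix_inv_mult(3))
  have inj: "inj h"
  proof (rule injI)
    show "a = c" if "h a = h c" for a c
      using injD[OF inj_g, of "ax a" "ax c"] that by (simp add: h_def axis_eq_axis)
  qed
  have "independent ((*v) (matrix_inv g) ` Basis)"
    by (intro linear_independent_injective_image matrix_vector_mul_linear independent_Basis
        inj_on_subset[OF inj_g] subset_UNIV)
  moreover have "(*v) (matrix_inv g) ` Basis = range h"
    by (auto simp: Basis_vec_def h_def)
  ultimately have ind: "independent (range h)" by simp
  obtain K where K: "orthogonal_matrix K"
    and up: "\<And>i. transpose K *v ax i \<in> span {h a |a. f i \<le> f a}"
    and perp: "\<And>i a. f i < f a \<Longrightarrow> (transpose K *v ax i) \<bullet> h a = 0"
    by (rule gram_schmidt_decreasing[OF ind inj, of f]) (rule that)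
  define U where "U s = span {h l |l. s \<le> f l}" for s
  have Usub: "subspace (U s)" for s by (simp add: U_def)
  have U_anti: "s \<le> t \<Longrightarrow> U t \<subseteq> U s" for s t
    unfolding U_def by (rule span_mono) auto
  have base: "\<mu> (h a) (h c) \<in> U (f a + f c + r)" for a c
  proof -
    define x where "x = gl_act g \<mu> (ax a) (ax c)"
    have "\<mu> (h a) (h c) = matrix_inv g *v x"
      by (simp add: x_def gl_act_def h_def matrix_inv_mult[OF g])
    also have "\<dots> = (\<Sum>l\<in>UNIV. (x $ l) *\<^sub>R h l)"
      by (subst standard_expansion[of x])
        (simp add: linear_sum[OF matrix_vector_mul_linear] matrix_vector_mult_scaleR h_def)
    also have "\<dots> \<in> U (f a + f c + r)"
    proof (rule subspace_sum[OF Usub])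
      fix l
      show "(x $ l) *\<^sub>R h l \<in> U (f a + f c + r)"
      proof (cases "x $ l = 0")
        case False
        then have "r \<le> f l - f a - f c" using r[of a c l] by (simp add: x_def f_def inner_alpha)
        then have "h l \<in> U (f a + f c + r)" unfolding U_def by (intro span_base) auto
        then show ?thesis by (rule subspace_scale[OF Usub])
      qed (simp add: subspace_0[OF Usub])
    qed
    finally show ?thesis .
  qed
  have step: "\<mu> x (h c) \<in> U (s + f c + r)" if "x \<in> U s" for x s c
  proof -
    have "U s \<subseteq> {x. \<mu> x (h c) \<in> U (s + f c + r)}"
      unfolding U_def[of s]
    proof (rule span_minimal)
      show "subspace {x. \<mu> x (h c) \<in> U (s + f c + r)}"
        using Usub by (auto simp: subspace_def sw)
      show "{h l |l. s \<le> f l} \<subseteq> {x. \<mu> x (h c) \<in> U (s + f c + r)}"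
      proof safe
        fix l assume "s \<le> f l"
        then have "U (f l + f c + r) \<subseteq> U (s + f c + r)" by (intro U_anti) simp
        then show "\<mu> (h l) (h c) \<in> U (s + f c + r)" using base[of l c] by blast
      qed
    qed
    then show ?thesis using that by blast
  qed
  have filtered: "\<mu> x y \<in> U (s + t + r)" if x: "x \<in> U s" and y: "y \<in> U t" for x y s t
  proof -
    have "U t \<subseteq> {y. \<mu> x y \<in> U (s + t + r)}"
      unfolding U_def[of t]
    proof (rule span_minimal)
      show "subspace {y. \<mu> x y \<in> U (s + t + r)}"
        using Usub by (auto simp: subspace_def sw)
      show "{h l |l. t \<le> f l} \<subseteq> {y. \<mu> x y \<in> U (s + t + r)}"
      proof safe
        fix l assume "t \<le> f l"
        then have "U (s + f l + r) \<subseteq> U (s + t + r)" by (intro U_anti) simp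
        then show "\<mu> x (h l) \<in> U (s + t + r)" using step[OF x, of l] by blast
      qed
    qed
    then show ?thesis using y by blast
  qed
  have "r \<le> b \<bullet> alpha i j k" if nz: "gl_act K \<mu> (ax i) (ax j) $ k \<noteq> 0" for i j k
  proof (rule ccontr)
    assume "\<not> r \<le> b \<bullet> alpha i j k"
    then have less: "f k < f i + f j + r" by (simp add: inner_alpha f_def)
    have "\<mu> (transpose K *v ax i) (transpose K *v ax j) \<in> U (f i + f j + r)"
      by (rule filtered) (simp_all add: U_def up)
    then have "orthogonal (transpose K *v ax k) (\<mu> (transpose K *v ax i) (transpose K *v ax j))"
      unfolding U_def
      by (rule orthogonal_to_span) (use less perp in \<open>auto simp: orthogonal_def\<close>)
    moreover have "gl_act K \<mu> (ax i) (ax j) $ k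
        = \<mu> (transpose K *v ax i) (transpose K *v ax j) \<bullet> (transpose K *v ax k)"
      by (simp add: gl_act_def matrix_inv_orthogonal[OF K] inner_mult_transpose flip: inner_standard)
    ultimately show False using nz by (simp add: orthogonal_def inner_commute)
  qed
  with K show ?thesis by blast
qed

text \<open>The number \<open>\<langle>m, b\<rangle>\<close> is an average of the numbers \<open>\<langle>\<alpha>, b\<rangle>\<close>, each weight \<open>\<alpha>\<close> counted with the square
  of its structure constant.\<close>

lemma moment_inner_lower_bound:
  assumes \<mu>: "\<mu> \<in> skew_bilinear" "\<mu> \<noteq> (\<lambda>X Y. 0)" and B: "b \<in> diag_mats"
    and r: "\<And>i j k. \<mu> (ax i) (ax j) $ k \<noteq> 0 \<Longrightarrow> r \<le> b \<bullet> alpha i j k"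
  shows "r \<le> moment \<mu> \<bullet> b"
    "moment \<mu> \<bullet> b = r \<Longrightarrow> \<mu> (ax i) (ax j) $ k \<noteq> 0 \<Longrightarrow> b \<bullet> alpha i j k = r"
proof -
  define c where "c i j k = (\<mu> (ax i) (ax j) $ k)\<^sup>2 * (b \<bullet> alpha i j k - r)" for i j k
  have c: "0 \<le> c i j k" for i j k
    using r[of i j k] by (cases "\<mu> (ax i) (ax j) $ k = 0") (auto simp: c_def)
  have N: "0 < (bracket_norm \<mu>)\<^sup>2" by (rule bracket_norm_pos[OF \<mu>])
  have "(\<Sum>i\<in>UNIV. \<Sum>j\<in>UNIV. \<Sum>k\<in>UNIV. c i j k)
      = (\<Sum>i\<in>UNIV. \<Sum>j\<in>UNIV. \<Sum>k\<in>UNIV. (\<mu> (ax i) (ax j) $ k)\<^sup>2 * (b \<bullet> alpha i j k))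
        - (\<Sum>i\<in>UNIV. \<Sum>j\<in>UNIV. \<Sum>k\<in>UNIV. (\<mu> (ax i) (ax j) $ k)\<^sup>2) * r"
    by (simp add: c_def right_diff_distrib sum_subtractf sum_distrib_right)
  then have eq: "(\<Sum>i\<in>UNIV. \<Sum>j\<in>UNIV. \<Sum>k\<in>UNIV. c i j k) = (bracket_norm \<mu>)\<^sup>2 * (moment \<mu> \<bullet> b - r)"
    unfolding sum_squares_bracket moment_inner_diag[OF \<mu> B, symmetric] by (simp add: right_diff_distrib)
  have "0 \<le> (\<Sum>i\<in>UNIV. \<Sum>j\<in>UNIV. \<Sum>k\<in>UNIV. c i j k)"
    by (intro sum_nonneg c)
  then show "r \<le> moment \<mu> \<bullet> b" using N unfolding eq by (simp add: zero_le_mult_iff)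
  assume "moment \<mu> \<bullet> b = r" and nz: "\<mu> (ax i) (ax j) $ k \<noteq> 0"
  then have "(\<Sum>i\<in>UNIV. \<Sum>j\<in>UNIV. \<Sum>k\<in>UNIV. c i j k) = 0" using eq by simp
  then have "\<forall>i\<in>UNIV. (\<Sum>j\<in>UNIV. \<Sum>k\<in>UNIV. c i j k) = 0"
    by (subst (asm) sum_nonneg_eq_0_iff) (auto intro!: sum_nonneg c)
  then have "(\<Sum>j\<in>UNIV. \<Sum>k\<in>UNIV. c i j k) = 0" by blast
  then have "\<forall>j\<in>UNIV. (\<Sum>k\<in>UNIV. c i j k) = 0"
    by (subst (asm) sum_nonneg_eq_0_iff) (auto intro!: sum_nonneg c)
  then have "(\<Sum>k\<in>UNIV. c i j k) = 0" by blast
  then have "\<forall>k\<in>UNIV. c i j k = 0"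
    by (subst (asm) sum_nonneg_eq_0_iff) (auto intro!: c)
  then show "b \<bullet> alpha i j k = r" using nz by (auto simp: c_def)
qed

lemma beta_inner_weight:
  assumes "\<mu> \<in> skew_bilinear" "\<mu> (ax i) (ax j) $ k \<noteq> 0"
  shows "(norm (beta \<mu>))\<^sup>2 \<le> beta \<mu> \<bullet> alpha i j k"
proof -
  have w: "alpha i j k \<in> weights \<mu>" by (rule weights_iff[OF assms])
  then have "weights \<mu> \<noteq> {}" by blast
  from beta_minimal(2)[OF this hull_inc[OF w]] show ?thesis .
qed

lemma beta_diag:
  assumes "\<mu> \<in> skew_bilinear" "\<mu> \<noteq> (\<lambda>X Y. 0)"
  shows "beta \<mu> \<in> diag_mats"
  using beta_minimal(1)[OF weights_nonempty[OF assms]] hull_weights_diag by blast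

text \<open>In the orthogonal frame just constructed, the moment map \<open>m\<close> satisfies \<open>\<parallel>b\<parallel>\<^sup>2 \<le> \<langle>m, b\<rangle>\<close> for the label
  \<open>b\<close>. Cauchy-Schwarz gives the bound, and in the case of equality \<open>m = b\<close>; then the average
  \<open>\<langle>m, b\<rangle>\<close> of the numbers \<open>\<langle>\<alpha>, b\<rangle>\<close> equals their lower bound, so that all of them are equal and
  \<open>b + \<parallel>b\<parallel>\<^sup>2 I\<close> is orthogonal to all weights, which makes it a derivation.\<close>

lemma norm_beta_le_norm_moment:
  assumes \<mu>: "\<mu> \<in> skew_bilinear" "\<mu> \<noteq> (\<lambda>X Y. 0)" and g: "invertible g"
  defines "b \<equiv> beta (gl_act g \<mu>)"
  shows "norm b \<le> norm (moment \<mu>)"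
    and "norm (moment \<mu>) = norm b \<Longrightarrow> \<exists>K. orthogonal_matrix K \<and> moment (gl_act K \<mu>) = b
        \<and> b + (norm b)\<^sup>2 *\<^sub>R mat 1 \<in> derivations (gl_act K \<mu>)"
proof -
  have gs: "gl_act g \<mu> \<in> skew_bilinear" by (rule gl_act_skew_bilinear[OF \<mu>(1)])
  have bd: "b \<in> diag_mats" unfolding b_def by (rule beta_diag[OF gs gl_act_nonzero[OF g \<mu>(2)]])
  have "\<exists>K. orthogonal_matrix K
      \<and> (\<forall>i j k. gl_act K \<mu> (ax i) (ax j) $ k \<noteq> 0 \<longrightarrow> (norm b)\<^sup>2 \<le> b \<bullet> alpha i j k)"
    by (rule orthogonal_frame_in_half_space[OF \<mu>(1) g])
      (rule beta_inner_weight[OF gs, folded b_def])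
  then obtain K where K: "orthogonal_matrix K"
    and w: "\<And>i j k. gl_act K \<mu> (ax i) (ax j) $ k \<noteq> 0 \<Longrightarrow> (norm b)\<^sup>2 \<le> b \<bullet> alpha i j k"
    by blast
  define m where "m = moment (gl_act K \<mu>)"
  have Ks: "gl_act K \<mu> \<in> skew_bilinear" "gl_act K \<mu> \<noteq> (\<lambda>X Y. 0)"
    by (rule gl_act_skew_bilinear[OF \<mu>(1)], rule gl_act_nonzero[OF invertible_orthogonal[OF K] \<mu>(2)])
  have mb: "(norm b)\<^sup>2 \<le> m \<bullet> b"
    unfolding m_def by (rule moment_inner_lower_bound(1)[OF Ks bd w])
  have nm: "norm (moment \<mu>) = norm m"
    by (simp add: m_def moment_gl_act_orthogonal[OF \<mu>(1) K] norm_conj_orthogonal[OF K])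
  have "norm b * norm b \<le> norm m * norm b"
    using mb norm_cauchy_schwarz[of m b] by (simp add: power2_eq_square)
  then show "norm b \<le> norm (moment \<mu>)"
    unfolding nm by (cases "b = 0") auto
  assume "norm (moment \<mu>) = norm b"
  then have "m \<bullet> m = b \<bullet> b" using nm by (simp add: norm_eq_sqrt_inner)
  then have "(m - b) \<bullet> (m - b) \<le> 0"
    using mb by (simp add: inner_diff_left inner_diff_right inner_commute power2_norm_eq_inner)
  then have "(m - b) \<bullet> (m - b) = 0" using inner_ge_zero[of "m - b"] by linarith
  then have m: "m = b" by simp
  then have const: "gl_act K \<mu> (ax i) (ax j) $ k \<noteq> 0 \<Longrightarrow> b \<bullet> alpha i j k = (norm b)\<^sup>2" for i j k
    using moment_inner_lower_bound(2)[OF Ks bd w] by (simp add: m_def power2_norm_eq_inner)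
  have "b + (norm b)\<^sup>2 *\<^sub>R mat 1 \<in> diag_mats"
    using bd by (auto simp: diag_mats_def mat_def)
  then have "b + (norm b)\<^sup>2 *\<^sub>R mat 1 \<in> derivations (gl_act K \<mu>)"
    by (simp add: diag_derivation_iff[OF Ks(1)] inner_add_left const trace_alpha)
  with K m show "\<exists>K. orthogonal_matrix K \<and> moment (gl_act K \<mu>) = b
        \<and> b + (norm b)\<^sup>2 *\<^sub>R mat 1 \<in> derivations (gl_act K \<mu>)"
    unfolding m_def by blast
qed

text \<open>A diagonal derivation is orthogonal to all weights, and \<open>\<langle>I, \<alpha>\<rangle> = -1\<close>; so \<open>\<langle>m, \<cdot>\<rangle>\<close> is constantly \<open>t\<close>
  on the weights and on their convex hull. As \<open>m\<close> belongs to the hull, it is the minimal vector.\<close>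

lemma beta_eq_of_derivation:
  assumes \<mu>: "\<mu> \<in> skew_bilinear" "\<mu> \<noteq> (\<lambda>X Y. 0)" and diag: "moment \<mu> \<in> diag_mats"
    and D: "moment \<mu> + t *\<^sub>R mat 1 \<in> derivations \<mu>"
  shows "beta \<mu> = moment \<mu>" and "t = (norm (moment \<mu>))\<^sup>2"
    and "\<And>x. x \<in> weights \<mu> \<Longrightarrow> moment \<mu> \<bullet> x = t"
proof -
  have "moment \<mu> + t *\<^sub>R mat 1 \<in> diag_mats"
    using diag by (auto simp: diag_mats_def mat_def)
  then have "\<mu> (ax i) (ax j) $ k \<noteq> 0 \<Longrightarrow> moment \<mu> \<bullet> alpha i j k = t" for i j k
    using D by (simp add: diag_derivation_iff[OF \<mu>(1)] inner_add_left trace_alpha)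
  then show w: "moment \<mu> \<bullet> x = t" if "x \<in> weights \<mu>" for x
    using that by (auto simp: weights_def)
  have h: "moment \<mu> \<bullet> x = t" if "x \<in> convex hull weights \<mu>" for x
    using hull_weights_inner_const[OF w that] .
  note mem = moment_in_hull_weights[OF \<mu> diag]
  show t: "t = (norm (moment \<mu>))\<^sup>2" using h[OF mem] by (simp add: power2_norm_eq_inner)
  show "beta \<mu> = moment \<mu>"
  proof (rule beta_eqI[OF mem])
    fix x assume "x \<in> convex hull weights \<mu>"
    then have "norm (moment \<mu>) * norm (moment \<mu>) \<le> norm (moment \<mu>) * norm x"
      using h[of x] t norm_cauchy_schwarz[of "moment \<mu>" x] by (simp add: power2_eq_square)
    then show "norm (moment \<mu>) \<le> norm x" by (cases "moment \<mu> = 0") auto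
  qed
qed

text \<open>The algebraic form of the nilsoliton condition \<open>Ric = c I + D\<close>.\<close>

definition soliton :: "'n::finite bracket \<Rightarrow> bool" where
  "soliton \<mu> \<longleftrightarrow> (\<exists>c. Ric \<mu> - c *\<^sub>R mat 1 \<in> derivations \<mu>)"

lemma derivations_scaleR: "\<mu> \<in> skew_bilinear \<Longrightarrow> D \<in> derivations \<mu> \<Longrightarrow> c *\<^sub>R D \<in> derivations \<mu>"
  by (simp add: derivations_def skew_bilinearD scaleR_matrix_vector_assoc[symmetric]
      scaleR_right_distrib[symmetric])

lemma soliton_moment:
  assumes \<mu>: "\<mu> \<in> skew_bilinear" "\<mu> \<noteq> (\<lambda>X Y. 0)"
  shows "soliton \<mu> \<longleftrightarrow> (\<exists>t. moment \<mu> + t *\<^sub>R mat 1 \<in> derivations \<mu>)"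
proof
  define q where "q = 4 / (bracket_norm \<mu>)\<^sup>2"
  have q: "q \<noteq> 0" using bracket_norm_pos[OF \<mu>] by (simp add: q_def)
  have m: "moment \<mu> = q *\<^sub>R Ric \<mu>" by (simp add: moment_def q_def)
  show "\<exists>t. moment \<mu> + t *\<^sub>R mat 1 \<in> derivations \<mu>" if "soliton \<mu>"
  proof -
    obtain c where "Ric \<mu> - c *\<^sub>R mat 1 \<in> derivations \<mu>" using \<open>soliton \<mu>\<close> soliton_def by blast
    from derivations_scaleR[OF \<mu>(1) this, of q]
    have "moment \<mu> + (- q * c) *\<^sub>R mat 1 \<in> derivations \<mu>" by (simp add: m scaleR_diff_right)
    then show ?thesis by blast
  qed
  show "soliton \<mu>" if ex: "\<exists>t. moment \<mu> + t *\<^sub>R mat 1 \<in> derivations \<mu>"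
  proof -
    obtain t where "moment \<mu> + t *\<^sub>R mat 1 \<in> derivations \<mu>" using ex by blast
    from derivations_scaleR[OF \<mu>(1) this, of "1/q"] q
    have "Ric \<mu> - (- t / q) *\<^sub>R mat 1 \<in> derivations \<mu>" by (simp add: m scaleR_add_right)
    then show ?thesis unfolding soliton_def by blast
  qed
qed

lemma stratumI:
  assumes "\<mu> \<in> skew_bilinear" "\<mu> \<noteq> (\<lambda>X Y. 0)" "invertible g" "b = beta (gl_act g \<mu>)"
    "\<And>g. invertible g \<Longrightarrow> norm (beta (gl_act g \<mu>)) \<le> norm b"
  shows "\<mu> \<in> stratum b"
  using assms unfolding stratum_def by blast

lemma stratumD:
  assumes "\<mu> \<in> stratum b"
  shows "\<mu> \<in> skew_bilinear" "\<mu> \<noteq> (\<lambda>X Y. 0)" "\<exists>g. invertible g \<and> b = beta (gl_act g \<mu>)"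
    "invertible g \<Longrightarrow> norm (beta (gl_act g \<mu>)) \<le> norm b"
  using assms unfolding stratum_def by blast+

text \<open>The orthogonal matrix that diagonalises the moment map of a soliton realises a label of the norm
  of the moment map, which by the general bound is the largest possible.\<close>

lemma soliton_stratum:
  fixes \<mu> :: "'n::{finite,linorder} bracket"
  assumes \<mu>: "\<mu> \<in> skew_bilinear" "\<mu> \<noteq> (\<lambda>X Y. 0)" and D: "moment \<mu> + t *\<^sub>R mat 1 \<in> derivations \<mu>"
  obtains K where "orthogonal_matrix K" "moment (gl_act K \<mu>) \<in> diag_mats_incr"
    "moment (gl_act K \<mu>) = K ** moment \<mu> ** transpose K"
    "\<mu> \<in> stratum (moment (gl_act K \<mu>))" "t = (norm (moment (gl_act K \<mu>)))\<^sup>2"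
    "\<And>x. x \<in> weights (gl_act K \<mu>) \<Longrightarrow> moment (gl_act K \<mu>) \<bullet> x = t"
    "moment (gl_act K \<mu>) \<in> convex hull weights (gl_act K \<mu>)"
proof -
  obtain K where K: "orthogonal_matrix K" and inc: "K ** moment \<mu> ** transpose K \<in> diag_mats_incr"
    by (rule symmetric_diagonalization[OF moment_symmetric]) (rule that)
  define \<nu> where "\<nu> = gl_act K \<mu>"
  have m: "moment \<nu> = K ** moment \<mu> ** transpose K"
    unfolding \<nu>_def by (rule moment_gl_act_orthogonal[OF \<mu>(1) K])
  have \<nu>: "\<nu> \<in> skew_bilinear" "\<nu> \<noteq> (\<lambda>X Y. 0)" unfolding \<nu>_def
    by (rule gl_act_skew_bilinear[OF \<mu>(1)], rule gl_act_nonzero[OF invertible_orthogonal[OF K] \<mu>(2)])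
  have diag: "moment \<nu> \<in> diag_mats" using inc m by (simp add: diag_mats_incr_def)
  have "K ** (moment \<mu> + t *\<^sub>R mat 1) ** transpose K = moment \<nu> + t *\<^sub>R mat 1"
    by (simp add: m matrix_add_ldistrib matrix_add_rdistrib mult_scaleR_left mult_scaleR_right
        orthogonal_matrix_transpose_mult[OF K])
  then have "moment \<nu> + t *\<^sub>R mat 1 \<in> derivations \<nu>"
    using derivations_gl_act[OF invertible_orthogonal[OF K] D]
    by (simp add: \<nu>_def matrix_inv_orthogonal[OF K])
  note b = beta_eq_of_derivation[OF \<nu> diag this]
  have "norm (moment \<nu>) = norm (moment \<mu>)" unfolding m by (rule norm_conj_orthogonal[OF K])
  then have "norm (beta (gl_act g \<mu>)) \<le> norm (moment \<nu>)" if "invertible g" for g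
    using norm_beta_le_norm_moment(1)[OF \<mu> that] by simp
  then have "\<mu> \<in> stratum (moment \<nu>)"
    by (rule stratumI[OF \<mu> invertible_orthogonal[OF K] b(1)[symmetric, unfolded \<nu>_def], folded \<nu>_def])
  show ?thesis
  proof (rule that[OF K, folded \<nu>_def])
    show "moment \<nu> \<in> diag_mats_incr" using inc m by simp
  qed (fact m \<open>\<mu> \<in> stratum (moment \<nu>)\<close> b(2) b(3) moment_in_hull_weights[OF \<nu> diag])+
qed

lemma conjugate_symmetric_norm:
  assumes "conjugate A B" "transpose A = A" "transpose B = B"
  shows "norm A = norm B"
proof -
  obtain P where P: "invertible P" and A: "A = P ** B ** matrix_inv P"
    using assms(1) unfolding conjugate_def by blast
  have "A ** A = P ** (B ** B) ** matrix_inv P"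
    unfolding A by (simp add: matrix_mul_assoc matrix_cancel(2)[OF P])
  then have "trace (A ** A) = trace (matrix_inv P ** (P ** (B ** B)))"
    by (simp only: trace_mul_sym[of _ "matrix_inv P"])
  also have "\<dots> = trace (B ** B)" by (simp add: matrix_mul_assoc matrix_inv_mult[OF P])
  finally have "trace (A ** A) = trace (B ** B)" .
  then show ?thesis using assms(2,3) by (simp add: norm_eq_sqrt_inner inner_matrix_eq_trace)
qed

lemma conjugate_orthogonal:
  assumes "orthogonal_matrix K"
  shows "conjugate (K ** A ** transpose K) A"
  unfolding conjugate_def
  by (rule exI[of _ K]) (simp add: invertible_orthogonal[OF assms] matrix_inv_orthogonal[OF assms])

lemma conjugate_sym: 
  assumes "conjugate A B" shows "conjugate B A"
proof -
  obtain P where P: "invertible P" and A: "A = P ** B ** matrix_inv P"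
    using assms(1) unfolding conjugate_def by blast
  note i = matrix_inv_eqI[OF matrix_inv_mult(2)[OF P]]
  have "B = matrix_inv P ** A ** matrix_inv (matrix_inv P)"
    unfolding i(1)
    unfolding A by (simp add: matrix_mul_assoc matrix_inv_mult[OF P] matrix_cancel(2)[OF P])
  with i(2) show ?thesis
    unfolding conjugate_def by (intro exI[of _ "matrix_inv P"] conjI)
qed

lemma conjugate_trans:
  assumes "conjugate A B" "conjugate B C" shows "conjugate A C"
proof -
  obtain P Q where P: "invertible P" and A: "A = P ** B ** matrix_inv P"
    and Q: "invertible Q" and B: "B = Q ** C ** matrix_inv Q"
    using assms unfolding conjugate_def by blast
  have "(P ** Q) ** (matrix_inv Q ** matrix_inv P) = mat 1"
    by (simp add: matrix_mul_assoc matrix_inv_mult[OF P] matrix_cancel(1)[OF Q])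
  note i = matrix_inv_eqI[OF this]
  have "A = (P ** Q) ** C ** matrix_inv (P ** Q)"
    unfolding A B i(1) by (simp only: matrix_mul_assoc)
  with i(2) show ?thesis
    unfolding conjugate_def by (intro exI[of _ "P ** Q"] conjI)
qed

lemma diag_mats_transpose: "A \<in> diag_mats \<Longrightarrow> transpose A = A"
  by (rule matrix_eq_entries) (metis (mono_tags, lifting) diag_mats_def mem_Collect_eq transpose_def vec_lambda_beta)

text \<open>All three conditions say that the bound of the previous results is attained. All
  labels of a bracket have the same norm, which is what allows a soliton, one label of which is its
  diagonalised moment map, to be compared with an arbitrary label.\<close>

lemma stratum_equality_iff:
  fixes \<mu> :: "'n::{finite,linorder} bracket"
  assumes "\<mu> \<in> stratum b"
  shows "soliton \<mu> \<longleftrightarrow> norm (moment \<mu>) = norm b"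
    and "conjugate (moment \<mu>) b \<longleftrightarrow> norm (moment \<mu>) = norm b"
proof -
  have \<mu>: "\<mu> \<in> skew_bilinear" "\<mu> \<noteq> (\<lambda>X Y. 0)" using stratumD[OF assms] by blast+
  obtain g where g: "invertible g" and b: "b = beta (gl_act g \<mu>)"
    using stratumD(3)[OF assms] by blast
  have bd: "b \<in> diag_mats"
    unfolding b by (rule beta_diag[OF gl_act_skew_bilinear[OF \<mu>(1)] gl_act_nonzero[OF g \<mu>(2)]])
  have eq: "conjugate (moment \<mu>) b \<and> soliton \<mu>" if attained: "norm (moment \<mu>) = norm b"
  proof -
    obtain K where K: "orthogonal_matrix K" and m: "moment (gl_act K \<mu>) = b"
      and der: "b + (norm b)\<^sup>2 *\<^sub>R mat 1 \<in> derivations (gl_act K \<mu>)"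
      using norm_beta_le_norm_moment(2)[OF \<mu> g] attained unfolding b by blast
    have bK: "b = K ** moment \<mu> ** transpose K"
      using m moment_gl_act_orthogonal[OF \<mu>(1) K] by simp
    then have c: "conjugate (moment \<mu>) b" using conjugate_sym[OF conjugate_orthogonal[OF K]] by simp
    have "K ** (moment \<mu> + (norm b)\<^sup>2 *\<^sub>R mat 1) ** transpose K = b + (norm b)\<^sup>2 *\<^sub>R mat 1"
      by (simp add: bK[symmetric] matrix_add_ldistrib matrix_add_rdistrib mult_scaleR_left mult_scaleR_right
          orthogonal_matrix_transpose_mult[OF K])
    then have "moment \<mu> + (norm b)\<^sup>2 *\<^sub>R mat 1 \<in> derivations \<mu>"
      using der derivations_gl_act_iff[OF invertible_orthogonal[OF K], of "moment \<mu> + (norm b)\<^sup>2 *\<^sub>R mat 1" \<mu>]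
      by (simp add: matrix_inv_orthogonal[OF K])
    then show ?thesis using c soliton_moment[OF \<mu>] by blast
  qed
  have "norm (moment \<mu>) = norm b" if "conjugate (moment \<mu>) b"
    using conjugate_symmetric_norm[OF that moment_symmetric diag_mats_transpose[OF bd]] .
  with eq show "conjugate (moment \<mu>) b \<longleftrightarrow> norm (moment \<mu>) = norm b" by blast
  have "norm (moment \<mu>) = norm b" if sol: "soliton \<mu>"
  proof -
    obtain t where D: "moment \<mu> + t *\<^sub>R mat 1 \<in> derivations \<mu>" using sol soliton_moment[OF \<mu>] by blast
    obtain K where K: "orthogonal_matrix K"
      and m: "moment (gl_act K \<mu>) = K ** moment \<mu> ** transpose K"
      and st: "\<mu> \<in> stratum (moment (gl_act K \<mu>))"
      by (rule soliton_stratum[OF \<mu> D]) (rule that)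
    obtain g' where "invertible g'" "moment (gl_act K \<mu>) = beta (gl_act g' \<mu>)"
      using stratumD(3)[OF st] by blast
    then have "norm (moment (gl_act K \<mu>)) \<le> norm b"
      using stratumD(4)[OF assms] by metis
    moreover have "norm b \<le> norm (moment (gl_act K \<mu>))"
      unfolding b by (rule stratumD(4)[OF st g])
    ultimately show ?thesis using norm_conj_orthogonal[OF K, of "moment \<mu>"] m by simp
  qed
  with eq show "soliton \<mu> \<longleftrightarrow> norm (moment \<mu>) = norm b" by blast
qed

section \<open>Traces on nilpotent Lie algebras\<close>

lemma subspace_projection:
  fixes V :: "(real^'n) set"
  assumes "subspace V"
  shows "\<exists>P :: real^'n^'n. (\<forall>x. P *v x \<in> V) \<and> (\<forall>x\<in>V. P *v x = x)"
proof -
  obtain B where B: "B \<subseteq> V" "independent B" "V \<subseteq> span B"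
    using basis_exists[of V] by metis
  have V: "span B = V"
    using B assms span_minimal by blast
  obtain p where p: "linear p" "\<forall>x\<in>B. p x = x" "range p = span ((\<lambda>x. x) ` B)"
    using linear_independent_extend_subspace[OF B(2), of "\<lambda>x. x"] by blast
  have fix_V: "p x = x" if "x \<in> V" for x
    using linear_eq_on_span[OF p(1) linear_ident, of B] p(2) that V by auto
  have "matrix p *v x = p x" for x
    using matrix_works[of p x] p(1) by (simp add: linear_matrix_vector_mul_eq)
  then show ?thesis
    using p(3) V fix_V by (intro exI[of _ "matrix p"]) auto
qed

text \<open>With projections \<open>P\<^sub>i\<close> onto the subspaces of the flag, \<open>A P\<^sub>i = P\<^sub>i\<^sub>+\<^sub>1 A P\<^sub>i\<close> and
  \<open>P\<^sub>i P\<^sub>i\<^sub>+\<^sub>1 = P\<^sub>i\<^sub>+\<^sub>1\<close>, so that \<open>tr (A P\<^sub>i) = tr (A P\<^sub>i P\<^sub>i\<^sub>+\<^sub>1) = tr (A P\<^sub>i\<^sub>+\<^sub>1)\<close>.\<close>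

lemma trace_zero_of_flag:
  fixes A :: "real^'n^'n" and V :: "nat \<Rightarrow> (real^'n) set"
  assumes V: "V 0 = UNIV" "V m = {0}" "\<And>i. subspace (V i)" "\<And>i. V (Suc i) \<subseteq> V i"
    and A: "\<And>i x. x \<in> V i \<Longrightarrow> A *v x \<in> V (Suc i)"
  shows "trace A = 0"
proof -
  have "\<forall>i. \<exists>P :: real^'n^'n. (\<forall>x. P *v x \<in> V i) \<and> (\<forall>x\<in>V i. P *v x = x)"
    using subspace_projection V(3) by blast
  from choice[OF this] obtain P :: "nat \<Rightarrow> real^'n^'n"
    where P: "\<And>i x. P i *v x \<in> V i" "\<And>i x. x \<in> V i \<Longrightarrow> P i *v x = x" by blast
  have step: "trace (A ** P i) = trace (A ** P (Suc i))" for i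
  proof -
    have "P (Suc i) ** (A ** P i) = A ** P i"
      by (simp add: matrix_eq matrix_vector_mul_assoc[symmetric] P A)
    then have "trace (A ** P i) = trace ((A ** P i) ** P (Suc i))"
      using trace_mul_sym[of "P (Suc i)" "A ** P i"] by simp
    also have "(A ** P i) ** P (Suc i) = A ** P (Suc i)"
      using P V(4) by (simp add: matrix_eq matrix_vector_mul_assoc[symmetric] subset_iff)
    finally show ?thesis .
  qed
  have "trace (A ** P 0) = trace (A ** P i)" for i
    by (induction i) (simp_all add: step[symmetric])
  then have "trace (A ** P 0) = trace (A ** P m)" .
  moreover have "P 0 = mat 1" using P(2)[of _ 0] V(1) by (simp add: matrix_eq)
  moreover have "P m = 0" using P(1)[of m] V(2) by (simp add: matrix_eq)
  moreover have "trace (A ** 0) = 0" by (simp add: trace_def matrix_matrix_mult_def)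
  ultimately show ?thesis by simp
qed

definition ad :: "'n::finite bracket \<Rightarrow> real^'n \<Rightarrow> real^'n^'n" where
  "ad \<mu> X = matrix (\<mu> X)"

lemma ad_mult: "\<mu> \<in> skew_bilinear \<Longrightarrow> ad \<mu> X *v Y = \<mu> X Y"
  using matrix_works[of "\<mu> X" Y] skew_bilinearD(4)[of \<mu> X]
  by (simp add: ad_def linear_matrix_vector_mul_eq)

lemma nilpotent_skew: "\<mu> \<in> nilpotent_brackets \<Longrightarrow> \<mu> \<in> skew_bilinear"
  by (simp add: nilpotent_brackets_def)

lemma ad_derivation:
  assumes "\<mu> \<in> nilpotent_brackets"
  shows "ad \<mu> X \<in> derivations \<mu>"
  unfolding derivations_def mem_Collect_eq ad_mult[OF nilpotent_skew[OF assms]]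
proof (intro allI)
  fix Y Z
  have \<mu>: "\<mu> \<in> skew_bilinear" by (rule nilpotent_skew[OF assms])
  have "\<mu> X (\<mu> Y Z) + \<mu> Y (\<mu> Z X) + \<mu> Z (\<mu> X Y) = 0"
    using assms unfolding nilpotent_brackets_def jacobi_def by blast
  moreover have "\<mu> Y (\<mu> Z X) = - \<mu> Y (\<mu> X Z)"
    unfolding skew_bilinear_swap[OF \<mu>, of Z X]
    by (rule linear_neg[OF skew_bilinearD(4)[OF \<mu>]])
  moreover have "\<mu> Z (\<mu> X Y) = - \<mu> (\<mu> X Y) Z" by (rule skew_bilinear_swap[OF \<mu>])
  ultimately show "\<mu> X (\<mu> Y Z) = \<mu> (\<mu> X Y) Z + \<mu> Y (\<mu> X Z)" by (simp add: algebra_simps)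
qed

lemma lower_central_series_decreasing:
  "lower_central_series \<mu> (Suc i) \<subseteq> lower_central_series \<mu> i"
proof (induction i)
  case (Suc i)
  then show ?case unfolding lower_central_series.simps(2)[of \<mu> "Suc i"]
    lower_central_series.simps(2)[of \<mu> i] by (intro span_mono) blast
qed simp

lemma subspace_lower_central_series: "subspace (lower_central_series \<mu> i)"
  by (cases i) simp_all

lemma derivation_lower_central_series:
  assumes D: "D \<in> derivations \<mu>"
  shows "x \<in> lower_central_series \<mu> i \<Longrightarrow> D *v x \<in> lower_central_series \<mu> i"
proof (induction i arbitrary: x)
  case (Suc i)
  let ?C = "lower_central_series \<mu> (Suc i)"
  have "?C \<subseteq> {x. D *v x \<in> ?C}"
    unfolding lower_central_series.simps(2)[of \<mu> i]
  proof (rule span_minimal)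
    have sub: "subspace (span {\<mu> X Y |X Y. Y \<in> lower_central_series \<mu> i})" by simp
    then show "subspace {x. D *v x \<in> span {\<mu> X Y |X Y. Y \<in> lower_central_series \<mu> i}}"
      by (auto simp: subspace_def matrix_vector_right_distrib matrix_vector_mult_scaleR)
    show "{\<mu> X Y |X Y. Y \<in> lower_central_series \<mu> i}
        \<subseteq> {x. D *v x \<in> span {\<mu> X Y |X Y. Y \<in> lower_central_series \<mu> i}}"
    proof clarify
      fix X Y assume Y: "Y \<in> lower_central_series \<mu> i"
      have "D *v \<mu> X Y = \<mu> (D *v X) Y + \<mu> X (D *v Y)" using D by (simp add: derivations_def)
      moreover have "\<mu> (D *v X) Y \<in> span {\<mu> X Y |X Y. Y \<in> lower_central_series \<mu> i}"
        using Y by (intro span_base) blast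
      moreover have "\<mu> X (D *v Y) \<in> span {\<mu> X Y |X Y. Y \<in> lower_central_series \<mu> i}"
        using Suc.IH[OF Y] by (intro span_base) blast
      ultimately show "D *v \<mu> X Y \<in> span {\<mu> X Y |X Y. Y \<in> lower_central_series \<mu> i}"
        by (simp add: span_add)
    qed
  qed
  then show ?case using Suc.prems by blast
qed simp

text \<open>A derivation preserves the lower central series, and \<open>ad X\<close> shifts it by one step.\<close>

lemma trace_derivation_ad:
  assumes \<mu>: "\<mu> \<in> nilpotent_brackets" and D: "D \<in> derivations \<mu>"
  shows "trace (D ** ad \<mu> X) = 0"
proof -
  obtain m where m: "lower_central_series \<mu> m = {0}"
    using \<mu> unfolding nilpotent_brackets_def by blast
  show ?thesis
  proof (rule trace_zero_of_flag[OF _ m subspace_lower_central_series lower_central_series_decreasing])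
    fix i x assume "x \<in> lower_central_series \<mu> i"
    then have "\<mu> X x \<in> lower_central_series \<mu> (Suc i)"
      unfolding lower_central_series.simps(2) by (intro span_base) blast
    then show "(D ** ad \<mu> X) *v x \<in> lower_central_series \<mu> (Suc i)"
      using derivation_lower_central_series[OF D]
      by (simp add: matrix_vector_mul_assoc[symmetric] ad_mult[OF nilpotent_skew[OF \<mu>]]
          del: lower_central_series.simps)
  qed simp
qed

lemma trace_ad:
  assumes \<mu>: "\<mu> \<in> nilpotent_brackets"
  shows "trace (ad \<mu> X) = 0"
proof -
  obtain m where m: "lower_central_series \<mu> m = {0}"
    using \<mu> unfolding nilpotent_brackets_def by blast
  show ?thesis
  proof (rule trace_zero_of_flag[OF _ m subspace_lower_central_series lower_central_series_decreasing])
    fix i x assume "x \<in> lower_central_series \<mu> i"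
    then show "ad \<mu> X *v x \<in> lower_central_series \<mu> (Suc i)"
      unfolding lower_central_series.simps(2) ad_mult[OF nilpotent_skew[OF \<mu>]]
      by (intro span_base) blast
  qed simp
qed

section \<open>Positivity of the soliton derivation\<close>

lemma gl_rep_commutator:
  assumes "\<mu> \<in> skew_bilinear"
  shows "gl_rep (A ** B - B ** A) \<mu> = (\<lambda>X Y. gl_rep A (gl_rep B \<mu>) X Y - gl_rep B (gl_rep A \<mu>) X Y)"
proof -
  have d: "\<mu> (x - y) z = \<mu> x z - \<mu> y z" "\<mu> z (x - y) = \<mu> z x - \<mu> z y" for x y z
    using linear_diff[OF skew_bilinearD(3)[OF assms]] linear_diff[OF skew_bilinearD(4)[OF assms]] by auto
  show ?thesis
    by (intro ext) (simp add: gl_rep_def matrix_vector_mult_diff_rdistrib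
        matrix_vector_mult_diff_distrib d flip: matrix_vector_mul_assoc)
qed

text \<open>Let \<open>A = ad X\<close> for an eigenvector \<open>X\<close> of \<open>D\<close> with eigenvalue \<open>l\<close>, so that \<open>[D, A] = l A\<close>. Pairing
  \<open>Ric = c I + D\<close> with \<open>[A, A\<^sup>t]\<close> gives \<open>l \<parallel>A\<parallel>\<^sup>2\<close> directly, and a nonnegative multiple of \<open>\<parallel>\<pi>(A\<^sup>t) \<mu>\<parallel>\<^sup>2\<close> by
  the moment map property and \<open>\<pi>(A) \<mu> = 0\<close>. If \<open>l = 0\<close> then \<open>A\<^sup>t\<close> is a derivation, and nilpotency yields
  \<open>tr (A\<^sup>t A) = 0\<close>. In the remaining case \<open>X\<close> is central, and there the Ricci form is nonnegative.\<close>

lemma soliton_eigenvalue_pos: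
  assumes \<mu>: "\<mu> \<in> nilpotent_brackets" and ric: "Ric \<mu> = c *\<^sub>R mat 1 + D" and D: "D \<in> derivations \<mu>"
    and c: "c < 0" and X: "D *v X = l *\<^sub>R X" "X \<noteq> 0"
  shows "0 < l"
proof -
  have sk: "\<mu> \<in> skew_bilinear" by (rule nilpotent_skew[OF \<mu>])
  note sw = skew_bilinearD[OF sk]
  define A where "A = ad \<mu> X"
  have A: "A *v v = \<mu> X v" for v by (simp add: A_def ad_mult[OF sk])
  show ?thesis
  proof (cases "A = 0")
    case True
    then have central: "\<mu> X v = 0" for v using A[of v] by simp
    have "(Ric \<mu> *v X) \<bullet> X = (c + l) * (X \<bullet> X)"
      unfolding ric by (simp add: matrix_vector_mult_add_rdistrib X(1) inner_add_left algebra_simps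
          flip: scaleR_matrix_vector_assoc)
    moreover have "0 \<le> (Ric \<mu> *v X) \<bullet> X"
      unfolding Ric_inner[OF sk] ric_form_eq central by (simp add: sum_nonneg)
    moreover have "0 < X \<bullet> X" using X(2) by simp
    ultimately have "0 \<le> c + l" by (simp add: zero_le_mult_iff)
    then show ?thesis using c by simp
  next
    case False
    define \<nu> where "\<nu> = gl_rep (transpose A) \<mu>"
    define E where "E = A ** transpose A - transpose A ** A"
    have "gl_rep A \<mu> = (\<lambda>X Y. 0)"
      using ad_derivation[OF \<mu>] by (simp add: A_def flip: derivations_gl_rep)
    then have "gl_rep E \<mu> = gl_rep A \<nu>"
      unfolding E_def gl_rep_commutator[OF sk] \<nu>_def by (simp add: gl_rep_def)
    then have "Ric \<mu> \<bullet> E = 1/4 * bracket_inner \<nu> \<nu>"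
      unfolding Ric_moment[OF sk] using gl_rep_adjoint[OF bilinear_gl_rep[OF sw(1)] sw(1), of A "transpose A"]
      by (simp add: \<nu>_def)
    moreover have "Ric \<mu> \<bullet> E = l * (A \<bullet> A)"
    proof -
      have sE: "transpose E = E"
        by (simp add: E_def matrix_transpose_mul transpose_def[of "_ - _"] vec_eq_iff)
          (simp add: transpose_def matrix_matrix_mult_def mult.commute)
      have com: "D ** A - A ** D = l *\<^sub>R A"
      proof -
        have "D *v \<mu> X v = l *\<^sub>R \<mu> X v + \<mu> X (D *v v)" for v
          using D X(1) by (simp add: derivations_def sw)
        then show ?thesis
          by (simp add: matrix_eq matrix_vector_mult_diff_rdistrib A
              flip: matrix_vector_mul_assoc scaleR_matrix_vector_assoc)
      qed
      have "mat 1 \<bullet> E = 0"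
        by (simp add: inner_commute[of "mat 1"] inner_mat_1 E_def trace_sub trace_mul_sym[of A])
      moreover have "D \<bullet> E = trace (D ** A ** transpose A) - trace (A ** D ** transpose A)"
      proof -
        have "D ** E = D ** A ** transpose A - D ** transpose A ** A"
          by (simp add: E_def matrix_eq matrix_vector_mult_diff_rdistrib matrix_vector_mult_diff_distrib
              flip: matrix_vector_mul_assoc)
        moreover have "trace (D ** transpose A ** A) = trace (A ** D ** transpose A)"
          by (simp add: trace_mul_sym[of _ A] matrix_mul_assoc)
        ultimately show ?thesis by (simp add: inner_matrix_eq_trace sE trace_sub)
      qed
      moreover have "trace (D ** A ** transpose A) - trace (A ** D ** transpose A)
          = trace ((D ** A - A ** D) ** transpose A)"
        unfolding trace_sub[symmetric]
        by (rule arg_cong[of _ _ trace]) (simp add: matrix_eq matrix_vector_mult_diff_rdistrib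
            flip: matrix_vector_mul_assoc)
      ultimately show ?thesis
        unfolding ric com
        by (simp add: inner_add_left mult_scaleR_left trace_scaleR inner_matrix_eq_trace[of A A])
    qed
    ultimately have eq: "l * (A \<bullet> A) = 1/4 * bracket_inner \<nu> \<nu>" by simp
    have pos: "0 < A \<bullet> A" using False by simp
    have "0 \<le> bracket_inner \<nu> \<nu>" by (simp flip: bracket_norm_sq)
    then have "0 \<le> l * (A \<bullet> A)" using eq by simp
    then have "0 \<le> l" using pos by (simp add: zero_le_mult_iff)
    moreover have "l \<noteq> 0"
    proof
      assume "l = 0"
      then have "bracket_inner \<nu> \<nu> = 0" using eq by simp
      then have "transpose A \<in> derivations \<mu>"
        using bracket_inner_eq_0[OF bilinear_gl_rep[OF sw(1)]] by (simp add: \<nu>_def derivations_gl_rep)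
      then have "trace (transpose A ** A) = 0"
        unfolding A_def by (rule trace_derivation_ad[OF \<mu>])
      then show False using pos by (simp add: inner_matrix_eq_trace trace_mul_sym[of A])
    qed
    ultimately show ?thesis by simp
  qed
qed

section \<open>The Ricci tensor of a left invariant metric\<close>

lemma sum_sum_symmetric_skew:
  fixes s a :: "'b \<Rightarrow> 'b \<Rightarrow> real"
  assumes "\<And>i j. s i j = s j i" "\<And>i j. a i j = - a j i"
  shows "(\<Sum>i\<in>I. \<Sum>j\<in>I. s i j * a i j) = 0"
proof -
  have "(\<Sum>i\<in>I. \<Sum>j\<in>I. s i j * a i j) = (\<Sum>i\<in>I. \<Sum>j\<in>I. s j i * a j i)" by (rule sum.swap)
  also have "\<dots> = (\<Sum>i\<in>I. \<Sum>j\<in>I. - (s i j * a i j))"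
  proof (intro sum.cong refl)
    fix i j show "s j i * a j i = - (s i j * a i j)"
      using assms(1)[of j i] assms(2)[of j i] by simp
  qed
  also have "\<dots> = - (\<Sum>i\<in>I. \<Sum>j\<in>I. s i j * a i j)" by (simp add: sum_negf)
  finally show ?thesis by simp
qed

lemma levi_civita_koszul:
  assumes lc: "levi_civita br nab"
  shows "nab X Y \<bullet> Z = (br X Y \<bullet> Z - br Y Z \<bullet> X + br Z X \<bullet> Y) / 2"
proof -
  have t: "br X Y = nab X Y - nab Y X" and m: "nab X Y \<bullet> Z + nab X Z \<bullet> Y = 0" for X Y Z
    using lc unfolding levi_civita_def by (auto simp: inner_commute)
  show ?thesis
    using m[of X Y Z] m[of Y X Z] m[of Z X Y] by (simp add: t inner_diff_left field_simps)
qed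

text \<open>With \<open>A\<^sub>Y X = \<nabla>\<^sub>X Y\<close>, metric compatibility and vanishing torsion turn the trace of the curvature
  into \<open>- tr ad (\<nabla>\<^sub>Y Z) - tr (A\<^sub>Y A\<^sub>Z)\<close>. The Koszul formula splits \<open>A\<^sub>Y\<close> into minus the symmetric part
  of \<open>ad Y\<close> and a skew map, which gives the second trace.\<close>

lemma ricci_tensor_formula:
  fixes br :: "'a::euclidean_space \<Rightarrow> 'a \<Rightarrow> 'a"
  assumes lc: "levi_civita br nab" and bil: "bilinear br" and skew: "\<And>X Y. br X Y = - br Y X"
  shows "ricci_tensor br nab Y Z = - (\<Sum>b\<in>Basis. br (nab Y Z) b \<bullet> b)
    - 1/2 * (\<Sum>b\<in>Basis. br Y b \<bullet> br Z b) - 1/2 * (\<Sum>b\<in>Basis. br Y (br Z b) \<bullet> b)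
    + 1/4 * (\<Sum>b\<in>Basis. \<Sum>c\<in>Basis. (br b c \<bullet> Y) * (br b c \<bullet> Z))"
proof -
  have t: "br X Y = nab X Y - nab Y X" and m: "nab X Y \<bullet> Z = - (nab X Z \<bullet> Y)" for X Y Z
    using lc unfolding levi_civita_def by (auto simp: inner_commute eq_neg_iff_add_eq_0)
  have nab: "linear (\<lambda>x. nab x y)" for y
    using lc unfolding levi_civita_def bilinear_def by blast
  have brl: "linear (br x)" for x using bil unfolding bilinear_def by blast
  have expand: "L v = (\<Sum>c\<in>Basis. (v \<bullet> c) * L c)" if "linear L" for L :: "'a \<Rightarrow> real" and v
  proof -
    have "L v = L (\<Sum>c\<in>Basis. (v \<bullet> c) *\<^sub>R c)" by (simp add: euclidean_representation)
    then show ?thesis by (simp add: linear_sum[OF that] linear_scale[OF that])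
  qed
  have lin: "linear (\<lambda>x. nab x W \<bullet> b)" "linear (\<lambda>x. br V x \<bullet> b)" for W V b
    using nab[of W] brl[of V] by (auto simp: linear_iff inner_simps)
  let ?R = "\<lambda>b. - (br (nab Y Z) b \<bullet> b) + (nab b Z \<bullet> nab Y b + nab (nab Y b) Z \<bullet> b) - nab (nab b Y) Z \<bullet> b"
  have "curvature br nab b Y Z \<bullet> b = ?R b" for b
  proof -
    have "nab b (nab Y Z) \<bullet> b = - (br (nab Y Z) b \<bullet> b)"
      using m[of "nab Y Z" b b] m[of b b "nab Y Z"] t[of "nab Y Z" b] by (simp add: inner_diff_left)
    moreover have "nab Y (nab b Z) \<bullet> b = - (nab b Z \<bullet> nab Y b)"
      using m[of Y "nab b Z" b] by (simp add: inner_commute)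
    moreover have "nab (br b Y) Z = nab (nab b Y) Z - nab (nab Y b) Z"
      unfolding t[of b Y] by (rule linear_diff[OF nab])
    ultimately show ?thesis by (simp add: curvature_def inner_diff_left)
  qed
  then have "ricci_tensor br nab Y Z = (\<Sum>b\<in>Basis. ?R b)" by (simp add: ricci_tensor_def)
  also have "\<dots> = - (\<Sum>b\<in>Basis. br (nab Y Z) b \<bullet> b)
      + (\<Sum>b\<in>Basis. nab b Z \<bullet> nab Y b + nab (nab Y b) Z \<bullet> b) - (\<Sum>b\<in>Basis. nab (nab b Y) Z \<bullet> b)"
    by (simp only: sum.distrib sum_subtractf sum_negf)
  also have "(\<Sum>b\<in>Basis. nab b Z \<bullet> nab Y b + nab (nab Y b) Z \<bullet> b) = 0"
  proof -
    have "(\<Sum>b\<in>Basis. nab (nab Y b) Z \<bullet> b) = (\<Sum>b\<in>Basis. \<Sum>c\<in>Basis. (nab Y b \<bullet> c) * (nab c Z \<bullet> b))"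
      by (rule sum.cong[OF refl], rule expand[OF lin(1)])
    also have "\<dots> = (\<Sum>b\<in>Basis. \<Sum>c\<in>Basis. - ((nab c Z \<bullet> b) * (nab Y c \<bullet> b)))"
    proof (intro sum.cong refl)
      fix b c show "(nab Y b \<bullet> c) * (nab c Z \<bullet> b) = - ((nab c Z \<bullet> b) * (nab Y c \<bullet> b))"
        using m[of Y b c] by simp
    qed
    also have "\<dots> = (\<Sum>c\<in>Basis. \<Sum>b\<in>Basis. - ((nab c Z \<bullet> b) * (nab Y c \<bullet> b)))" by (rule sum.swap)
    also have "\<dots> = - (\<Sum>c\<in>Basis. nab c Z \<bullet> nab Y c)"
      by (simp only: sum_negf euclidean_inner[symmetric])
    finally show ?thesis by (simp add: sum.distrib)
  qed
  also have "(\<Sum>b\<in>Basis. nab (nab b Y) Z \<bullet> b) = 1/2 * (\<Sum>b\<in>Basis. br Y b \<bullet> br Z b)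
      + 1/2 * (\<Sum>b\<in>Basis. br Y (br Z b) \<bullet> b) - 1/4 * (\<Sum>b\<in>Basis. \<Sum>c\<in>Basis. (br b c \<bullet> Y) * (br b c \<bullet> Z))"
  proof -
    define y z jy jz where "y b c = br Y b \<bullet> c" and "z b c = br Z b \<bullet> c"
      and "jy b c = br b c \<bullet> Y" and "jz b c = br b c \<bullet> Z" for b c
    have jy: "jy b c = - jy c b" and jz: "jz b c = - jz c b" for b c
      unfolding jy_def jz_def skew[of b c] by simp_all
    have sum_eq: "(\<Sum>b\<in>Basis. \<Sum>c\<in>Basis. f b c) = (\<Sum>b\<in>Basis. \<Sum>c\<in>Basis. g b c)"
      if "\<And>b c. f b c = g b c" for f g :: "'a \<Rightarrow> 'a \<Rightarrow> real" using that by simp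
    have "(\<Sum>b\<in>Basis. nab (nab b Y) Z \<bullet> b) = (\<Sum>b\<in>Basis. \<Sum>c\<in>Basis. (nab b Y \<bullet> c) * (nab c Z \<bullet> b))"
      by (rule sum.cong[OF refl], rule expand[OF lin(1)])
    also have "\<dots> = (\<Sum>b\<in>Basis. \<Sum>c\<in>Basis. 1/4 * (y b c * z b c) + 1/4 * (y c b * z c b)
        + 1/4 * (y b c * z c b) + 1/4 * (y c b * z b c) - 1/4 * (jy b c * jz b c)
        + 1/4 * ((z b c + z c b) * jy b c) - 1/4 * ((y b c + y c b) * jz b c))"
    proof (rule sum_eq)
      fix b c
      have "nab b Y \<bullet> c = - (y b c + y c b + jy b c) / 2"
        unfolding levi_civita_koszul[OF lc] y_def jy_def skew[of b Y] skew[of c b] by simp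
      moreover have "nab c Z \<bullet> b = - (z b c + z c b - jz b c) / 2"
        unfolding levi_civita_koszul[OF lc] z_def jz_def skew[of c Z] by simp
      ultimately have "(nab b Y \<bullet> c) * (nab c Z \<bullet> b)
        = (- (y b c + y c b + jy b c) / 2) * (- (z b c + z c b - jz b c) / 2)" by (simp only:)
      then show "(nab b Y \<bullet> c) * (nab c Z \<bullet> b) = 1/4 * (y b c * z b c) + 1/4 * (y c b * z c b)
        + 1/4 * (y b c * z c b) + 1/4 * (y c b * z b c) - 1/4 * (jy b c * jz b c)
        + 1/4 * ((z b c + z c b) * jy b c) - 1/4 * ((y b c + y c b) * jz b c)"
        by (simp add: field_simps)
    qed
    also have "\<dots> = 1/4 * (\<Sum>b\<in>Basis. \<Sum>c\<in>Basis. y b c * z b c) + 1/4 * (\<Sum>b\<in>Basis. \<Sum>c\<in>Basis. y c b * z c b)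
        + 1/4 * (\<Sum>b\<in>Basis. \<Sum>c\<in>Basis. y b c * z c b) + 1/4 * (\<Sum>b\<in>Basis. \<Sum>c\<in>Basis. y c b * z b c)
        - 1/4 * (\<Sum>b\<in>Basis. \<Sum>c\<in>Basis. jy b c * jz b c)
        + 1/4 * (\<Sum>b\<in>Basis. \<Sum>c\<in>Basis. (z b c + z c b) * jy b c)
        - 1/4 * (\<Sum>b\<in>Basis. \<Sum>c\<in>Basis. (y b c + y c b) * jz b c)"
      by (simp only: sum.distrib sum_subtractf sum_distrib_left)
    also have "(\<Sum>b\<in>Basis. \<Sum>c\<in>Basis. (z b c + z c b) * jy b c) = 0"
      by (rule sum_sum_symmetric_skew) (simp, rule jy)
    also have "(\<Sum>b\<in>Basis. \<Sum>c\<in>Basis. (y b c + y c b) * jz b c) = 0"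
      by (rule sum_sum_symmetric_skew) (simp, rule jz)
    also have "(\<Sum>b\<in>Basis. \<Sum>c\<in>Basis. y c b * z c b) = (\<Sum>b\<in>Basis. \<Sum>c\<in>Basis. y b c * z b c)"
      by (rule sum.swap)
    also have "(\<Sum>b\<in>Basis. \<Sum>c\<in>Basis. y c b * z b c) = (\<Sum>b\<in>Basis. \<Sum>c\<in>Basis. y b c * z c b)"
      by (rule sum.swap)
    also have "(\<Sum>b\<in>Basis. \<Sum>c\<in>Basis. y b c * z b c) = (\<Sum>b\<in>Basis. br Y b \<bullet> br Z b)"
      by (simp only: y_def z_def euclidean_inner[symmetric])
    also have "(\<Sum>b\<in>Basis. \<Sum>c\<in>Basis. y b c * z c b) = (\<Sum>b\<in>Basis. br Y (br Z b) \<bullet> b)"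
    proof -
      have "(\<Sum>b\<in>Basis. br Y (br Z b) \<bullet> b) = (\<Sum>b\<in>Basis. \<Sum>c\<in>Basis. z b c * y c b)"
        unfolding y_def z_def by (rule sum.cong[OF refl], rule expand[OF lin(2)])
      also have "\<dots> = (\<Sum>b\<in>Basis. \<Sum>c\<in>Basis. z c b * y b c)" by (rule sum.swap)
      finally show ?thesis by (simp add: mult.commute)
    qed
    finally show ?thesis by (simp add: jy_def jz_def)
  qed
  finally show ?thesis by simp
qed

section \<open>Einstein solvmanifolds are the extensions of solitons\<close>

lemma sum_Basis_solv:
  fixes G :: "real \<times> (real^'n) \<Rightarrow> real"
  shows "(\<Sum>b\<in>Basis. G b) = G (1, 0) + (\<Sum>i\<in>UNIV. G (0, ax i))"
proof -
  have vec: "Basis = range (ax :: 'n \<Rightarrow> real^'n)" by (auto simp: Basis_vec_def)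
  have inj: "inj (\<lambda>i. (0, ax i) :: real \<times> (real^'n))" by (auto simp: inj_def axis_eq_axis)
  have "Basis = insert (1, 0) (range (\<lambda>i. (0, ax i) :: real \<times> (real^'n)))"
    unfolding Basis_prod_def vec by auto
  then have "(\<Sum>b\<in>Basis. G b) = (\<Sum>b\<in>insert (1, 0) (range (\<lambda>i. (0, ax i))). G b)" by (rule arg_cong)
  also have "\<dots> = G (1, 0) + (\<Sum>b\<in>range (\<lambda>i. (0, ax i)). G b)"
    by (rule sum.insert) auto
  also have "(\<Sum>b\<in>range (\<lambda>i. (0, ax i)). G b) = (\<Sum>i\<in>UNIV. G (0, ax i))"
    by (simp add: sum.reindex[OF inj])
  finally show ?thesis .
qed

lemma solv_bracket_bilinear:
  assumes "\<mu> \<in> skew_bilinear"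
  shows "bilinear (solv_bracket \<mu>)" "solv_bracket \<mu> u v = - solv_bracket \<mu> v u"
proof -
  show "bilinear (solv_bracket \<mu>)"
    by (auto simp: bilinear_def linear_iff solv_bracket_def skew_bilinearD[OF assms]
        matrix_vector_right_distrib matrix_vector_mult_scaleR algebra_simps)
  obtain a X b Y where uv: "u = (a, X)" "v = (b, Y)" by (meson surj_pair)
  show "solv_bracket \<mu> u v = - solv_bracket \<mu> v u"
    unfolding uv solv_bracket_def prod.case skew_bilinear_swap[OF assms, of X Y] by simp
qed

lemma ricci_tensor_solv_bracket:
  fixes \<mu> :: "'n::finite bracket"
  assumes \<mu>: "\<mu> \<in> nilpotent_brackets" and D: "D_der \<mu> \<in> derivations \<mu>" "transpose (D_der \<mu>) = D_der \<mu>"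
    and lc: "levi_civita (solv_bracket \<mu>) nab"
  shows "ricci_tensor (solv_bracket \<mu>) nab (a, X) (b, Y) = - a * b * (D_der \<mu> \<bullet> D_der \<mu>)
    + ric_form \<mu> X Y - trace (D_der \<mu>) * ((D_der \<mu> *v X) \<bullet> Y)"
proof -
  define D where "D = D_der \<mu>"
  have sk: "\<mu> \<in> skew_bilinear" by (rule nilpotent_skew[OF \<mu>])
  note sw = skew_bilinearD[OF sk]
  define br where "br = solv_bracket \<mu>"
  have br: "br (a, X) (b, Y) = (0, a *\<^sub>R (D *v Y) - b *\<^sub>R (D *v X) + \<mu> X Y)" for a b X Y
    by (simp add: br_def D_def solv_bracket_def)
  have skew: "br u v = - br v u" for u v
    unfolding br_def by (rule solv_bracket_bilinear(2)[OF sk])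
  have DT: "(D *v x) \<bullet> y = x \<bullet> (D *v y)" for x y
    using inner_mult_transpose[of D x y] D(2) by (simp add: D_def)
  have tD: "trace (D ** ad \<mu> W) = 0" for W
    unfolding D_def by (rule trace_derivation_ad[OF \<mu> D(1)])
  have tDad: "(\<Sum>i\<in>UNIV. (D *v ax i) \<bullet> \<mu> W (ax i)) = 0" "(\<Sum>i\<in>UNIV. \<mu> W (ax i) \<bullet> (D *v ax i)) = 0"
    "(\<Sum>i\<in>UNIV. (D *v \<mu> W (ax i)) \<bullet> ax i) = 0" "(\<Sum>i\<in>UNIV. \<mu> W (D *v ax i) \<bullet> ax i) = 0" for W
  proof -
    show *: "(\<Sum>i\<in>UNIV. (D *v \<mu> W (ax i)) \<bullet> ax i) = 0"
      using tD[of W] by (simp add: trace_eq_inner ad_mult[OF sk] flip: matrix_vector_mul_assoc)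
    then show "(\<Sum>i\<in>UNIV. \<mu> W (ax i) \<bullet> (D *v ax i)) = 0" by (simp add: DT)
    then show "(\<Sum>i\<in>UNIV. (D *v ax i) \<bullet> \<mu> W (ax i)) = 0" by (simp add: inner_commute)
    show "(\<Sum>i\<in>UNIV. \<mu> W (D *v ax i) \<bullet> ax i) = 0"
      using tD[of W] unfolding trace_mul_sym[of D]
      by (simp add: trace_eq_inner ad_mult[OF sk] flip: matrix_vector_mul_assoc)
  qed
  have tadad: "(\<Sum>i\<in>UNIV. \<mu> V (\<mu> W (ax i)) \<bullet> ax i) = 0" for V W
    using trace_derivation_ad[OF \<mu> ad_derivation[OF \<mu>], of V W]
    by (simp add: trace_eq_inner ad_mult[OF sk] flip: matrix_vector_mul_assoc)
  have tad: "(\<Sum>i\<in>UNIV. \<mu> W (ax i) \<bullet> ax i) = 0" for W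
    using trace_ad[OF \<mu>, of W] by (simp add: trace_eq_inner ad_mult[OF sk])
  obtain w W where nab: "nab (a, X) (b, Y) = (w, W)" by (meson surj_pair)
  have "w = nab (a, X) (b, Y) \<bullet> (1, 0)" by (simp add: nab)
  also have "\<dots> = (D *v X) \<bullet> Y"
    unfolding levi_civita_koszul[OF lc[folded br_def]] by (simp add: br sw DT[of Y X] inner_commute[of Y])
  finally have w: "w = (D *v X) \<bullet> Y" .
  have 1: "(\<Sum>e\<in>Basis. br (nab (a, X) (b, Y)) e \<bullet> e) = ((D *v X) \<bullet> Y) * trace D"
    unfolding sum_Basis_solv nab w
    by (simp add: br inner_add_left sum.distrib tad trace_eq_inner sum_distrib_left)
  have 2: "(\<Sum>e\<in>Basis. br (a, X) e \<bullet> br (b, Y) e)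
      = (D *v X) \<bullet> (D *v Y) + a * b * (D \<bullet> D) + (\<Sum>i\<in>UNIV. \<mu> X (ax i) \<bullet> \<mu> Y (ax i))"
    unfolding sum_Basis_solv
    by (simp add: br sw inner_add_left inner_add_right sum.distrib inner_matrix_columns[of D D] tDad
        flip: sum_distrib_left)
  have 3: "(\<Sum>e\<in>Basis. br (a, X) (br (b, Y) e) \<bullet> e) = a * b * (D \<bullet> D)"
    unfolding sum_Basis_solv
    by (simp add: br sw inner_add_left matrix_vector_right_distrib matrix_vector_mult_scaleR sum.distrib
        inner_matrix_columns[of D D] tDad tadad DT flip: sum_distrib_left)
  have 4: "(\<Sum>e\<in>Basis. \<Sum>f\<in>Basis. (br e f \<bullet> (a, X)) * (br e f \<bullet> (b, Y)))
      = 2 * ((D *v X) \<bullet> (D *v Y)) + (\<Sum>i\<in>UNIV. \<Sum>j\<in>UNIV. (\<mu> (ax i) (ax j) \<bullet> X) * (\<mu> (ax i) (ax j) \<bullet> Y))"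
  proof -
    have "(\<Sum>i\<in>UNIV. ((D *v ax i) \<bullet> X) * ((D *v ax i) \<bullet> Y)) = (D *v X) \<bullet> (D *v Y)"
      using parseval[of "D *v X" "D *v Y"] by (simp add: DT inner_commute[of "ax _"] del: transpose_matrix_vector)
    then show ?thesis
      unfolding sum_Basis_solv by (simp add: br sw sum.distrib)
  qed
  show ?thesis
    using ricci_tensor_formula[OF lc solv_bracket_bilinear[OF sk], of "(a, X)" "(b, Y)"]
    unfolding br_def[symmetric] 1 2 3 4 D_def[symmetric] ric_form_eq
    by (simp add: field_simps)
qed

lemma einstein_solv_iff:
  fixes \<mu> :: "'n::finite bracket"
  assumes \<mu>: "\<mu> \<in> nilpotent_brackets" and D: "D_der \<mu> \<in> derivations \<mu>" "transpose (D_der \<mu>) = D_der \<mu>"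
  shows "einstein (solv_bracket \<mu>) \<longleftrightarrow>
    Ric \<mu> = - (D_der \<mu> \<bullet> D_der \<mu>) *\<^sub>R mat 1 + trace (D_der \<mu>) *\<^sub>R D_der \<mu>"
proof -
  define D where "D = D_der \<mu>"
  have sk: "\<mu> \<in> skew_bilinear" by (rule nilpotent_skew[OF \<mu>])
  obtain nab where lc: "levi_civita (solv_bracket \<mu>) nab"
    and unique: "\<And>nab'. levi_civita (solv_bracket \<mu>) nab' \<Longrightarrow> nab' = nab"
    using levi_civita_ex1[OF solv_bracket_bilinear[OF sk]] by blast
  note ric = ricci_tensor_solv_bracket[OF \<mu> D lc, folded D_def]
  have "einstein (solv_bracket \<mu>) \<longleftrightarrow>
      (\<exists>c. \<forall>u v. ricci_tensor (solv_bracket \<mu>) nab u v = c * (u \<bullet> v))"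
    unfolding einstein_def using lc unique by blast
  also have "\<dots> \<longleftrightarrow> (\<forall>X Y. ric_form \<mu> X Y - trace D * ((D *v X) \<bullet> Y) = - (D \<bullet> D) * (X \<bullet> Y))"
  proof
    assume "\<exists>c. \<forall>u v. ricci_tensor (solv_bracket \<mu>) nab u v = c * (u \<bullet> v)"
    then obtain c where c: "\<And>u v. ricci_tensor (solv_bracket \<mu>) nab u v = c * (u \<bullet> v)" by blast
    have "ric_form \<mu> 0 0 = 0" by (simp add: ric_form_eq skew_bilinearD[OF sk])
    then have "c = - (D \<bullet> D)" using c[of "(1, 0)" "(1, 0)"] ric[of 1 0 1 0] by simp
    then show "\<forall>X Y. ric_form \<mu> X Y - trace D * ((D *v X) \<bullet> Y) = - (D \<bullet> D) * (X \<bullet> Y)"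
      using c[of "(0, _)" "(0, _)"] ric[of 0 _ 0 _] by simp
  next
    assume R: "\<forall>X Y. ric_form \<mu> X Y - trace D * ((D *v X) \<bullet> Y) = - (D \<bullet> D) * (X \<bullet> Y)"
    have "ricci_tensor (solv_bracket \<mu>) nab (a, X) (b, Y) = - (D \<bullet> D) * ((a, X) \<bullet> (b, Y))" for a X b Y
      using ric[of a X b Y] R[rule_format, of X Y] by (simp add: algebra_simps)
    then show "\<exists>c. \<forall>u v. ricci_tensor (solv_bracket \<mu>) nab u v = c * (u \<bullet> v)"
      by (metis surj_pair)
  qed
  also have "\<dots> \<longleftrightarrow> (\<forall>X Y. (Ric \<mu> *v X) \<bullet> Y = ((- (D \<bullet> D) *\<^sub>R mat 1 + trace D *\<^sub>R D) *v X) \<bullet> Y)"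
    by (simp add: Ric_inner[OF sk] matrix_vector_mult_add_rdistrib inner_add_left algebra_simps
        flip: scaleR_matrix_vector_assoc)
  also have "\<dots> \<longleftrightarrow> Ric \<mu> = - (D \<bullet> D) *\<^sub>R mat 1 + trace D *\<^sub>R D"
    by (auto simp: matrix_eq vector_eq_rdot)
  finally show ?thesis unfolding D_def .
qed

subsection \<open>The distinguished derivation\<close>

lemma subspace_sym_derivations:
  fixes \<mu> :: "'n::finite bracket"
  assumes "\<mu> \<in> skew_bilinear"
  shows "subspace (derivations \<mu> \<inter> Sym)"
proof -
  have "subspace (derivations \<mu>)"
    using derivations_scaleR[OF assms]
    by (auto simp: subspace_def derivations_def skew_bilinearD[OF assms] matrix_vector_mult_add_rdistrib
        algebra_simps)
  moreover have "subspace (Sym :: 'n sq_mat set)"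
    by (auto simp: subspace_def Sym_def transpose_def vec_eq_iff)
  ultimately show ?thesis by (rule subspace_inter)
qed

lemma trace_Ric_neg: "\<mu> \<in> skew_bilinear \<Longrightarrow> \<mu> \<noteq> (\<lambda>X Y. 0) \<Longrightarrow> trace (Ric \<mu>) < 0"
  using bracket_norm_pos[of \<mu>] by (simp add: trace_Ric)

lemma c_const_neg:
  assumes "\<mu> \<in> skew_bilinear" "\<mu> \<noteq> (\<lambda>X Y. 0)"
  shows "c_const \<mu> < 0"
proof -
  have tr: "trace (Ric \<mu>) < 0" by (rule trace_Ric_neg[OF assms])
  then have "Ric \<mu> \<noteq> 0" by (auto simp: trace_def)
  then have "0 < Ric \<mu> \<bullet> Ric \<mu>" by simp
  then show ?thesis using tr by (simp add: c_const_def trace_Ric_squared divide_pos_neg)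
qed

text \<open>The property that \<^const>\<open>D_der\<close> selects by a definite description.\<close>

definition einstein_derivation :: "'n::finite bracket \<Rightarrow> real^'n^'n \<Rightarrow> bool" where
  "einstein_derivation \<mu> D \<longleftrightarrow> D \<in> derivations \<mu> \<inter> Sym \<and> trace D \<ge> 0 \<and>
     (\<forall>A \<in> derivations \<mu> \<inter> Sym. orthogonal (c_const \<mu> *\<^sub>R mat 1 + trace D *\<^sub>R D) A)"

lemma einstein_derivation_unique:
  fixes \<mu> :: "'n::finite bracket"
  assumes \<mu>: "\<mu> \<in> skew_bilinear" "\<mu> \<noteq> (\<lambda>X Y. 0)"
    and A: "A \<in> derivations \<mu> \<inter> Sym" "trace A \<noteq> 0"
    and D: "einstein_derivation \<mu> D" and E: "einstein_derivation \<mu> E"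
  shows "D = E"
proof -
  let ?W = "derivations \<mu> \<inter> Sym"
  define G where "G = trace D *\<^sub>R D - trace E *\<^sub>R E"
  have perp: "(c_const \<mu> *\<^sub>R mat 1 + trace F *\<^sub>R F) \<bullet> B = 0" if "einstein_derivation \<mu> F" "B \<in> ?W" for F B
    using that by (simp add: einstein_derivation_def orthogonal_def)
  have "D \<in> ?W" "E \<in> ?W" using D E by (auto simp: einstein_derivation_def)
  then have "G \<in> ?W"
    unfolding G_def using subspace_sym_derivations[OF \<mu>(1)] by (intro subspace_diff subspace_scale)
  from perp[OF D this] perp[OF E this] have "G \<bullet> G = 0"
    by (simp add: G_def inner_add_left inner_diff_left)
  then have eq: "trace D *\<^sub>R D = trace E *\<^sub>R E" by (simp add: G_def)
  then have "trace D * trace D = trace E * trace E" using trace_scaleR by metis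
  then have tr: "trace D = trace E"
    using D E unfolding einstein_derivation_def by (metis power2_eq_square power2_eq_imp_eq)
  have "trace D \<noteq> 0"
  proof
    assume "trace D = 0"
    then have "c_const \<mu> * trace A = 0"
      using perp[OF D A(1)] by (simp add: inner_commute[of "mat 1"] inner_mat_1)
    then show False using A(2) c_const_neg[OF \<mu>] by simp
  qed
  then show ?thesis using eq tr by simp
qed

text \<open>If \<open>P\<close> is the projection of \<open>I\<close> onto the symmetric derivations, then \<open>tr P = \<parallel>P\<parallel>\<^sup>2\<close>, and the
  multiple \<open>D\<close> of \<open>P\<close> with \<open>tr (D) D = - c P\<close> has the defining property.\<close>

lemma einstein_derivation_exists:
  fixes \<mu> :: "'n::finite bracket"
  assumes \<mu>: "\<mu> \<in> skew_bilinear" "\<mu> \<noteq> (\<lambda>X Y. 0)"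
    and A: "A \<in> derivations \<mu> \<inter> Sym" "trace A \<noteq> 0"
  shows "\<exists>D. einstein_derivation \<mu> D"
proof -
  let ?W = "derivations \<mu> \<inter> Sym"
  have W: "subspace ?W" by (rule subspace_sym_derivations[OF \<mu>(1)])
  then have sp: "span ?W = ?W" by (simp only: span_eq_iff)
  obtain P z where P: "P \<in> ?W" and z: "\<And>w. w \<in> ?W \<Longrightarrow> orthogonal z w" and I: "mat 1 = P + z"
    by (rule orthogonal_subspace_decomp_exists[of ?W "mat 1", unfolded sp]) (rule that)
  have tr: "trace B = P \<bullet> B" if "B \<in> ?W" for B
    using z[OF that] by (simp add: I inner_add_right inner_commute orthogonal_def flip: inner_mat_1)
  have "P \<noteq> 0" using tr[OF A(1)] A(2) by auto
  then have PP: "0 < P \<bullet> P" by simp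
  have c: "c_const \<mu> < 0" by (rule c_const_neg[OF \<mu>])
  define s where "s = sqrt (- c_const \<mu> / (P \<bullet> P))"
  have k: "0 \<le> - c_const \<mu> / (P \<bullet> P)" using c PP by (intro divide_nonneg_pos) auto
  have s: "0 \<le> s" "s * s = - c_const \<mu> / (P \<bullet> P)"
    unfolding s_def real_sqrt_mult_self abs_of_nonneg[OF k] using k by (simp_all only: real_sqrt_ge_0_iff)
  have tP: "trace P = P \<bullet> P" by (rule tr[OF P])
  have "trace (s *\<^sub>R P) *\<^sub>R (s *\<^sub>R P) = (s * s * (P \<bullet> P)) *\<^sub>R P" by (simp add: trace_scaleR tP mult_ac)
  also have "\<dots> = (- c_const \<mu>) *\<^sub>R P" using PP by (simp add: s(2))
  finally have "c_const \<mu> *\<^sub>R mat 1 + trace (s *\<^sub>R P) *\<^sub>R (s *\<^sub>R P) = c_const \<mu> *\<^sub>R z"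
    by (simp add: I scaleR_add_right)
  moreover have "s *\<^sub>R P \<in> ?W" by (rule subspace_scale[OF W P])
  moreover have "0 \<le> trace (s *\<^sub>R P)" using s(1) PP by (simp add: trace_scaleR tP)
  ultimately have "einstein_derivation \<mu> (s *\<^sub>R P)"
    using z by (simp add: einstein_derivation_def orthogonal_def)
  then show ?thesis by blast
qed

lemma D_der_eq:
  fixes \<mu> :: "'n::finite bracket"
  assumes \<mu>: "\<mu> \<in> skew_bilinear" "\<mu> \<noteq> (\<lambda>X Y. 0)"
    and A: "A \<in> derivations \<mu> \<inter> Sym" "trace A \<noteq> 0"
    and D: "einstein_derivation \<mu> D"
  shows "D_der \<mu> = D"
proof -
  have "\<not> (\<forall>A \<in> derivations \<mu> \<inter> Sym. trace A = 0)" using A by blast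
  then have "D_der \<mu> = (THE D. einstein_derivation \<mu> D)"
    unfolding D_der_def einstein_derivation_def by (rule if_not_P)
  also have "\<dots> = D"
    by (rule the_equality[where P = "einstein_derivation \<mu>", OF D])
      (rule einstein_derivation_unique[OF \<mu> A _ D])
  finally show ?thesis .
qed

lemma D_der_sym_derivation:
  fixes \<mu> :: "'n::finite bracket"
  assumes \<mu>: "\<mu> \<in> skew_bilinear" "\<mu> \<noteq> (\<lambda>X Y. 0)"
  shows "D_der \<mu> \<in> derivations \<mu> \<inter> Sym"
proof (cases "\<forall>A \<in> derivations \<mu> \<inter> Sym. trace A = 0")
  case True
  then have "D_der \<mu> = 0" by (simp add: D_der_def)
  then show ?thesis using subspace_0[OF subspace_sym_derivations[OF \<mu>(1)]] by simp
next
  case False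
  then obtain A where A: "A \<in> derivations \<mu> \<inter> Sym" "trace A \<noteq> 0" by blast
  obtain D where D: "einstein_derivation \<mu> D" using einstein_derivation_exists[OF \<mu> A] by blast
  then show ?thesis using D_der_eq[OF \<mu> A D] by (simp add: einstein_derivation_def)
qed

text \<open>For a soliton \<open>Ric = c I + D\<close>, orthogonality of \<open>Ric\<close> to all derivations forces \<open>c = c\<^sub>\<mu>\<close> and
  \<open>\<parallel>D\<parallel>\<^sup>2 = - c tr D\<close>; positivity of \<open>D\<close> excludes \<open>D = 0\<close>. So \<open>D / sqrt (tr D)\<close> is \<open>D\<^sub>\<mu>\<close>, and the
  Einstein equations hold in the direction \<open>H\<close> as well.\<close>

lemma soliton_D_der:
  fixes \<mu> :: "'n::finite bracket"
  assumes \<mu>: "\<mu> \<in> nilpotent_brackets" "\<mu> \<noteq> (\<lambda>X Y. 0)"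
    and E: "Ric \<mu> - c *\<^sub>R mat 1 \<in> derivations \<mu>"
  shows "c < 0" "\<exists>q>0. D_der \<mu> = q *\<^sub>R (Ric \<mu> - c *\<^sub>R mat 1)" "einstein (solv_bracket \<mu>)"
proof -
  have sk: "\<mu> \<in> skew_bilinear" by (rule nilpotent_skew[OF \<mu>(1)])
  define E where "E = Ric \<mu> - c *\<^sub>R mat 1"
  have ric: "Ric \<mu> = c *\<^sub>R mat 1 + E" by (simp add: E_def)
  have EW: "E \<in> derivations \<mu> \<inter> Sym"
    using E by (simp add: E_def Sym_def transpose_def[of "_ - _"] vec_eq_iff)
      (simp add: Ric_def mat_def ric_form_eq inner_commute mult.commute)
  have ortho: "Ric \<mu> \<bullet> A = 0" if "A \<in> derivations \<mu> \<inter> Sym" for A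
    using that Ric_orthogonal_derivation[OF sk] by blast
  have tr: "trace (Ric \<mu>) < 0" by (rule trace_Ric_neg[OF sk \<mu>(2)])
  have "Ric \<mu> \<bullet> Ric \<mu> = Ric \<mu> \<bullet> (c *\<^sub>R mat 1 + E)" using ric by simp
  then have "Ric \<mu> \<bullet> Ric \<mu> = c * trace (Ric \<mu>)"
    by (simp add: inner_add_right ortho[OF EW] inner_mat_1)
  then have c: "c = c_const \<mu>" using tr by (simp add: c_const_def trace_Ric_squared)
  then show neg: "c < 0" using c_const_neg[OF sk \<mu>(2)] by simp
  have "E \<noteq> 0"
  proof
    assume "E = 0"
    \<comment> \<open>every nonzero vector is then an eigenvector with eigenvalue \<open>0\<close>\<close>
    have "0 < (0::real)"
      by (rule soliton_eigenvalue_pos[OF \<mu>(1) ric _ neg, of "ax undefined"])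
        (use EW \<open>E = 0\<close> in \<open>auto simp: axis_eq_0_iff\<close>)
    then show False by simp
  qed
  then have EE: "0 < E \<bullet> E" by simp
  have "(c *\<^sub>R mat 1 + E) \<bullet> E = 0" using ortho[OF EW] ric by simp
  then have cE: "c * trace E = - (E \<bullet> E)"
    by (simp add: inner_add_left inner_commute[of "mat 1"] inner_mat_1)
  then have tE: "0 < trace E" using EE neg by (metis mult_nonpos_nonpos neg_0_le_iff_le not_le order_less_imp_le)
  define q where "q = 1 / sqrt (trace E)"
  have q: "0 < q" "q * q * trace E = 1" using tE by (auto simp: q_def)
  define D where "D = q *\<^sub>R E"
  have DE: "trace D *\<^sub>R D = E" using q(2) by (simp add: D_def trace_scaleR mult_ac)
  have "einstein_derivation \<mu> D"
    unfolding einstein_derivation_def DE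
  proof (intro conjI ballI)
    show "D \<in> derivations \<mu> \<inter> Sym"
      unfolding D_def by (rule subspace_scale[OF subspace_sym_derivations[OF sk] EW])
    show "0 \<le> trace D" using q(1) tE by (simp add: D_def trace_scaleR)
    show "orthogonal (c_const \<mu> *\<^sub>R mat 1 + E) A" if "A \<in> derivations \<mu> \<inter> Sym" for A
      using ortho[OF that] unfolding c[symmetric] ric[symmetric] orthogonal_def .
  qed
  then have D: "D_der \<mu> = D" using D_der_eq[OF sk \<mu>(2) EW] tE by simp
  then show "\<exists>q>0. D_der \<mu> = q *\<^sub>R (Ric \<mu> - c *\<^sub>R mat 1)"
    using q(1) unfolding D_def E_def by blast
  have "D \<bullet> D = q * q * (E \<bullet> E)" by (simp add: D_def)
  also have "\<dots> = - c * (q * q * trace E)" using cE by (simp add: algebra_simps)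
  finally have "D \<bullet> D = - c" using q(2) by simp
  then show "einstein (solv_bracket \<mu>)"
    using D_der_sym_derivation[OF sk \<mu>(2)] einstein_solv_iff[OF \<mu>(1)] ric D DE by (simp add: Sym_def)
qed

lemma einstein_iff_soliton:
  fixes \<mu> :: "'n::finite bracket"
  assumes \<mu>: "\<mu> \<in> nilpotent_brackets" "\<mu> \<noteq> (\<lambda>X Y. 0)"
  shows "einstein (solv_bracket \<mu>) \<longleftrightarrow> soliton \<mu>"
proof
  have sk: "\<mu> \<in> skew_bilinear" by (rule nilpotent_skew[OF \<mu>(1)])
  have W: "D_der \<mu> \<in> derivations \<mu>" "transpose (D_der \<mu>) = D_der \<mu>"
    using D_der_sym_derivation[OF sk \<mu>(2)] by (auto simp: Sym_def)
  assume "einstein (solv_bracket \<mu>)"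
  then have "Ric \<mu> - (- (D_der \<mu> \<bullet> D_der \<mu>)) *\<^sub>R mat 1 = trace (D_der \<mu>) *\<^sub>R D_der \<mu>"
    using einstein_solv_iff[OF \<mu>(1) W] by simp
  then show "soliton \<mu>"
    unfolding soliton_def using derivations_scaleR[OF sk W(1)] by metis
qed (use soliton_D_der(3)[OF \<mu>] in \<open>auto simp: soliton_def\<close>)

section \<open>Spectra of conjugate matrices\<close>

lemma conjugate_eigenspace:
  fixes A B P :: "real^'n^'n"
  assumes P: "invertible P" and A: "A = P ** B ** matrix_inv P"
  shows "{v. A *v v = l *\<^sub>R v} = (*v) P ` {v. B *v v = l *\<^sub>R v}"
proof (intro subset_antisym subsetI)
  fix v assume "v \<in> {v. A *v v = l *\<^sub>R v}"
  then have "P *v (B *v (matrix_inv P *v v)) = l *\<^sub>R v" by (simp add: A matrix_vector_mul_assoc matrix_mul_assoc)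
  then have "matrix_inv P *v (P *v (B *v (matrix_inv P *v v))) = matrix_inv P *v (l *\<^sub>R v)" by simp
  then have "B *v (matrix_inv P *v v) = l *\<^sub>R (matrix_inv P *v v)"
    by (simp add: matrix_inv_mult[OF P] matrix_vector_mult_scaleR)
  moreover have "v = P *v (matrix_inv P *v v)" by (simp add: matrix_inv_mult[OF P])
  ultimately show "v \<in> (*v) P ` {v. B *v v = l *\<^sub>R v}" by blast
next
  fix v assume "v \<in> (*v) P ` {v. B *v v = l *\<^sub>R v}"
  then show "v \<in> {v. A *v v = l *\<^sub>R v}"
    by (auto simp: A matrix_inv_mult[OF P] matrix_vector_mult_scaleR simp flip: matrix_vector_mul_assoc)
qed

lemma has_spectrum_conjugate:
  assumes "conjugate A B" and spec: "has_spectrum ((*v) B) ks ds"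
  shows "has_spectrum ((*v) A) ks ds"
proof -
  obtain P where P: "invertible P" and A: "A = P ** B ** matrix_inv P"
    using assms(1) unfolding conjugate_def by blast
  have inj: "inj ((*v) P)" by (rule injI) (metis P matrix_inv_mult(4))
  have dims: "dim {v. A *v v = l *\<^sub>R v} = dim {v. B *v v = l *\<^sub>R v}" for l
    unfolding conjugate_eigenspace[OF P A]
    by (rule dim_image_eq[OF matrix_vector_mul_linear]) (use inj in \<open>auto intro: inj_on_subset\<close>)
  have "(\<exists>v. v \<noteq> 0 \<and> A *v v = l *\<^sub>R v) \<longleftrightarrow> (\<exists>v. v \<noteq> 0 \<and> B *v v = l *\<^sub>R v)" for l
  proof -
    have "P *v v = 0 \<longleftrightarrow> v = 0" for v using inj_eq[OF inj, of v 0] by simp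
    moreover have "(\<exists>v. v \<noteq> 0 \<and> A *v v = l *\<^sub>R v) \<longleftrightarrow> (\<exists>v\<in>{v. A *v v = l *\<^sub>R v}. v \<noteq> 0)" by blast
    ultimately show ?thesis unfolding conjugate_eigenspace[OF P A] by auto
  qed
  then show ?thesis using spec unfolding has_spectrum_def dims by simp
qed

lemma eigenvalues_of_conjugate_diag:
  assumes B: "B \<in> diag_mats" and "conjugate B A"
  shows "{l. \<exists>v. v \<noteq> 0 \<and> A *v v = l *\<^sub>R v} = range (\<lambda>i. B $ i $ i)"
proof (intro subset_antisym subsetI)
  obtain P where P: "invertible P" and BA: "B = P ** A ** matrix_inv P"
    using assms(2) unfolding conjugate_def by blast
  have BP: "B *v (P *v v) = P *v (A *v v)" for v
    by (simp add: BA matrix_inv_mult[OF P] flip: matrix_vector_mul_assoc)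
  fix l assume "l \<in> {l. \<exists>v. v \<noteq> 0 \<and> A *v v = l *\<^sub>R v}"
  then obtain v where v: "v \<noteq> 0" "A *v v = l *\<^sub>R v" by blast
  define w where "w = P *v v"
  have "w \<noteq> 0" using v(1) matrix_inv_mult(4)[OF P, of v] by (auto simp: w_def)
  then obtain i where i: "w $ i \<noteq> 0" by (auto simp: vec_eq_iff)
  have "(B *v w) $ i = B $ i $ i * w $ i"
  proof -
    have "(B *v w) $ i = (\<Sum>j\<in>UNIV. if j = i then B $ i $ i * w $ i else 0)"
      unfolding matrix_vector_mult_def vec_lambda_beta
      using B by (intro sum.cong) (auto simp: diag_mats_def)
    then show ?thesis by simp
  qed
  moreover have "B *v w = l *\<^sub>R w" by (simp add: w_def BP v(2) matrix_vector_mult_scaleR)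
  ultimately have "l = B $ i $ i" using i by simp
  then show "l \<in> range (\<lambda>i. B $ i $ i)" by blast
next
  obtain P where P: "invertible P" and BA: "B = P ** A ** matrix_inv P"
    using assms(2) unfolding conjugate_def by blast
  fix l assume "l \<in> range (\<lambda>i. B $ i $ i)"
  then obtain i where l: "l = B $ i $ i" by blast
  define v where "v = matrix_inv P *v ax i"
  have "P *v v \<noteq> 0" by (simp add: v_def matrix_inv_mult[OF P] axis_eq_0_iff)
  then have "v \<noteq> 0" by auto
  moreover have "P *v (A *v v) = l *\<^sub>R (P *v v)"
    using diag_mult_axis[OF B, of i] by (simp add: BA v_def l matrix_inv_mult[OF P] flip: matrix_vector_mul_assoc)
  then have "A *v v = l *\<^sub>R v"
    by (metis P matrix_inv_mult(4) matrix_vector_mult_scaleR)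
  ultimately show "l \<in> {l. \<exists>v. v \<noteq> 0 \<and> A *v v = l *\<^sub>R v}" by blast
qed

text \<open>If \<open>f (x) > g (x)\<close>, then at most the \<open>y < x\<close> satisfy \<open>f (y) \<le> g (x)\<close>, but all \<open>y \<le> x\<close> satisfy
  \<open>g (y) \<le> g (x)\<close>; a rearrangement preserves the size of sublevel sets.\<close>

lemma mono_rearrangement_le:
  fixes f g :: "'n::{finite,linorder} \<Rightarrow> real"
  assumes f: "mono f" and g: "mono g" and p: "bij p" and fg: "\<And>i. f i = g (p i)"
  shows "f x \<le> g x"
proof (rule ccontr)
  assume less: "\<not> f x \<le> g x"
  have "card {y. f y \<le> g x} = card {y. g y \<le> g x}"
    by (rule bij_betw_same_card[of p]) (use p in \<open>auto simp: fg bij_betw_def bij_def inj_on_def surj_def image_iff\<close>)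
  moreover have "{y. f y \<le> g x} \<subseteq> {y. y < x}"
  proof
    fix y assume "y \<in> {y. f y \<le> g x}"
    then show "y \<in> {y. y < x}" using less monoD[OF f, of x y] by (cases "x \<le> y") auto
  qed
  then have "card {y. f y \<le> g x} \<le> card {y. y < x}" by (rule card_mono[rotated]) simp
  moreover have "card {y. y < x} < card {y. y \<le> x}"
    by (rule psubset_card_mono) auto
  moreover have "card {y. y \<le> x} \<le> card {y. g y \<le> g x}"
    by (rule card_mono) (use monoD[OF g] in auto)
  ultimately show False by linarith
qed

text \<open>A nonzero term in the expansion of \<open>det P\<close> is a permutation along which \<open>A P = P B\<close> matches the
  diagonal entries.\<close>

lemma diag_mats_incr_conjugate_eq:
  assumes A: "A \<in> diag_mats_incr" and B: "B \<in> diag_mats_incr" and AB: "conjugate A B"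
  shows "A = B"
proof -
  have dA: "A \<in> diag_mats" and dB: "B \<in> diag_mats" using A B by (auto simp: diag_mats_incr_def)
  obtain P where P: "invertible P" and AP: "A = P ** B ** matrix_inv P"
    using AB unfolding conjugate_def by blast
  have eq: "A ** P = P ** B" unfolding AP by (simp add: matrix_cancel(2)[OF P])
  have entries: "A $ i $ i * P $ i $ j = P $ i $ j * B $ j $ j" for i j
  proof -
    have l: "(A ** P) $ i $ j = (\<Sum>k\<in>UNIV. if k = i then A $ i $ i * P $ i $ j else 0)"
      unfolding matrix_matrix_mult_def vec_lambda_beta
      using dA by (intro sum.cong) (auto simp: diag_mats_def)
    have r: "(P ** B) $ i $ j = (\<Sum>k\<in>UNIV. if k = j then P $ i $ j * B $ j $ j else 0)"
      unfolding matrix_matrix_mult_def vec_lambda_beta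
      using dB by (intro sum.cong) (auto simp: diag_mats_def)
    show ?thesis using l[unfolded eq r] by (simp only: sum.delta finite UNIV_I if_True)
  qed
  have "det P \<noteq> 0" using P invertible_det_nz by blast
  then obtain p where p: "p permutes UNIV" and nz: "(\<Prod>i\<in>UNIV. P $ i $ p i) \<noteq> 0"
    unfolding det_def by (metis (mono_tags, lifting) mem_Collect_eq mult_zero_right sum.neutral)
  have perm: "A $ i $ i = B $ p i $ p i" for i
    using nz entries[of i "p i"] by (simp add: mult.commute)
  have bij: "bij p" using p by (rule permutes_bij)
  have mono: "mono (\<lambda>i. A $ i $ i)" "mono (\<lambda>i. B $ i $ i)"
    using A B by (auto simp: diag_mats_incr_def mono_def)
  have "A $ i $ i = B $ i $ i" for i
  proof (rule antisym)
    show "A $ i $ i \<le> B $ i $ i"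
      by (rule mono_rearrangement_le[OF mono bij]) (rule perm)
    show "B $ i $ i \<le> A $ i $ i"
      by (rule mono_rearrangement_le[OF mono(2,1) bij_imp_bij_inv[OF bij]])
        (simp add: perm surj_f_inv_f[OF bij_is_surj[OF bij]])
  qed
  then show ?thesis
    using dA dB by (intro matrix_eq_entries) (metis (mono_tags, lifting) diag_mats_def mem_Collect_eq)
qed

section \<open>Rationality of the eigenvalues\<close>

text \<open>Each step of the orthogonalisation of \<open>W\<close> divides by an inner product of rational vectors only,
  never by a norm.\<close>

lemma rational_projection:
  fixes x :: "'a::euclidean_space"
  assumes "finite W" "\<And>w b. w \<in> W \<Longrightarrow> b \<in> Basis \<Longrightarrow> w \<bullet> b \<in> \<rat>" "\<And>b. b \<in> Basis \<Longrightarrow> x \<bullet> b \<in> \<rat>"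
  shows "\<exists>y \<in> span W. (\<forall>w\<in>span W. orthogonal (x - y) w) \<and> (\<forall>b\<in>Basis. y \<bullet> b \<in> \<rat>)"
  using assms
proof (induction W arbitrary: x rule: finite_induct)
  case empty
  show ?case by (intro bexI[of _ 0]) (auto simp: orthogonal_def)
next
  case (insert a W)
  have aQ: "a \<bullet> b \<in> \<rat>" if "b \<in> Basis" for b using insert.prems(1) that by blast
  have WQ: "w \<bullet> b \<in> \<rat>" if "w \<in> W" "b \<in> Basis" for w b using insert.prems(1) that by blast
  obtain q where q: "q \<in> span W" "\<forall>w\<in>span W. orthogonal (a - q) w" "\<forall>b\<in>Basis. q \<bullet> b \<in> \<rat>"
    using insert.IH[OF WQ aQ] by blast
  obtain y where y: "y \<in> span W" "\<forall>w\<in>span W. orthogonal (x - y) w" "\<forall>b\<in>Basis. y \<bullet> b \<in> \<rat>"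
    using insert.IH[OF WQ insert.prems(2)] by blast
  define a' where "a' = a - q"
  have a'Q: "a' \<bullet> b \<in> \<rat>" if "b \<in> Basis" for b
    using aQ q(3) that by (simp add: a'_def inner_diff_left)
  show ?case
  proof (cases "a' = 0")
    case True
    then have "span (insert a W) = span W" using q(1) by (simp add: a'_def span_redundant)
    then show ?thesis using y by auto
  next
    case False
    define c where "c = (x \<bullet> a') / (a' \<bullet> a')"
    have cQ: "c \<in> \<rat>"
      unfolding c_def euclidean_inner[of _ a'] using a'Q insert.prems(2)
      by (intro Rats_divide Rats_sum Rats_mult) auto
    define z where "z = y + c *\<^sub>R a'"
    have sub: "span W \<subseteq> span (insert a W)" by (rule span_mono) blast
    have "q \<in> span (insert a W)" "y \<in> span (insert a W)" "a \<in> span (insert a W)"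
      using q(1) y(1) sub by (auto intro: span_base)
    then have "z \<in> span (insert a W)"
      unfolding z_def a'_def by (intro span_add span_scale span_diff)
    moreover have "\<forall>b\<in>Basis. z \<bullet> b \<in> \<rat>"
      using y(3) cQ a'Q by (simp add: z_def inner_add_left)
    moreover have "orthogonal (x - z) w" if w: "w \<in> span (insert a W)" for w
    proof (rule orthogonal_to_span[OF w])
      fix u assume u: "u \<in> insert a W"
      have W: "(x - z) \<bullet> w = 0" if "w \<in> span W" for w
        using q(2) y(2) that by (simp add: z_def a'_def orthogonal_def inner_simps)
      have "y \<bullet> a' = 0"
        using q(2) y(1) by (simp add: a'_def orthogonal_def inner_commute)
      then have "(x - z) \<bullet> a' = 0"
        using False by (simp add: z_def c_def inner_diff_left inner_add_left)
      then have "(x - z) \<bullet> a = 0"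
        using W[OF q(1)] by (simp add: a'_def inner_diff_right)
      then show "orthogonal (x - z) u"
        using u W[OF span_base] by (auto simp: orthogonal_def)
    qed
    ultimately show ?thesis by blast
  qed
qed

lemma primitive_integer_multiple:
  fixes r :: "'n::finite \<Rightarrow> real"
  assumes "\<And>i. r i \<in> \<rat>" "\<And>i. 0 < r i"
  obtains s and k :: "'n \<Rightarrow> nat" where "0 < s" "\<And>i. s * r i = real (k i)" "\<And>i. 0 < k i" "Gcd (range k) = 1"
proof -
  have "\<exists>n m. 0 < n \<and> 0 < m \<and> real n * r i = real m" for i
  proof -
    obtain m n where "n \<noteq> 0" "\<bar>r i\<bar> = real m / real n"
      using Rats_abs_nat_div_natE[OF assms(1)] by metis
    then have "0 < n" "real n * r i = real m" using assms(2)[of i] by (auto simp: field_simps)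
    moreover from this have "0 < m" using assms(2)[of i] by (metis mult_pos_pos of_nat_0_less_iff)
    ultimately show ?thesis by blast
  qed
  then obtain n m where n: "\<And>i. 0 < n i" and m: "\<And>i. 0 < m i" and nm: "\<And>i. real (n i) * r i = real (m i)"
    by metis
  define N where "N = (\<Prod>i\<in>UNIV. n i)"
  define M where "M i = (\<Prod>j\<in>UNIV - {i}. n j) * m i" for i
  have N: "0 < N" unfolding N_def by (rule prod_pos) (simp add: n)
  have NM: "real N * r i = real (M i)" for i
    unfolding N_def M_def by (subst prod.remove[of _ i]) (simp_all add: nm[symmetric] mult_ac)
  have M: "0 < M i" for i unfolding M_def using n m by (simp add: prod_pos)
  define G where "G = Gcd (range M)"
  have G: "G dvd M i" for i unfolding G_def by (rule Gcd_dvd) simp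
  have G0: "0 < G" using G M by (metis dvd_0_left_iff not_gr_zero)
  define k where "k i = M i div G" for i
  have kM: "k i * G = M i" for i using G by (simp add: k_def)
  show ?thesis
  proof (rule that)
    show "0 < real N / real G" using N G0 by simp
    show "real N / real G * r i = real (k i)" for i
      using NM[of i] G0 by (simp add: field_simps flip: kM)
    show "0 < k i" for i using M[of i] kM[of i] by (metis mult_is_0 not_gr_zero)
    have "Gcd (range k) * G dvd M i" for i
      unfolding kM[symmetric] by (intro mult_dvd_mono Gcd_dvd) auto
    then have "Gcd (range k) * G dvd G"
      unfolding G_def[symmetric] by (subst (2) G_def) (auto intro: Gcd_greatest)
    then show "Gcd (range k) = 1" using G0 by simp
  qed
qed

text \<open>All weights of a soliton in diagonal form lie on the hyperplane \<open>\<langle>b, \<cdot>\<rangle> = t\<close>, where \<open>b\<close> is the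
  moment map and is itself in the span of the weights. Since \<open>\<langle>I, \<alpha>\<rangle> = -1\<close> for each weight, \<open>- b / t\<close> is
  the orthogonal projection of \<open>I\<close> onto the span of the weights, and these have integer entries.\<close>

lemma rational_minimal_vector:
  assumes h: "b \<in> convex hull weights \<mu>" and t: "\<And>x. x \<in> weights \<mu> \<Longrightarrow> b \<bullet> x = t"
  shows "t = (norm b)\<^sup>2" "0 < t" "b $ i $ i / t \<in> \<rat>"
proof -
  have "b \<bullet> b = t" by (rule hull_weights_inner_const[OF t h])
  then show tb: "t = (norm b)\<^sup>2" by (simp add: power2_norm_eq_inner)
  have trace_w: "mat 1 \<bullet> x = -1" if "x \<in> weights \<mu>" for x
    using that trace_alpha by (auto simp: weights_def)
  have "mat 1 \<bullet> b = -1" by (rule hull_weights_inner_const[OF trace_w h])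
  then have "b \<noteq> 0" by auto
  then show t0: "0 < t" using tb by simp
  have entry: "x \<bullet> axis i (ax j) = x $ i $ j" for x :: "'a sq_mat" and i j
    by (simp add: inner_axis)
  have basis: "\<exists>i j. e = axis i (ax j)" if "e \<in> Basis" for e :: "'a sq_mat"
    using that by (auto simp: Basis_vec_def)
  have "w \<bullet> e \<in> \<rat>" if w: "w \<in> weights \<mu>" and e: "e \<in> Basis" for w e
  proof -
    obtain i j where "e = axis i (ax j)" using basis[OF e] by blast
    then show ?thesis using w entry by (auto simp: weights_def alpha_def E_mat_def)
  qed
  moreover have "mat 1 \<bullet> e \<in> \<rat>" if e: "e \<in> Basis" for e :: "'a sq_mat"
  proof -
    obtain i j where "e = axis i (ax j)" using basis[OF e] by blast
    then show ?thesis using entry[of "mat 1"] by (auto simp: mat_def)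
  qed
  ultimately obtain y where y: "y \<in> span (weights \<mu>)" "\<forall>w\<in>span (weights \<mu>). orthogonal (mat 1 - y) w"
    "\<forall>e\<in>Basis. y \<bullet> e \<in> \<rat>"
    using rational_projection[OF finite_weights, of \<mu> "mat 1"] by blast
  have "b \<in> span (weights \<mu>)"
    using h convex_hull_subset_span by blast
  then have s: "b + t *\<^sub>R y \<in> span (weights \<mu>)" using y(1) by (intro span_add span_scale)
  have "orthogonal (b + t *\<^sub>R y) (b + t *\<^sub>R y)"
  proof (rule orthogonal_to_span[OF s])
    fix w assume w: "w \<in> weights \<mu>"
    then have "y \<bullet> w = -1"
      using y(2) span_base[OF w] trace_w[OF w] by (simp add: orthogonal_def inner_diff_left)
    then show "orthogonal (b + t *\<^sub>R y) w" by (simp add: orthogonal_def inner_add_left t[OF w])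
  qed
  then have "b = - (t *\<^sub>R y)" by (simp add: orthogonal_self eq_neg_iff_add_eq_0)
  then have "b $ i $ i / t = - (y $ i $ i)" using t0 by simp
  moreover have "y $ i $ i \<in> \<rat>"
  proof -
    have "axis i (ax i) \<in> (Basis :: 'a sq_mat set)" by (auto simp: Basis_vec_def)
    then show ?thesis using y(3) entry[of y] by metis
  qed
  ultimately show "b $ i $ i / t \<in> \<rat>" by simp
qed

section \<open>Einstein solvmanifolds and strata\<close>

lemma eigenvalue_typeI:
  fixes \<mu> :: "'n::finite bracket" and k :: "'n \<Rightarrow> nat"
  assumes \<mu>: "\<mu> \<in> skew_bilinear" and h: "0 < h" and k: "\<And>i. 0 < k i" "Gcd (range k) = 1"
    and ev: "{l. \<exists>v. v \<noteq> 0 \<and> h *\<^sub>R (D_der \<mu> *v v) = l *\<^sub>R v} = range (\<lambda>i. real (k i))"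
  shows "\<exists>ks ds. eigenvalue_type \<mu> ks ds"
proof -
  define ks where "ks = sorted_list_of_set (range k)"
  define ds where "ds = map (\<lambda>k. dim {v. h *\<^sub>R (D_der \<mu> *v v) = real k *\<^sub>R v}) ks"
  have set: "set ks = range k" by (simp add: ks_def)
  have f: "(\<lambda>X. snd (solv_bracket \<mu> (h *\<^sub>R (1, 0)) (0, X))) = (\<lambda>v. h *\<^sub>R (D_der \<mu> *v v))"
    by (simp add: solv_bracket_def skew_bilinearD[OF \<mu>])
  have "has_spectrum (\<lambda>v. h *\<^sub>R (D_der \<mu> *v v)) ks ds"
    unfolding has_spectrum_def set ev by (auto simp: ds_def ks_def)
  then have "eigenvalue_type \<mu> ks ds"
    unfolding eigenvalue_type_def set using k h by (intro conjI exI[of _ h]) (simp_all only: f, auto)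
  then show ?thesis by blast
qed

theorem proposition3p4:
  fixes \<mu> :: "'n::{finite,linorder} bracket"
  assumes "\<mu> \<in> nilpotent_brackets" and "\<mu> \<noteq> (\<lambda>X Y. 0)"
  shows "(einstein (solv_bracket \<mu>) \<longrightarrow>
            (\<exists>\<beta>. \<beta> \<in> diag_mats_incr
               \<and> conjugate \<beta> ((4 / bracket_norm \<mu> ^ 2) *\<^sub>R Ric \<mu>)
               \<and> (\<forall>\<gamma> \<in> diag_mats_incr.
                    conjugate \<gamma> ((4 / bracket_norm \<mu> ^ 2) *\<^sub>R Ric \<mu>) \<longrightarrow> \<gamma> = \<beta>)
               \<and> \<mu> \<in> stratum \<beta>
               \<and> (\<exists>ks ds. eigenvalue_type \<mu> ks ds)
               \<and> (\<forall>ks ds. eigenvalue_type \<mu> ks ds \<longrightarrow>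
                    (\<exists>s > 0. has_spectrum ((*v) (s *\<^sub>R (\<beta> + (norm \<beta>)\<^sup>2 *\<^sub>R mat 1))) ks ds))))
       \<and> (\<forall>\<beta> \<in> diag_mats. \<mu> \<in> stratum \<beta> \<longrightarrow>
            (einstein (solv_bracket \<mu>) \<longleftrightarrow>
               conjugate ((4 / bracket_norm \<mu> ^ 2) *\<^sub>R Ric \<mu>) \<beta>)
          \<and> (conjugate ((4 / bracket_norm \<mu> ^ 2) *\<^sub>R Ric \<mu>) \<beta> \<longleftrightarrow>
               F_functional \<mu> = (norm \<beta>)\<^sup>2))"
  unfolding moment_def[symmetric]
proof (intro conjI impI ballI)
  fix \<beta> assume st: "\<mu> \<in> stratum \<beta>"
  show "einstein (solv_bracket \<mu>) \<longleftrightarrow> conjugate (moment \<mu>) \<beta>"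
    unfolding einstein_iff_soliton[OF assms] stratum_equality_iff[OF st] ..
  have "norm (moment \<mu>) = norm \<beta> \<longleftrightarrow> (norm (moment \<mu>))\<^sup>2 = (norm \<beta>)\<^sup>2"
    by (simp add: power2_eq_iff_nonneg)
  then show "conjugate (moment \<mu>) \<beta> \<longleftrightarrow> F_functional \<mu> = (norm \<beta>)\<^sup>2"
    unfolding stratum_equality_iff(2)[OF st] F_functional_eq_norm_moment .
next
  have sk: "\<mu> \<in> skew_bilinear" by (rule nilpotent_skew[OF assms(1)])
  assume "einstein (solv_bracket \<mu>)"
  then obtain t where t: "moment \<mu> + t *\<^sub>R mat 1 \<in> derivations \<mu>"
    using einstein_iff_soliton[OF assms] soliton_moment[OF sk assms(2)] by blast
  obtain K where K: "orthogonal_matrix K" and inc: "moment (gl_act K \<mu>) \<in> diag_mats_incr"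
    and mK: "moment (gl_act K \<mu>) = K ** moment \<mu> ** transpose K"
    and st: "\<mu> \<in> stratum (moment (gl_act K \<mu>))"
    and tn: "t = (norm (moment (gl_act K \<mu>)))\<^sup>2"
    and w: "\<And>x. x \<in> weights (gl_act K \<mu>) \<Longrightarrow> moment (gl_act K \<mu>) \<bullet> x = t"
    and hull: "moment (gl_act K \<mu>) \<in> convex hull weights (gl_act K \<mu>)"
    by (rule soliton_stratum[OF sk assms(2) t]) (rule that)
  define \<beta> where "\<beta> = moment (gl_act K \<mu>)"
  define T where "T = moment \<mu> + t *\<^sub>R mat 1"
  have conj: "conjugate \<beta> (moment \<mu>)"
    unfolding \<beta>_def mK by (rule conjugate_orthogonal[OF K])
  have "s *\<^sub>R (\<beta> + t *\<^sub>R mat 1) = K ** (s *\<^sub>R T) ** transpose K" for s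
    by (simp add: T_def \<beta>_def mK matrix_add_ldistrib matrix_add_rdistrib mult_scaleR_left
        mult_scaleR_right orthogonal_matrix_transpose_mult[OF K])
  then have conjT: "conjugate (s *\<^sub>R (\<beta> + t *\<^sub>R mat 1)) (s *\<^sub>R T)" for s
    using conjugate_orthogonal[OF K] by metis
  define N where "N = (bracket_norm \<mu>)\<^sup>2"
  have N: "0 < N" unfolding N_def by (rule bracket_norm_pos[OF sk assms(2)])
  have RT: "Ric \<mu> - (- t * N / 4) *\<^sub>R mat 1 = (N / 4) *\<^sub>R T"
    using N by (simp add: T_def moment_def N_def[symmetric] scaleR_add_right mult.commute)
  then have "Ric \<mu> - (- t * N / 4) *\<^sub>R mat 1 \<in> derivations \<mu>"
    using derivations_scaleR[OF sk t] by (simp add: T_def)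
  note sol = soliton_D_der[OF assms this]
  obtain q where q: "0 < q" "D_der \<mu> = q *\<^sub>R T"
  proof -
    obtain q where "0 < q" "D_der \<mu> = q *\<^sub>R ((N / 4) *\<^sub>R T)" using sol(2) unfolding RT by blast
    then show ?thesis using N by (intro that[of "q * (N / 4)"]) auto
  qed
  have bd: "\<beta> \<in> diag_mats" using inc by (simp add: \<beta>_def diag_mats_incr_def)
  have sd: "s *\<^sub>R (\<beta> + t *\<^sub>R mat 1) \<in> diag_mats" for s
    using bd by (auto simp: diag_mats_def mat_def)
  have evT: "{l. \<exists>v. v \<noteq> 0 \<and> (s *\<^sub>R T) *v v = l *\<^sub>R v} = range (\<lambda>i. s * (\<beta> $ i $ i + t))" for s
    using eigenvalues_of_conjugate_diag[OF sd conjT, of s] by (simp add: mat_def)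
  note rat = rational_minimal_vector[OF hull w, folded \<beta>_def]
  have pos: "0 < \<beta> $ i $ i + t" for i
  proof -
    have "(N / 4) * (\<beta> $ i $ i + t) \<in> {l. \<exists>v. v \<noteq> 0 \<and> ((N / 4) *\<^sub>R T) *v v = l *\<^sub>R v}"
      unfolding evT by blast
    then obtain v where v: "v \<noteq> 0" "((N / 4) *\<^sub>R T) *v v = ((N / 4) * (\<beta> $ i $ i + t)) *\<^sub>R v" by blast
    have "Ric \<mu> = (- t * N / 4) *\<^sub>R mat 1 + (N / 4) *\<^sub>R T" using RT by (simp add: algebra_simps)
    from soliton_eigenvalue_pos[OF assms(1) this derivations_scaleR[OF sk t[folded T_def]] sol(1) v(2,1)]
    show ?thesis using N by (simp add: zero_less_mult_iff)
  qed
  obtain s k where s: "0 < s" and sk_eq: "\<And>i. s * (\<beta> $ i $ i / t + 1) = real (k i)"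
    and k: "\<And>i. 0 < k i" "Gcd (range k) = 1"
  proof (rule primitive_integer_multiple[of "\<lambda>i. \<beta> $ i $ i / t + 1"])
    show "\<beta> $ i $ i / t + 1 \<in> \<rat>" for i using rat(3) by simp
    show "0 < \<beta> $ i $ i / t + 1" for i using pos[of i] rat(2) by (simp add: field_simps)
  qed (rule that)
  \<comment> \<open>\<open>h\<close> is chosen such that \<open>h D\<^sub>\<mu> = (s / t) (\<beta> + t I)\<close> up to conjugation\<close>
  define h where "h = s / (t * q)"
  have h: "0 < h" "h * q = s / t" using s rat(2) q(1) by (auto simp: h_def)
  have "h *\<^sub>R (D_der \<mu> *v v) = ((s / t) *\<^sub>R T) *v v" for v
    by (simp add: q(2) h(2)[symmetric] flip: scaleR_matrix_vector_assoc)
  moreover have "s / t * (\<beta> $ i $ i + t) = real (k i)" for i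
    using sk_eq[of i] rat(2) by (simp add: field_simps)
  ultimately have "{l. \<exists>v. v \<noteq> 0 \<and> h *\<^sub>R (D_der \<mu> *v v) = l *\<^sub>R v} = range (\<lambda>i. real (k i))"
    using evT[of "s / t"] by simp
  from eigenvalue_typeI[OF sk h(1) k this] have type: "\<exists>ks ds. eigenvalue_type \<mu> ks ds" .
  have spectrum: "\<forall>ks ds. eigenvalue_type \<mu> ks ds \<longrightarrow>
      (\<exists>s>0. has_spectrum ((*v) (s *\<^sub>R (\<beta> + (norm \<beta>)\<^sup>2 *\<^sub>R mat 1))) ks ds)"
  proof (intro allI impI)
    fix ks ds assume "eigenvalue_type \<mu> ks ds"
    then have "\<exists>h>0. has_spectrum (\<lambda>X. snd (solv_bracket \<mu> (h *\<^sub>R (1, 0)) (0, X))) ks ds"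
      by (simp only: eigenvalue_type_def)
    then obtain h where h: "0 < h"
      and spec: "has_spectrum (\<lambda>X. snd (solv_bracket \<mu> (h *\<^sub>R (1, 0)) (0, X))) ks ds" by auto
    have "(\<lambda>X. snd (solv_bracket \<mu> (h *\<^sub>R (1, 0)) (0, X))) = (*v) ((h * q) *\<^sub>R T)"
      by (rule ext) (simp add: solv_bracket_def skew_bilinearD[OF sk] q(2) flip: scaleR_matrix_vector_assoc)
    then have "has_spectrum ((*v) ((h * q) *\<^sub>R T)) ks ds" using spec by (simp only:)
    then have "has_spectrum ((*v) ((h * q) *\<^sub>R (\<beta> + (norm \<beta>)\<^sup>2 *\<^sub>R mat 1))) ks ds"
      unfolding \<beta>_def tn[symmetric] by (rule has_spectrum_conjugate[OF conjT[unfolded \<beta>_def]])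
    moreover have "0 < h * q" using h q(1) by simp
    ultimately show "\<exists>s>0. has_spectrum ((*v) (s *\<^sub>R (\<beta> + (norm \<beta>)\<^sup>2 *\<^sub>R mat 1))) ks ds"
      by (intro exI[of _ "h * q"] conjI)
  qed
  have unique: "\<forall>\<gamma> \<in> diag_mats_incr. conjugate \<gamma> (moment \<mu>) \<longrightarrow> \<gamma> = \<beta>"
  proof (intro ballI impI)
    fix \<gamma> assume "\<gamma> \<in> diag_mats_incr" and "conjugate \<gamma> (moment \<mu>)"
    then show "\<gamma> = \<beta>"
      using diag_mats_incr_conjugate_eq[OF _ inc[folded \<beta>_def]] conjugate_trans[OF _ conjugate_sym[OF conj]]
      by blast
  qed
  show "\<exists>\<beta>. \<beta> \<in> diag_mats_incr \<and> conjugate \<beta> (moment \<mu>)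
      \<and> (\<forall>\<gamma> \<in> diag_mats_incr. conjugate \<gamma> (moment \<mu>) \<longrightarrow> \<gamma> = \<beta>) \<and> \<mu> \<in> stratum \<beta>
      \<and> (\<exists>ks ds. eigenvalue_type \<mu> ks ds)
      \<and> (\<forall>ks ds. eigenvalue_type \<mu> ks ds \<longrightarrow>
            (\<exists>s > 0. has_spectrum ((*v) (s *\<^sub>R (\<beta> + (norm \<beta>)\<^sup>2 *\<^sub>R mat 1))) ks ds))"
    by (intro exI[of _ \<beta>] conjI inc[folded \<beta>_def] conj unique st[folded \<beta>_def] type spectrum)
qed

end
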